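(* Let $P$ and $Q$ be finite posets and let $P' \subseteq P$ be a subposet such that every order-preserving map $\phi: P' \to Q$ extends to an order-preserving map $P \to Q$. Then \[ \beta_{i}^{S_{P,Q}}(\mathbb{K}[P,Q]) \geq \beta_{i}^{S_{P',Q}}(\mathbb{K}[P',Q]) \] for all $i$.
   Context: All posets are finite and nonempty; subposets carry the induced order; $\mathbb{K}$ is an arbitrary field. $\operatorname{Hom}(P,Q)$ is the set of order-preserving maps $P\to Q$. $S_{P,Q}=\mathbb{K}[x_{p,q} : p\in P, q\in Q]$, $u_\phi=\prod_{p\in P}x_{p,\phi(p)}$, $L(P,Q)=(u_\phi : \phi\in \operatorname{Hom}(P,Q))\subseteq S_{P,Q}$ and $\mathbb{K}[P,Q]=S_{P,Q}/L(P,Q)$. $\beta^S_{i}(R)=\dim_{\mathbb K}\operatorname{Tor}_i^{S}(R,\mathbb{K})$ is the $i$-th total Betti number of $R$ over $S$. *)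

theory Defs
  imports
    "HOL-Algebra.QuotRing"
    "HOL-Library.FuncSet"
    "HOL-Library.Poly_Mapping"
    "Jordan_Normal_Form.VS_Connect"
begin

section \<open>Modules, tensor products and Tor\<close>

definition regular_module :: "('a, 'c) ring_scheme \<Rightarrow> ('a, 'a) module" where
  "regular_module A = ring.extend (ring.truncate A) (module.fields (mult A))"

definition restrict_scalars :: "('r \<Rightarrow> 'a) \<Rightarrow> ('a, 'b) module \<Rightarrow> ('r, 'b) module" where
  "restrict_scalars h M = ring.extend (ring.truncate M) (module.fields (\<lambda>r x. h r \<odot>\<^bsub>M\<^esub> x))"

text \<open>Module records extend ring records; the multiplicative fields are filled with dummy values here.\<close>

definition quot_module :: "('a, 'b, 'c) module_scheme \<Rightarrow> 'b set \<Rightarrow> ('a, 'b set) module" where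
  "quot_module M N =
     \<lparr>carrier = a_rcosets\<^bsub>M\<^esub> N, mult = (\<lambda>_ _. N), one = N, zero = N, add = set_add M,
      smult = (\<lambda>r X. \<Union>x\<in>X. N +>\<^bsub>M\<^esub> (r \<odot>\<^bsub>M\<^esub> x))\<rparr>"

text \<open>The free module on a possibly infinite basis \<open>B\<close>: functions of finite support.\<close>

definition free_module :: "('a, 'c) ring_scheme \<Rightarrow> 'b set \<Rightarrow> ('a, 'b \<Rightarrow> 'a) module" where
  "free_module R B = (ring.func_space R B)
     \<lparr>carrier := {f \<in> B \<rightarrow>\<^sub>E carrier R. finite {b \<in> B. f b \<noteq> \<zero>\<^bsub>R\<^esub>}}\<rparr>"

definition free_gen :: "('a, 'c) ring_scheme \<Rightarrow> 'b set \<Rightarrow> 'b \<Rightarrow> 'b \<Rightarrow> 'a" where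
  "free_gen R B b = (\<lambda>x\<in>B. if x = b then \<one>\<^bsub>R\<^esub> else \<zero>\<^bsub>R\<^esub>)"

definition tensor_relations ::
  "('a, 'c) ring_scheme \<Rightarrow> ('a, 'm) module \<Rightarrow> ('a, 'n) module \<Rightarrow> ('m \<times> 'n \<Rightarrow> 'a) set" where
  "tensor_relations R M N =
     (let B = carrier M \<times> carrier N; F = free_module R B; g = (\<lambda>m n. free_gen R B (m, n)) in
        {g (m \<oplus>\<^bsub>M\<^esub> m') n \<ominus>\<^bsub>F\<^esub> (g m n \<oplus>\<^bsub>F\<^esub> g m' n) | m m' n.
           m \<in> carrier M \<and> m' \<in> carrier M \<and> n \<in> carrier N}
      \<union> {g m (n \<oplus>\<^bsub>N\<^esub> n') \<ominus>\<^bsub>F\<^esub> (g m n \<oplus>\<^bsub>F\<^esub> g m n') | m n n'.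
           m \<in> carrier M \<and> n \<in> carrier N \<and> n' \<in> carrier N}
      \<union> {g (r \<odot>\<^bsub>M\<^esub> m) n \<ominus>\<^bsub>F\<^esub> (r \<odot>\<^bsub>F\<^esub> g m n) | r m n.
           r \<in> carrier R \<and> m \<in> carrier M \<and> n \<in> carrier N}
      \<union> {g m (r \<odot>\<^bsub>N\<^esub> n) \<ominus>\<^bsub>F\<^esub> (r \<odot>\<^bsub>F\<^esub> g m n) | r m n.
           r \<in> carrier R \<and> m \<in> carrier M \<and> n \<in> carrier N})"

definition tensor_kernel ::
  "('a, 'c) ring_scheme \<Rightarrow> ('a, 'm) module \<Rightarrow> ('a, 'n) module \<Rightarrow> ('m \<times> 'n \<Rightarrow> 'a) set" where
  "tensor_kernel R M N =
     LinearCombinations.module.span R (free_module R (carrier M \<times> carrier N)) (tensor_relations R M N)"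

definition tensor ::
  "('a, 'c) ring_scheme \<Rightarrow> ('a, 'm) module \<Rightarrow> ('a, 'n) module \<Rightarrow> ('a, ('m \<times> 'n \<Rightarrow> 'a) set) module" where
  "tensor R M N = quot_module (free_module R (carrier M \<times> carrier N)) (tensor_kernel R M N)"

definition pure_tensor ::
  "('a, 'c) ring_scheme \<Rightarrow> ('a, 'm) module \<Rightarrow> ('a, 'n) module \<Rightarrow> 'm \<Rightarrow> 'n \<Rightarrow> ('m \<times> 'n \<Rightarrow> 'a) set" where
  "pure_tensor R M N m n =
     tensor_kernel R M N +>\<^bsub>free_module R (carrier M \<times> carrier N)\<^esub>
       free_gen R (carrier M \<times> carrier N) (m, n)"

text \<open>The map \<open>f \<otimes> id\<^sub>N\<close> for a linear map \<open>f\<close> from \<open>M\<close> to \<open>M'\<close>.\<close>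

definition tensor_map ::
  "('a, 'c) ring_scheme \<Rightarrow> ('a, 'm) module \<Rightarrow> ('a, 'p) module \<Rightarrow> ('a, 'n) module \<Rightarrow> ('m \<Rightarrow> 'p)
     \<Rightarrow> ('m \<times> 'n \<Rightarrow> 'a) set \<Rightarrow> ('p \<times> 'n \<Rightarrow> 'a) set" where
  "tensor_map R M M' N f =
     (THE h. h \<in> extensional (carrier (tensor R M N))
           \<and> h \<in> LinearCombinations.module_hom R (tensor R M N) (tensor R M' N)
           \<and> (\<forall>m\<in>carrier M. \<forall>n\<in>carrier N. h (pure_tensor R M N m n) = pure_tensor R M' N (f m) n))"

text \<open>
  A resolution by free modules of finite rank,
  \<open>\<dots> \<longrightarrow> R\<^bsup>n 2\<^esup> \<longrightarrow> R\<^bsup>n 1\<^esup> \<longrightarrow> R\<^bsup>n 0\<^esup> \<longrightarrow> M \<longrightarrow> 0\<close>,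
  with differentials \<open>d (Suc i)\<close> from \<open>R\<^bsup>n (Suc i)\<^esup>\<close> to \<open>R\<^bsup>n i\<^esup>\<close> and augmentation \<open>e\<close>; the value \<open>d 0\<close>
  is not used. Every finitely generated module over a Noetherian ring has such a resolution.
\<close>

definition free_resolution ::
  "('a, 'c) ring_scheme \<Rightarrow> ('a, 'm) module \<Rightarrow> (nat \<Rightarrow> nat)
     \<Rightarrow> (nat \<Rightarrow> (nat \<Rightarrow> 'a) \<Rightarrow> (nat \<Rightarrow> 'a)) \<Rightarrow> ((nat \<Rightarrow> 'a) \<Rightarrow> 'm) \<Rightarrow> bool" where
  "free_resolution R M n d e \<longleftrightarrow>
     (let F = (\<lambda>i. free_module R {..<n i}) in
        e \<in> LinearCombinations.module_hom R (F 0) M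
      \<and> e ` carrier (F 0) = carrier M
      \<and> (\<forall>i. d (Suc i) \<in> LinearCombinations.module_hom R (F (Suc i)) (F i))
      \<and> a_kernel (F 0) M e = d 1 ` carrier (F 1)
      \<and> (\<forall>i. a_kernel (F (Suc i)) (F i) (d (Suc i)) = d (Suc (Suc i)) ` carrier (F (Suc (Suc i)))))"

text \<open>
  \<open>Tor\<^sub>i(M, N)\<close> over \<open>R\<close>: tensor a free resolution of \<open>M\<close> with \<open>N\<close>, drop the augmentation and take
  the \<open>i\<close>-th homology. Another choice of resolution gives an isomorphic module.
\<close>

definition Tor ::
  "('a, 'c) ring_scheme \<Rightarrow> nat \<Rightarrow> ('a, 'm) module \<Rightarrow> ('a, 'n) module
     \<Rightarrow> ('a, ((nat \<Rightarrow> 'a) \<times> 'n \<Rightarrow> 'a) set set) module" where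
  "Tor R i M N =
     (let (n, d, e) = (SOME (n, d, e). free_resolution R M n d e);
          F = (\<lambda>j. free_module R {..<n j});
          FN = (\<lambda>j. tensor R (F j) N);
          \<delta> = (\<lambda>j. tensor_map R (F (Suc j)) (F j) N (d (Suc j)));
          Z = (case i of 0 \<Rightarrow> carrier (FN 0) | Suc j \<Rightarrow> a_kernel (FN (Suc j)) (FN j) (\<delta> j));
          B = \<delta> i ` carrier (FN (Suc i))
      in quot_module ((FN i)\<lparr>carrier := Z\<rparr>) B)"

section \<open>Polynomial rings and Betti numbers\<close>

type_synonym ('v, 'k) mpoly = "('v \<Rightarrow>\<^sub>0 nat) \<Rightarrow>\<^sub>0 'k"

definition poly_ring :: "'v set \<Rightarrow> ('v, 'k::field) mpoly ring" where
  "poly_ring V =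
     class_ring\<lparr>carrier := {f. \<forall>m\<in>Poly_Mapping.keys f. Poly_Mapping.keys m \<subseteq> V}\<rparr>"

definition var :: "'v \<Rightarrow> ('v, 'k::field) mpoly" where
  "var v = Poly_Mapping.single (Poly_Mapping.single v 1) 1"

definition const :: "'k \<Rightarrow> ('v, 'k::field) mpoly" where
  "const c = Poly_Mapping.single 0 c"

definition const_coeff :: "('v, 'k::field) mpoly \<Rightarrow> 'k" where
  "const_coeff f = Poly_Mapping.lookup f 0"

text \<open>The field as a module over the polynomial ring, every variable acting as zero.\<close>

definition residue_module :: "(('v, 'k::field) mpoly, 'k) module" where
  "residue_module = restrict_scalars const_coeff (regular_module class_ring)"

definition betti :: "'v set \<Rightarrow> nat \<Rightarrow> (('v, 'k::field) mpoly, 'm) module \<Rightarrow> nat" where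
  "betti V i M =
     vectorspace.dim (class_ring :: 'k ring)
       (restrict_scalars const (Tor (poly_ring V) i M residue_module))"

section \<open>The algebras attached to a pair of posets\<close>

text \<open>Posets are subsets of types of class \<^class>\<open>order\<close>, with the induced order.\<close>

definition Hom :: "'p::order set \<Rightarrow> 'q::order set \<Rightarrow> ('p \<Rightarrow> 'q) set" where
  "Hom P Q = {\<phi> \<in> P \<rightarrow>\<^sub>E Q. mono_on P \<phi>}"

definition hom_monomial :: "'p set \<Rightarrow> ('p \<Rightarrow> 'q) \<Rightarrow> ('p \<times> 'q, 'k::field) mpoly" where
  "hom_monomial P \<phi> = (\<Prod>p\<in>P. var (p, \<phi> p))"

definition hom_ideal :: "'p::order set \<Rightarrow> 'q::order set \<Rightarrow> ('p \<times> 'q, 'k::field) mpoly set" where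
  "hom_ideal P Q = Idl\<^bsub>poly_ring (P \<times> Q)\<^esub> (hom_monomial P ` Hom P Q)"

definition hom_algebra ::
  "'p::order set \<Rightarrow> 'q::order set \<Rightarrow> ('p \<times> 'q, 'k::field) mpoly set ring" where
  "hom_algebra P Q = poly_ring (P \<times> Q) Quot hom_ideal P Q"

definition hom_algebra_module ::
  "'p::order set \<Rightarrow> 'q::order set \<Rightarrow> (('p \<times> 'q, 'k::field) mpoly, ('p \<times> 'q, 'k) mpoly set) module" where
  "hom_algebra_module P Q =
     restrict_scalars (\<lambda>f. hom_ideal P Q +>\<^bsub>poly_ring (P \<times> Q)\<^esub> f) (regular_module (hom_algebra P Q))"

end

theory Submission
  imports Defs "Jordan_Normal_Form.DL_Rank"
begin

text \<open>
  The extension hypothesis says that the monomials \<open>u\<^sub>\<phi>\<close> of \<open>L(P', Q)\<close> are obtained from those of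
  \<open>L(P, Q)\<close> by setting the variables \<open>x\<^sub>p\<^sub>,\<^sub>q\<close> with \<open>p\<close> outside \<open>P'\<close> to \<open>1\<close>. So both quotients have a
  free resolution with the same basis, the tuples of elements of \<open>Hom(P, Q)\<close>: a non-minimal Taylor
  resolution, exact because its part of multidegree \<open>u\<close> is a cone over any generator dividing the
  monomial \<open>u\<close>. Modulo the variables, the entry of the differential from \<open>t\<close> to \<open>s\<close> is the simplicial
  sign if \<open>t\<close> and \<open>s\<close> have the same least common multiple, and \<open>0\<close> otherwise. Filtering by the degree of
  the least common multiple for \<open>P\<close>, the reduced differential for \<open>P\<close> is the graded part of the one for
  \<open>P'\<close>, so its kernel is at least as large. As \<open>\<beta>\<^sub>i\<close> is the sum of the dimensions of the kernels in
  degrees \<open>i\<close> and \<open>i + 1\<close> minus the rank of the free module in degree \<open>i + 1\<close>, the inequality follows.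
\<close>

text \<open>Distinct maps in Hom(P, Q) may have the same restriction to \<open>P'\<close>, so the
  generators of L(P', Q) are listed with repetitions. This is harmless, and it is what gives two
  matrices of the same shape to compare. Tuples are ordered and may repeat entries, so that
  prepending a generator always gives another basis element and no order on Hom(P, Q) is chosen. The
  price is a resolution of infinite length, but of finite rank in each degree.

  Passing to the graded part can only enlarge a kernel and shrink an image. Betti numbers are
  therefore written with kernels only, both occurring with positive sign.

  The other obstacle is the shape of \<open>Tor\<close>: it is built from an arbitrarily chosen
  resolution and from a tensor product that is a quotient of the free module on all pairs. Hence
  independence of the resolution is proved with chain maps and a homotopy, given by matrices over
  the ring and then reduced entrywise to the field, and the tensor product of a free module of rank
  n with the field is identified with the coordinate space of dimension n.\<close>

definition vecs :: "'a::zero set \<Rightarrow> 'b set \<Rightarrow> ('b \<Rightarrow> 'a) set" where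
  "vecs A B = {x. (\<forall>b\<in>B. x b \<in> A) \<and> (\<forall>b. b \<notin> B \<longrightarrow> x b = 0)}"

text \<open>Vectors are rows: \<open>M t\<close> is the image of the basis element \<open>t\<close>.
  Only the coordinates of \<open>x\<close> in \<open>B\<close> are read, so \<open>x\<close> may be
  changed outside \<open>B\<close> at will.\<close>

definition lin_ext :: "'b set \<Rightarrow> ('b \<Rightarrow> 'c \<Rightarrow> 'a::comm_ring_1) \<Rightarrow> ('b \<Rightarrow> 'a) \<Rightarrow> 'c \<Rightarrow> 'a" where
  "lin_ext B M x = (\<lambda>s. \<Sum>t\<in>B. x t * M t s)"

lemma lin_ext_add: "lin_ext B M (\<lambda>t. x t + y t) = (\<lambda>s. lin_ext B M x s + lin_ext B M y s)"
  by (simp add: lin_ext_def distrib_right sum.distrib)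

lemma lin_ext_diff: "lin_ext B M (\<lambda>t. x t - y t) = (\<lambda>s. lin_ext B M x s - lin_ext B M y s)"
  by (simp add: lin_ext_def left_diff_distrib sum_subtractf)

lemma lin_ext_smult: "lin_ext B M (\<lambda>t. c * x t) = (\<lambda>s. c * lin_ext B M x s)"
  by (simp add: lin_ext_def sum_distrib_left mult.assoc)

lemma lin_ext_zero: "lin_ext B M (\<lambda>_. 0) = (\<lambda>_. 0)"
  by (simp add: lin_ext_def)

lemma lin_ext_cong: "(\<And>t. t \<in> B \<Longrightarrow> M t = M' t) \<Longrightarrow> lin_ext B M x = lin_ext B M' x"
  by (simp add: lin_ext_def)

lemma lin_ext_comp:
  "lin_ext C N (lin_ext B M x) = lin_ext B (\<lambda>t. lin_ext C N (M t)) x"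
proof
  fix s
  have "lin_ext C N (lin_ext B M x) s = (\<Sum>u\<in>C. \<Sum>t\<in>B. x t * (M t u * N u s))"
    by (simp add: lin_ext_def sum_distrib_right mult.assoc)
  also have "\<dots> = (\<Sum>t\<in>B. x t * (\<Sum>u\<in>C. M t u * N u s))"
    by (subst sum.swap) (simp add: sum_distrib_left)
  finally show "lin_ext C N (lin_ext B M x) s = lin_ext B (\<lambda>t. lin_ext C N (M t)) x s"
    by (simp add: lin_ext_def)
qed

lemma lin_ext_mat_diff:
  "lin_ext B (\<lambda>t s. M t s - N t s) x = (\<lambda>s. lin_ext B M x s - lin_ext B N x s)"
  by (simp add: lin_ext_def right_diff_distrib sum_subtractf)

section \<open>Subspaces of a coordinate space\<close>

text \<open>All subspaces of a coordinate space share these operations and differ in the carrier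
  alone, so images and kernels are again records of this form. The multiplicative fields are
  dummies.\<close>

definition kspace :: "('b \<Rightarrow> 'k::field) set \<Rightarrow> ('k, 'b \<Rightarrow> 'k) module" where
  "kspace U = \<lparr>carrier = U, mult = (\<lambda>_ _ _. 0), one = (\<lambda>_. 0), zero = (\<lambda>_. 0),
     add = (\<lambda>f g x. f x + g x), smult = (\<lambda>c f x. c * f x)\<rparr>"

definition ksubspace :: "('b \<Rightarrow> 'k::field) set \<Rightarrow> bool" where
  "ksubspace U \<longleftrightarrow> (\<lambda>_. 0) \<in> U \<and> (\<forall>x\<in>U. \<forall>y\<in>U. (\<lambda>b. x b + y b) \<in> U) \<and> (\<forall>c. \<forall>x\<in>U. (\<lambda>b. c * x b) \<in> U)"

abbreviation kdim :: "('b \<Rightarrow> 'k::field) set \<Rightarrow> nat" where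
  "kdim U \<equiv> vectorspace.dim (class_ring :: 'k ring) (kspace U)"

lemma kspace_simps [simp]:
  "carrier (kspace U) = U" "zero (kspace U) = (\<lambda>_. 0)" "add (kspace U) = (\<lambda>f g x. f x + g x)"
  "module.smult (kspace U) = (\<lambda>c f x. c * f x)" "(kspace U)\<lparr>carrier := W\<rparr> = kspace W"
  by (simp_all add: kspace_def)

lemma ksubspaceD:
  assumes "ksubspace U"
  shows "(\<lambda>_. 0) \<in> U" "\<And>x y. x \<in> U \<Longrightarrow> y \<in> U \<Longrightarrow> (\<lambda>b. x b + y b) \<in> U"
    "\<And>c x. x \<in> U \<Longrightarrow> (\<lambda>b. c * x b) \<in> U"
    "\<And>x y. x \<in> U \<Longrightarrow> y \<in> U \<Longrightarrow> (\<lambda>b. x b - y b) \<in> U"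
proof -
  show add: "\<And>x y. x \<in> U \<Longrightarrow> y \<in> U \<Longrightarrow> (\<lambda>b. x b + y b) \<in> U"
    and smult: "\<And>c x. x \<in> U \<Longrightarrow> (\<lambda>b. c * x b) \<in> U" and "(\<lambda>_. 0) \<in> U"
    using assms by (auto simp: ksubspace_def)
  show "(\<lambda>b. x b - y b) \<in> U" if "x \<in> U" "y \<in> U" for x y
    using add[OF that(1) smult[OF that(2), of "-1"]] by simp
qed

lemma vectorspace_kspace:
  fixes U :: "('b \<Rightarrow> 'k::field) set"
  assumes "ksubspace U"
  shows "vectorspace (class_ring :: 'k ring) (kspace U)"
proof -
  note D = ksubspaceD[OF assms]
  have neg: "\<exists>y\<in>U. (\<lambda>b. x b + y b) = (\<lambda>_. 0)" if "x \<in> U" for x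
    using D(3)[OF that, of "-1"] by (intro bexI[of _ "\<lambda>b. - 1 * x b"]) auto
  show ?thesis
    by (rule vs_criteria) (auto simp: class_field D neg algebra_simps)
qed

lemma ksubspace_vecs: "ksubspace (vecs UNIV B)"
  by (auto simp: ksubspace_def vecs_def)

lemma ksubspace_image:
  assumes U: "ksubspace U"
    and add: "\<And>x y. x \<in> U \<Longrightarrow> y \<in> U \<Longrightarrow> f (\<lambda>b. x b + y b) = (\<lambda>b. f x b + f y b)"
    and smult: "\<And>c x. x \<in> U \<Longrightarrow> f (\<lambda>b. c * x b) = (\<lambda>b. c * f x b)"
  shows "ksubspace (f ` U)"
proof -
  note D = ksubspaceD[OF U]
  have "f (\<lambda>_. 0) = (\<lambda>_. 0)"
    using smult[OF D(1), of 0] by simp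
  then have "(\<lambda>_. 0) \<in> f ` U"
    by (metis D(1) imageI)
  then show ?thesis
    unfolding ksubspace_def using D add[symmetric] smult[symmetric] by auto
qed

lemma ksubspace_kernel:
  assumes U: "ksubspace U" shows "ksubspace {x \<in> U. lin_ext B M x = (\<lambda>_. 0)}"
  using ksubspaceD[OF U] by (auto simp: ksubspace_def lin_ext_add lin_ext_smult lin_ext_zero)

text \<open>Induction on the coordinates. The vectors of \<open>U\<close> that vanish at
  \<open>b\<close> have a finite spanning set by induction; one further vector \<open>u\<close> with
  \<open>u b\<close> nonzero, if there is any, completes it, because subtracting a multiple of
  \<open>u\<close> clears the coordinate \<open>b\<close>.\<close>

lemma fin_dim_kspace:
  fixes U :: "('b \<Rightarrow> 'k::field) set"
  assumes "finite B" "ksubspace U" "U \<subseteq> vecs UNIV B"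
  shows "vectorspace.fin_dim (class_ring :: 'k ring) (kspace U)"
  using assms
proof (induction B arbitrary: U rule: finite_induct)
  case empty
  interpret V: vectorspace "class_ring :: 'k ring" "kspace U"
    by (rule vectorspace_kspace) fact
  have "U = {\<lambda>_. 0}"
    using empty ksubspaceD(1)[of U] by (auto simp: vecs_def)
  moreover have "V.span U \<subseteq> U" "U \<subseteq> V.span U"
    using V.span_is_subset2[of U] V.in_own_span[of U] by auto
  ultimately show ?case
    unfolding V.fin_dim_def by (intro exI[of _ U]) auto
next
  case (insert b B)
  interpret V: vectorspace "class_ring :: 'k ring" "kspace U"
    by (rule vectorspace_kspace) fact
  note D = ksubspaceD[OF insert.prems(1)]
  let ?W = "{x \<in> U. x b = 0}"
  have W: "ksubspace ?W"
    using D by (auto simp: ksubspace_def)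
  interpret W: vectorspace "class_ring :: 'k ring" "kspace ?W"
    by (rule vectorspace_kspace) fact
  have "?W \<subseteq> vecs UNIV B"
    using insert.prems(2) by (auto simp: vecs_def)
  then have "W.fin_dim"
    by (rule insert.IH[OF W])
  then obtain X where X: "finite X" "X \<subseteq> ?W" "W.span X = ?W"
    by (auto simp: W.fin_dim_def)
  have sub: "submodule class_ring ?W (kspace U)"
    using D V.module_axioms by (auto intro!: submodule.intro)
  have span: "V.span X = ?W"
    using V.span_li_not_depend(1)[OF X(2) sub] X(3) by simp
  show ?case
  proof (cases "\<forall>x\<in>U. x b = 0")
    case True
    then have "?W = U"
      by auto
    with X span show ?thesis
      by (auto simp: V.fin_dim_def intro!: exI[of _ X])
  next
    case False
    then obtain u where u: "u \<in> U" "u b \<noteq> 0"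
      by auto
    let ?Y = "insert u X"
    have Y: "?Y \<subseteq> carrier (kspace U)"
      using X u by auto
    have sp: "submodule class_ring (V.span ?Y) (kspace U)"
      by (rule V.span_is_submodule[OF Y])
    have "x \<in> V.span ?Y" if x: "x \<in> U" for x
    proof -
      let ?c = "x b / u b"
      have "(\<lambda>a. x a - ?c * u a) \<in> ?W"
        using D(4)[OF x D(3)[OF u(1), of ?c]] u by simp
      then have 1: "(\<lambda>a. x a - ?c * u a) \<in> V.span ?Y"
        using V.span_is_monotone[of X ?Y] span by blast
      have "u \<in> V.span ?Y"
        using V.in_own_span[OF Y] by blast
      then have "(\<lambda>a. ?c * u a) \<in> V.span ?Y"
        using submodule.smult_closed[OF sp, of ?c u] by simp
      from submodule.m_closed[OF sp 1 this] show ?thesis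
        by simp
    qed
    then have "V.span ?Y = U"
      using V.span_is_subset2[OF Y] by auto
    with X Y show ?thesis
      by (auto simp: V.fin_dim_def intro!: exI[of _ ?Y])
  qed
qed

lemma kdim_mono:
  fixes U W :: "('b \<Rightarrow> 'k::field) set"
  assumes "finite B" "ksubspace U" "ksubspace W" "U \<subseteq> W" "W \<subseteq> vecs UNIV B"
  shows "kdim U \<le> kdim W"
proof -
  interpret V: vectorspace "class_ring :: 'k ring" "kspace W"
    by (rule vectorspace_kspace) fact
  have "subspace class_ring U (kspace W)"
    using assms ksubspaceD[OF assms(2)] V.vectorspace_axioms V.module_axioms
    by (auto simp: subspace_def intro!: submodule.intro)
  then have "vectorspace.dim class_ring ((kspace W)\<lparr>carrier := U\<rparr>) \<le> V.dim"
    using assms by (intro V.subspace_dim) (auto intro!: fin_dim_kspace)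
  then show ?thesis by simp
qed

text \<open>The target is an arbitrary vector space because quotient modules occur there, among them
  the one whose dimension is a Betti number. The later conclusions supply the finite-dimensionality
  required when dimensions of subspaces of such a target are compared.\<close>

lemma rank_nullity_kspace:
  fixes U :: "('b \<Rightarrow> 'k::field) set"
  assumes B: "finite B" and U: "ksubspace U" "U \<subseteq> vecs UNIV B"
    and W: "vectorspace (class_ring :: 'k ring) W"
    and f: "f \<in> LinearCombinations.module_hom class_ring (kspace U) W"
  shows "vectorspace.dim class_ring (W\<lparr>carrier := f ` U\<rparr>) + kdim {x \<in> U. f x = \<zero>\<^bsub>W\<^esub>} = kdim U"
    and "f ` U = carrier W \<Longrightarrow> vectorspace.fin_dim class_ring W"
    and "subspace class_ring (f ` U) W"
    and "vectorspace.fin_dim class_ring (W\<lparr>carrier := f ` U\<rparr>)"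
proof -
  interpret V: vectorspace "class_ring :: 'k ring" "kspace U"
    by (rule vectorspace_kspace) fact
  interpret W: vectorspace "class_ring :: 'k ring" W
    by fact
  interpret linear_map "class_ring :: 'k ring" "kspace U" W f
    by unfold_locales (rule f)
  have fd: "V.fin_dim"
    by (rule fin_dim_kspace[OF B U])
  show "vectorspace.dim class_ring (W\<lparr>carrier := f ` U\<rparr>) + kdim {x \<in> U. f x = \<zero>\<^bsub>W\<^esub>} = kdim U"
    using rank_nullity[OF fd] by (simp add: im_def ker_def)
  show "f ` U = carrier W \<Longrightarrow> vectorspace.fin_dim class_ring W"
    using rank_nullity_main(2)[OF fd] by simp
  show im: "subspace class_ring (f ` U) W"
    using imT_is_subspace by (simp add: im_def)
  \<comment> \<open>With the codomain cut down to the image the map is onto, so the image is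
    finite-dimensional whatever \<open>W\<close> is.\<close>
  interpret I: vectorspace "class_ring :: 'k ring" "W\<lparr>carrier := f ` U\<rparr>"
    by (rule W.subspace_is_vs[OF im])
  interpret I: linear_map "class_ring :: 'k ring" "kspace U" "W\<lparr>carrier := f ` U\<rparr>" f
    using f by unfold_locales (auto simp: LinearCombinations.module_hom_def)
  show "vectorspace.fin_dim class_ring (W\<lparr>carrier := f ` U\<rparr>)"
    using I.rank_nullity_main(2)[OF fd] by simp
qed

lemma rank_nullity_kdim:
  fixes U :: "('b \<Rightarrow> 'k::field) set" and f :: "('b \<Rightarrow> 'k) \<Rightarrow> 'c \<Rightarrow> 'k"
  assumes B: "finite B" and U: "ksubspace U" "U \<subseteq> vecs UNIV B"
    and add: "\<And>x y. x \<in> U \<Longrightarrow> y \<in> U \<Longrightarrow> f (\<lambda>b. x b + y b) = (\<lambda>b. f x b + f y b)"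
    and smult: "\<And>c x. x \<in> U \<Longrightarrow> f (\<lambda>b. c * x b) = (\<lambda>b. c * f x b)"
  shows "kdim (f ` U) + kdim {x \<in> U. f x = (\<lambda>_. 0)} = kdim U"
proof -
  have W: "vectorspace (class_ring :: 'k ring) (kspace (UNIV :: ('c \<Rightarrow> 'k) set))"
    by (rule vectorspace_kspace) (simp add: ksubspace_def)
  have "f \<in> LinearCombinations.module_hom class_ring (kspace U) (kspace UNIV)"
    using add smult by (auto simp: LinearCombinations.module_hom_def)
  from rank_nullity_kspace(1)[OF B U W this] show ?thesis
    by simp
qed

section \<open>Quotient modules\<close>

lemma quot_module_simps:
  "carrier (quot_module M N) = a_rcosets\<^bsub>M\<^esub> N" "zero (quot_module M N) = N"
  "add (quot_module M N) = set_add M"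
  "module.smult (quot_module M N) = (\<lambda>r X. \<Union>x\<in>X. N +>\<^bsub>M\<^esub> (r \<odot>\<^bsub>M\<^esub> x))"
  by (simp_all add: quot_module_def)

lemma quot_module:
  assumes "module R M" and N: "submodule R N M"
  shows module_quot_module: "module R (quot_module M N)"
    and coset_hom: "(\<lambda>x. N +>\<^bsub>M\<^esub> x) \<in> LinearCombinations.module_hom R M (quot_module M N)"
    and carrier_quot_module: "carrier (quot_module M N) = (\<lambda>x. N +>\<^bsub>M\<^esub> x) ` carrier M"
    and coset_eq_iff: "\<And>x y. x \<in> carrier M \<Longrightarrow> y \<in> carrier M \<Longrightarrow>
      N +>\<^bsub>M\<^esub> x = N +>\<^bsub>M\<^esub> y \<longleftrightarrow> x \<ominus>\<^bsub>M\<^esub> y \<in> N"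
proof -
  interpret Module.module R M by fact
  note S = submodule.subset[OF N] submodule.m_closed[OF N] submodule.zero_closed[OF N]
    submodule.smult_closed[OF N]
  have neg: "\<ominus>\<^bsub>M\<^esub> x \<in> N" if "x \<in> N" for x
    using S(4)[of "\<ominus>\<^bsub>R\<^esub> \<one>\<^bsub>R\<^esub>" x] that S(1) smult_minus_1[of x] by auto
  interpret N: abelian_subgroup N M
  proof (rule abelian_subgroupI3)
    show "additive_subgroup N M"
      using S neg by (intro additive_subgroup.intro M.add.subgroupI) (auto simp: a_inv_def)
  qed (rule M.abelian_group_axioms)
  show carrier: "carrier (quot_module M N) = (\<lambda>x. N +>\<^bsub>M\<^esub> x) ` carrier M"
    by (auto simp: quot_module_simps A_RCOSETS_def')
  have eq: "N +>\<^bsub>M\<^esub> x = N +>\<^bsub>M\<^esub> y \<longleftrightarrow> x \<ominus>\<^bsub>M\<^esub> y \<in> N"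
    if "x \<in> carrier M" "y \<in> carrier M" for x y
  proof
    assume "N +>\<^bsub>M\<^esub> x = N +>\<^bsub>M\<^esub> y"
    then have "x \<in> N +>\<^bsub>M\<^esub> y"
      using N.a_rcos_self[OF that(1)] by simp
    then obtain n where n: "n \<in> N" "x = n \<oplus>\<^bsub>M\<^esub> y"
      by (auto simp: a_r_coset_def')
    then have "x \<ominus>\<^bsub>M\<^esub> y = n"
      using S(1) that by (auto simp: a_minus_def M.a_assoc M.r_neg subset_iff)
    with n show "x \<ominus>\<^bsub>M\<^esub> y \<in> N" by simp
  next
    assume "x \<ominus>\<^bsub>M\<^esub> y \<in> N"
    moreover have "x = (x \<ominus>\<^bsub>M\<^esub> y) \<oplus>\<^bsub>M\<^esub> y"
      using that by (simp add: a_minus_def M.a_assoc M.l_neg)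
    ultimately have "x \<in> N +>\<^bsub>M\<^esub> y"
      by (auto simp: a_r_coset_def')
    then show "N +>\<^bsub>M\<^esub> x = N +>\<^bsub>M\<^esub> y"
      using N.a_repr_independence' that(2) by blast
  qed
  then show "\<And>x y. x \<in> carrier M \<Longrightarrow> y \<in> carrier M \<Longrightarrow>
      N +>\<^bsub>M\<^esub> x = N +>\<^bsub>M\<^esub> y \<longleftrightarrow> x \<ominus>\<^bsub>M\<^esub> y \<in> N" .
  have add: "(N +>\<^bsub>M\<^esub> x) <+>\<^bsub>M\<^esub> (N +>\<^bsub>M\<^esub> y) = N +>\<^bsub>M\<^esub> (x \<oplus>\<^bsub>M\<^esub> y)"
    if "x \<in> carrier M" "y \<in> carrier M" for x y
    using that by (rule N.a_rcos_sum)
  \<comment> \<open>The scalar multiplication of \<open>quot_module\<close> is a union over all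
    representatives; each of them contributes the same coset.\<close>
  have smult: "(\<Union>z\<in>N +>\<^bsub>M\<^esub> x. N +>\<^bsub>M\<^esub> (r \<odot>\<^bsub>M\<^esub> z)) = N +>\<^bsub>M\<^esub> (r \<odot>\<^bsub>M\<^esub> x)"
    if "x \<in> carrier M" "r \<in> carrier R" for x r
  proof -
    have "N +>\<^bsub>M\<^esub> (r \<odot>\<^bsub>M\<^esub> z) = N +>\<^bsub>M\<^esub> (r \<odot>\<^bsub>M\<^esub> x)" if z: "z \<in> N +>\<^bsub>M\<^esub> x" for z
    proof -
      obtain n where n: "n \<in> N" "z = n \<oplus>\<^bsub>M\<^esub> x"
        using z by (auto simp: a_r_coset_def')
      then have nc: "n \<in> carrier M" "z \<in> carrier M"
        using S(1) \<open>x \<in> carrier M\<close> by auto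
      have "z \<ominus>\<^bsub>M\<^esub> x = n"
        using n nc \<open>x \<in> carrier M\<close> by (simp add: a_minus_def M.a_assoc M.r_neg)
      then have "r \<odot>\<^bsub>M\<^esub> z \<ominus>\<^bsub>M\<^esub> r \<odot>\<^bsub>M\<^esub> x = r \<odot>\<^bsub>M\<^esub> n"
        using nc that \<open>x \<in> carrier M\<close> \<open>r \<in> carrier R\<close>
        by (metis M.minus_eq smult_r_distr smult_r_minus M.a_inv_closed)
      then show ?thesis
        using S(4) n nc that \<open>x \<in> carrier M\<close> \<open>r \<in> carrier R\<close> by (subst eq) auto
    qed
    moreover have "x \<in> N +>\<^bsub>M\<^esub> x"
      using that by (simp add: N.a_rcos_self)
    ultimately show ?thesis
      by blast
  qed
  have zero: "N = N +>\<^bsub>M\<^esub> \<zero>\<^bsub>M\<^esub>"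
    using S(1) by (auto simp: a_r_coset_def' subset_iff)
  have add_N: "(N +>\<^bsub>M\<^esub> x) <+>\<^bsub>M\<^esub> N = N +>\<^bsub>M\<^esub> x" if "x \<in> carrier M" for x
    using add[OF that M.zero_closed] that by (simp flip: zero)
  have inv: "(N +>\<^bsub>M\<^esub> x) <+>\<^bsub>M\<^esub> (N +>\<^bsub>M\<^esub> (\<ominus>\<^bsub>M\<^esub> x)) = N" if "x \<in> carrier M" for x
    using add[OF that M.a_inv_closed[OF that]] that by (simp add: M.r_neg flip: zero)
  have mem: "N \<in> (\<lambda>x. N +>\<^bsub>M\<^esub> x) ` carrier M"
    using zero by blast
  have exinv: "\<forall>v\<in>(\<lambda>x. N +>\<^bsub>M\<^esub> x) ` carrier M. \<exists>w\<in>(\<lambda>x. N +>\<^bsub>M\<^esub> x) ` carrier M. v <+>\<^bsub>M\<^esub> w = N"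
    using inv by auto
  let ?Q = "quot_module M N"
  have smult': "r \<odot>\<^bsub>?Q\<^esub> (N +>\<^bsub>M\<^esub> x) = N +>\<^bsub>M\<^esub> (r \<odot>\<^bsub>M\<^esub> x)" if "x \<in> carrier M" "r \<in> carrier R" for x r
    using smult[OF that] by (simp add: quot_module_simps)
  note ops = add[folded quot_module_simps(3)[of M N]] smult'
    add_N[folded quot_module_simps(3)[of M N]] quot_module_simps(2)[of M N]
  show mod: "module R ?Q"
  proof (rule module_criteria[OF is_cring], unfold carrier)
    show "\<forall>v\<in>(\<lambda>x. N +>\<^bsub>M\<^esub> x) ` carrier M. \<exists>w\<in>(\<lambda>x. N +>\<^bsub>M\<^esub> x) ` carrier M. v \<oplus>\<^bsub>?Q\<^esub> w = \<zero>\<^bsub>?Q\<^esub>"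
      using exinv by (simp add: quot_module_simps)
  qed (auto simp: ops mem M.a_ac smult_assoc1 smult_l_distr smult_r_distr)
  show "(\<lambda>x. N +>\<^bsub>M\<^esub> x) \<in> LinearCombinations.module_hom R M ?Q"
    by (auto simp: LinearCombinations.module_hom_def carrier ops)
qed

lemma module_hom_zero:
  assumes "module R M" "module R N" "f \<in> LinearCombinations.module_hom R M N"
  shows "f \<zero>\<^bsub>M\<^esub> = \<zero>\<^bsub>N\<^esub>"
  using assms by (intro mod_hom.f0_is_0[of R]) (auto simp: mod_hom_def mod_hom_axioms_def)

lemma coset_eq_zero_iff:
  assumes M: "module R M" and N: "submodule R N M" and x: "x \<in> carrier M"
  shows "N +>\<^bsub>M\<^esub> x = N \<longleftrightarrow> x \<in> N"
proof -
  interpret Module.module R M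
    by fact
  have "N +>\<^bsub>M\<^esub> \<zero>\<^bsub>M\<^esub> = N"
    using module_hom_zero[OF M quot_module(1,2)[OF M N]] by (simp add: quot_module_simps)
  moreover have "x \<ominus>\<^bsub>M\<^esub> \<zero>\<^bsub>M\<^esub> = x"
    using x by (simp add: a_minus_def)
  ultimately show ?thesis
    using quot_module(4)[OF M N x, of "\<zero>\<^bsub>M\<^esub>"] by simp
qed

section \<open>Dimensions of kernels of filtered maps and of subquotients\<close>

lemma vecs_mono: "B \<subseteq> C \<Longrightarrow> 0 \<in> A \<Longrightarrow> vecs A B \<subseteq> vecs A C"
  by (auto simp: vecs_def)

text \<open>The functions \<open>v\<close> and \<open>w\<close> filter source and target,
  \<open>C'\<close> does not raise the level, and \<open>C\<close> is its associated graded map. The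
  top-level part of a vector killed by \<open>C'\<close> is killed by \<open>C\<close>; comparing
  these leading parts level by level and adding up their dimensions gives the inequality.\<close>

lemma kdim_kernel_filtration:
  fixes C C' :: "'b \<Rightarrow> 'c \<Rightarrow> 'k::field" and v :: "'b \<Rightarrow> nat" and w :: "'c \<Rightarrow> nat"
  assumes B: "finite B"
    and C: "\<And>t s. t \<in> B \<Longrightarrow> C t s = (if w s = v t then C' t s else 0)"
    and C': "\<And>t s. t \<in> B \<Longrightarrow> C' t s \<noteq> 0 \<Longrightarrow> w s \<le> v t"
  shows "kdim {x \<in> vecs UNIV B. lin_ext B C' x = (\<lambda>_. 0)}
       \<le> kdim {x \<in> vecs UNIV B. lin_ext B C x = (\<lambda>_. 0)}"
proof -
  let ?V = "\<lambda>n. vecs UNIV {t \<in> B. v t < n} :: ('b \<Rightarrow> 'k) set"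
  let ?K' = "\<lambda>n. {x \<in> ?V n. lin_ext B C' x = (\<lambda>_. 0)}"
  let ?K = "\<lambda>n. {x \<in> ?V n. lin_ext B C x = (\<lambda>_. 0)}"
  have sub: "ksubspace (?K n)" "ksubspace (?K' n)" for n
    by (auto intro!: ksubspace_kernel ksubspace_vecs)
  have V: "?V n \<subseteq> vecs UNIV B" for n
    by (rule vecs_mono) auto
  have le: "kdim (?K' n) \<le> kdim (?K n)" for n
  proof (induction n)
    case 0
    have "?K' 0 = ?K 0"
      by (auto simp: vecs_def lin_ext_def)
    then show ?case
      by simp
  next
    case (Suc n)
    \<comment> \<open>The projection to the coordinates of level exactly \<open>n\<close>. On the
      vectors of level at most \<open>n\<close> its kernel is the previous step of the filtration,
      so rank-nullity peels off one level.\<close>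
    let ?p = "\<lambda>x t. if v t = n then x t else (0 :: 'k)"
    have pV: "?p x \<in> vecs UNIV B" if "x \<in> vecs UNIV B" for x
      using that by (auto simp: vecs_def)
    have dim: "kdim (?p ` U) + kdim {x \<in> U. ?p x = (\<lambda>_. 0)} = kdim U"
      if "ksubspace U" "U \<subseteq> vecs UNIV B" for U
      by (rule rank_nullity_kdim[OF B that]) (auto simp: fun_eq_iff)
    have psub: "ksubspace (?p ` U)" if "ksubspace U" for U
      by (rule ksubspace_image[OF that]) (auto simp: fun_eq_iff)
    have ker: "{x \<in> ?V (Suc n). ?p x = (\<lambda>_. 0)} = ?V n"
      by (auto simp: vecs_def fun_eq_iff less_Suc_eq split: if_splits)
    have ker1: "{x \<in> ?K (Suc n). ?p x = (\<lambda>_. 0)} = ?K n"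
      and ker2: "{x \<in> ?K' (Suc n). ?p x = (\<lambda>_. 0)} = ?K' n"
      using ker by blast+
    have "?p ` ?K' (Suc n) \<subseteq> ?p ` ?K (Suc n)"
    proof
      fix y assume "y \<in> ?p ` ?K' (Suc n)"
      then obtain x where x: "x \<in> ?V (Suc n)" "lin_ext B C' x = (\<lambda>_. 0)" and y: "y = ?p x"
        by auto
      have "lin_ext B C y s = 0" for s
      proof (cases "w s = n")
        case True
        have "x t * C' t s = y t * C t s" if "t \<in> B" for t
        proof (cases "v t = n")
          case True
          then show ?thesis
            using C[OF that, of s] \<open>w s = n\<close> y by simp
        next
          case False
          \<comment> \<open>Above level \<open>n\<close> the coordinate \<open>x t\<close> vanishes.
            Below level \<open>n\<close> the entry \<open>C' t s\<close> vanishes, since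
            \<open>s\<close> has level \<open>n\<close> and \<open>C'\<close> cannot raise the
            level.\<close>
          then have "x t = 0 \<or> C' t s = 0"
            using x(1) C'[OF that, of s] \<open>w s = n\<close> by (force simp: vecs_def)
          then show ?thesis
            using False y by auto
        qed
        then have "lin_ext B C y s = lin_ext B C' x s"
          by (simp add: lin_ext_def)
        then show ?thesis
          using x by simp
      next
        case False
        \<comment> \<open>All of \<open>y\<close> sits in level \<open>n\<close>, and
          \<open>C\<close> preserves levels, so nothing reaches an \<open>s\<close> of another
          level.\<close>
        then show ?thesis
          using C y by (auto simp: lin_ext_def intro!: sum.neutral)
      qed
      moreover have "y \<in> ?V (Suc n)" "?p y = y"
        using x(1) y by (auto simp: vecs_def)
      ultimately show "y \<in> ?p ` ?K (Suc n)"
        by (intro image_eqI[of y ?p y]) auto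
    qed
    moreover have "?p ` ?K (Suc n) \<subseteq> vecs UNIV B"
      using pV V[of "Suc n"] by blast
    ultimately have "kdim (?p ` ?K' (Suc n)) \<le> kdim (?p ` ?K (Suc n))"
      by (rule kdim_mono[OF B psub[OF sub(2)] psub[OF sub(1)]])
    moreover have "kdim (?p ` ?K' (Suc n)) + kdim (?K' n) = kdim (?K' (Suc n))"
      using dim[OF sub(2), of "Suc n"] V[of "Suc n"] unfolding ker2 by blast
    moreover have "kdim (?p ` ?K (Suc n)) + kdim (?K n) = kdim (?K (Suc n))"
      using dim[OF sub(1), of "Suc n"] V[of "Suc n"] unfolding ker1 by blast
    ultimately show ?case
      using Suc.IH by linarith
  qed
  obtain n where "\<And>t. t \<in> B \<Longrightarrow> v t < n"
    using finite_nat_set_iff_bounded[of "v ` B"] B by auto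
  then have "{t \<in> B. v t < n} = B"
    by auto
  with le[of n] show ?thesis
    by simp
qed

lemma kdim_quotient:
  fixes Z N :: "('b \<Rightarrow> 'k::field) set"
  assumes B: "finite B" and Z: "ksubspace Z" "Z \<subseteq> vecs UNIV B" and N: "ksubspace N" "N \<subseteq> Z"
  shows "vectorspace (class_ring :: 'k ring) (quot_module (kspace Z) N)"
    and "vectorspace.fin_dim (class_ring :: 'k ring) (quot_module (kspace Z) N)"
    and "vectorspace.dim (class_ring :: 'k ring) (quot_module (kspace Z) N) + kdim N = kdim Z"
    and "(\<lambda>x. N +>\<^bsub>kspace Z\<^esub> x) \<in> LinearCombinations.module_hom class_ring (kspace Z) (quot_module (kspace Z) N)"
    and "\<And>x. x \<in> Z \<Longrightarrow> N +>\<^bsub>kspace Z\<^esub> x = N \<longleftrightarrow> x \<in> N"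
proof -
  let ?Q = "quot_module (kspace Z) N"
  interpret Z: vectorspace "class_ring :: 'k ring" "kspace Z"
    by (rule vectorspace_kspace) fact
  have M: "module (class_ring :: 'k ring) (kspace Z)"
    by (rule Z.module_axioms)
  have S: "submodule (class_ring :: 'k ring) N (kspace Z)"
    using N ksubspaceD[OF N(1)] M by (auto intro!: submodule.intro)
  note q = quot_module[OF M S]
  show Q: "vectorspace (class_ring :: 'k ring) ?Q"
    using q(1) class_field by (auto simp: vectorspace_def)
  show h: "(\<lambda>x. N +>\<^bsub>kspace Z\<^esub> x) \<in> LinearCombinations.module_hom class_ring (kspace Z) ?Q"
    by (rule q(2))
  show z: "N +>\<^bsub>kspace Z\<^esub> x = N \<longleftrightarrow> x \<in> N" if "x \<in> Z" for x
    by (rule coset_eq_zero_iff[OF M S]) (simp add: that)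
  have surj: "(\<lambda>x. N +>\<^bsub>kspace Z\<^esub> x) ` Z = carrier ?Q"
    using q(3) by simp
  have "{x \<in> Z. N +>\<^bsub>kspace Z\<^esub> x = \<zero>\<^bsub>?Q\<^esub>} = N"
    using z N by (auto simp: quot_module_simps)
  with rank_nullity_kspace(1)[OF B Z Q h]
  show "vectorspace.dim (class_ring :: 'k ring) ?Q + kdim N = kdim Z"
    unfolding surj by simp
  show "vectorspace.fin_dim (class_ring :: 'k ring) ?Q"
    by (rule rank_nullity_kspace(2)[OF B Z Q h surj])
qed

text \<open>The equivalence \<open>ker\<close> says that \<open>f\<close> induces a well-defined and
  injective map from Z / N to Z' / N'. Used in both directions between two complexes, this replaces
  an isomorphism of homology.\<close>

lemma kdim_quotient_le:
  fixes Z N :: "('b \<Rightarrow> 'k::field) set" and Z' N' :: "('c \<Rightarrow> 'k) set"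
  assumes B: "finite B" and Z: "ksubspace Z" "Z \<subseteq> vecs UNIV B" and N: "ksubspace N" "N \<subseteq> Z"
    and B': "finite B'" and Z': "ksubspace Z'" "Z' \<subseteq> vecs UNIV B'" and N': "ksubspace N'" "N' \<subseteq> Z'"
    and f: "\<And>x. x \<in> Z \<Longrightarrow> f x \<in> Z'"
    and add: "\<And>x y. x \<in> Z \<Longrightarrow> y \<in> Z \<Longrightarrow> f (\<lambda>b. x b + y b) = (\<lambda>b. f x b + f y b)"
    and smult: "\<And>c x. x \<in> Z \<Longrightarrow> f (\<lambda>b. c * x b) = (\<lambda>b. c * f x b)"
    and ker: "\<And>x. x \<in> Z \<Longrightarrow> f x \<in> N' \<longleftrightarrow> x \<in> N"
  shows "kdim Z - kdim N \<le> kdim Z' - kdim N'"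
proof -
  note q' = kdim_quotient[OF B' Z' N']
  let ?Q = "quot_module (kspace Z') N'"
  let ?g = "\<lambda>x. N' +>\<^bsub>kspace Z'\<^esub> f x"
  have h: "?g \<in> LinearCombinations.module_hom class_ring (kspace Z) ?Q"
    using q'(4) f ksubspaceD[OF Z(1)] add smult by (auto simp: LinearCombinations.module_hom_def)
  note r = rank_nullity_kspace[OF B Z q'(1) h]
  have "{x \<in> Z. ?g x = \<zero>\<^bsub>?Q\<^esub>} = N"
    using q'(5) f ker N by (auto simp: quot_module_simps)
  with r(1) have "vectorspace.dim class_ring (?Q\<lparr>carrier := ?g ` Z\<rparr>) + kdim N = kdim Z"
    by simp
  moreover have "vectorspace.dim class_ring (?Q\<lparr>carrier := ?g ` Z\<rparr>) \<le> vectorspace.dim class_ring ?Q"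
    by (rule vectorspace.subspace_dim[OF q'(1) r(3) q'(2) r(4)])
  ultimately show ?thesis
    using q'(3) by linarith
qed

section \<open>Complexes over the field given by reduced matrices\<close>

definition unit_vec :: "'b \<Rightarrow> 'b \<Rightarrow> 'a::comm_ring_1" where
  "unit_vec b = (\<lambda>t. if t = b then 1 else 0)"

lemma lin_ext_unit_vec: "finite B \<Longrightarrow> b \<in> B \<Longrightarrow> lin_ext B M (unit_vec b) = M b"
  by (auto simp: lin_ext_def unit_vec_def if_distrib[of "\<lambda>x. x * _"] cong: if_cong)

lemma lin_ext_id: "finite B \<Longrightarrow> x \<in> vecs A B \<Longrightarrow> lin_ext B unit_vec x = x"
  by (auto simp: lin_ext_def unit_vec_def vecs_def fun_eq_iff if_distrib[of "\<lambda>y. _ * y"] cong: if_cong)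

text \<open>Entrywise augmentation: for a matrix over the polynomial ring this is the matrix after
  tensoring with the residue field.\<close>

definition red :: "('a \<Rightarrow> 'k) \<Rightarrow> ('b \<Rightarrow> 'c \<Rightarrow> 'a) \<Rightarrow> 'b \<Rightarrow> 'c \<Rightarrow> 'k" where
  "red eps M = (\<lambda>t s. eps (M t s))"

text \<open>The matrix \<open>D i\<close> leads from degree \<open>Suc i\<close> to degree
  \<open>i\<close>. Everything in degree 0 is a cycle, since the augmentation is dropped.\<close>

fun kcycles :: "(nat \<Rightarrow> 'b set) \<Rightarrow> (nat \<Rightarrow> 'b \<Rightarrow> 'b \<Rightarrow> 'k::field) \<Rightarrow> nat \<Rightarrow> ('b \<Rightarrow> 'k) set" where
  "kcycles B D 0 = vecs UNIV (B 0)"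
| "kcycles B D (Suc i) = {x \<in> vecs UNIV (B (Suc i)). lin_ext (B (Suc i)) (D i) x = (\<lambda>_. 0)}"

definition kboundaries :: "(nat \<Rightarrow> 'b set) \<Rightarrow> (nat \<Rightarrow> 'b \<Rightarrow> 'b \<Rightarrow> 'k::field) \<Rightarrow> nat \<Rightarrow> ('b \<Rightarrow> 'k) set" where
  "kboundaries B D i = lin_ext (B (Suc i)) (D i) ` vecs UNIV (B (Suc i))"

lemma ksubspace_kcycles: "ksubspace (kcycles B D i)"
  by (cases i) (auto intro!: ksubspace_vecs ksubspace_kernel)

lemma kcycles_subset: "kcycles B D i \<subseteq> vecs UNIV (B i)"
  by (cases i) auto

lemma ksubspace_kboundaries: "ksubspace (kboundaries B D i)"
  unfolding kboundaries_def
  by (rule ksubspace_image) (auto intro: ksubspace_vecs simp: lin_ext_add lin_ext_smult)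

text \<open>This trades the boundaries in degree \<open>i\<close> for the cycles in degree
  \<open>Suc i\<close>, so that homology is measured by kernels, the quantities that
  \<open>kdim_kernel_filtration\<close> compares.\<close>

lemma kdim_kboundaries:
  fixes B :: "nat \<Rightarrow> 'b set" and D :: "nat \<Rightarrow> 'b \<Rightarrow> 'b \<Rightarrow> 'k::field"
  assumes "finite (B (Suc i))"
  shows "kdim (kboundaries B D i) + kdim (kcycles B D (Suc i)) = kdim (vecs UNIV (B (Suc i)) :: ('b \<Rightarrow> 'k::field) set)"
proof -
  have "kdim (lin_ext (B (Suc i)) (D i) ` vecs UNIV (B (Suc i)))
    + kdim {x \<in> vecs UNIV (B (Suc i)). lin_ext (B (Suc i)) (D i) x = (\<lambda>_. 0)}
    = kdim (vecs UNIV (B (Suc i)) :: ('b \<Rightarrow> 'k::field) set)"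
    by (rule rank_nullity_kdim[OF assms]) (auto intro: ksubspace_vecs simp: lin_ext_add lin_ext_smult)
  then show ?thesis
    by (simp add: kboundaries_def)
qed

section \<open>The comparison theorem for resolutions of A / I\<close>

text \<open>The model is \<open>polys V\<close> with \<open>const_coeff\<close>. \<open>A\<close> is
  a subset because the variables form a set and not a type, while \<open>eps\<close> is
  multiplicative on the whole type, which keeps its rules free of membership conditions.\<close>

locale augmented_subring =
  fixes A :: "'a::comm_ring_1 set" and eps :: "'a \<Rightarrow> 'k::field"
  assumes zero_A: "0 \<in> A" and one_A: "1 \<in> A" and uminus_A: "x \<in> A \<Longrightarrow> - x \<in> A"
    and add_A: "x \<in> A \<Longrightarrow> y \<in> A \<Longrightarrow> x + y \<in> A" and mult_A: "x \<in> A \<Longrightarrow> y \<in> A \<Longrightarrow> x * y \<in> A"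
    and eps_zero: "eps 0 = 0" and eps_one: "eps 1 = 1"
    and eps_add: "eps (x + y) = eps x + eps y" and eps_mult: "eps (x * y) = eps x * eps y"
begin

lemma diff_A: "x \<in> A \<Longrightarrow> y \<in> A \<Longrightarrow> x - y \<in> A"
  using add_A[of x "- y"] uminus_A[of y] by simp

lemma sum_A: "(\<And>t. t \<in> B \<Longrightarrow> f t \<in> A) \<Longrightarrow> sum f B \<in> A"
  by (induction B rule: infinite_finite_induct) (auto simp: zero_A add_A)

lemma eps_sum: "eps (sum f B) = (\<Sum>t\<in>B. eps (f t))"
  by (induction B rule: infinite_finite_induct) (auto simp: eps_zero eps_add)

lemma eps_diff: "eps (x - y) = eps x - eps y"
  using eps_add[of "x - y" y] by simp

lemma lin_ext_vecs:
  "(\<And>t. t \<in> B \<Longrightarrow> M t \<in> vecs A C) \<Longrightarrow> x \<in> vecs A B \<Longrightarrow> lin_ext B M x \<in> vecs A C"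
  by (auto simp: vecs_def lin_ext_def intro!: sum_A mult_A sum.neutral)

lemma vecs_diff: "x \<in> vecs A B \<Longrightarrow> y \<in> vecs A B \<Longrightarrow> (\<lambda>t. x t - y t) \<in> vecs A B"
  by (auto simp: vecs_def intro: diff_A)

lemma unit_vec_vecs: "b \<in> B \<Longrightarrow> unit_vec b \<in> vecs A B"
  by (auto simp: vecs_def unit_vec_def zero_A one_A)

lemma eps_lin_ext: "eps (lin_ext B M x s) = lin_ext B (red eps M) (\<lambda>t. eps (x t)) s"
  by (simp add: lin_ext_def red_def eps_sum eps_mult)

text \<open>Reduction commutes with matrix products. Together with \<open>red_eqD\<close> it carries
  identities between chain maps and homotopies down to the field.\<close>

lemma red_lin_ext: "red eps (\<lambda>t. lin_ext B M (x t)) = (\<lambda>t. lin_ext B (red eps M) (red eps x t))"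
  by (simp add: red_def fun_eq_iff eps_lin_ext)

lemma red_eqD:
  assumes "\<And>t. t \<in> B \<Longrightarrow> M t = N t"
  shows "lin_ext B (red eps M) x = lin_ext B (red eps N) x"
  by (rule lin_ext_cong) (simp add: red_def assms)

text \<open>Unlike \<open>kcycles\<close> this includes the augmentation: in degree 0 the cycles are
  the kernel of the map to A / I, represented by a lift \<open>E\<close> with values in
  \<open>A\<close>.\<close>

fun cycles :: "'a set \<Rightarrow> (nat \<Rightarrow> 'b set) \<Rightarrow> (nat \<Rightarrow> 'b \<Rightarrow> 'b \<Rightarrow> 'a) \<Rightarrow> ('b \<Rightarrow> 'a) \<Rightarrow> nat \<Rightarrow> ('b \<Rightarrow> 'a) set" where
  "cycles I B D E 0 = {x \<in> vecs A (B 0). (\<Sum>t\<in>B 0. x t * E t) \<in> I}"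
| "cycles I B D E (Suc i) = {x \<in> vecs A (B (Suc i)). lin_ext (B (Suc i)) (D i) x = (\<lambda>_. 0)}"

text \<open>Resolutions of \<open>A / I\<close> by free modules \<open>A\<^bsup>B i\<^esup>\<close>, with differentials and augmentation given by matrices.\<close>

definition mat_resolution ::
  "'a set \<Rightarrow> (nat \<Rightarrow> 'b set) \<Rightarrow> (nat \<Rightarrow> 'b \<Rightarrow> 'b \<Rightarrow> 'a) \<Rightarrow> ('b \<Rightarrow> 'a) \<Rightarrow> bool" where
  "mat_resolution I B D E \<longleftrightarrow>
     (\<forall>i. finite (B i)) \<and> (\<forall>i. \<forall>t\<in>B (Suc i). D i t \<in> vecs A (B i)) \<and> (\<forall>t\<in>B 0. E t \<in> A)
   \<and> (\<exists>x\<in>vecs A (B 0). (\<Sum>t\<in>B 0. x t * E t) - 1 \<in> I)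
   \<and> (\<forall>i. cycles I B D E i = lin_ext (B (Suc i)) (D i) ` vecs A (B (Suc i)))"

lemma mat_resolutionD:
  assumes "mat_resolution I B D E"
  shows "\<And>i. finite (B i)" "\<And>i t. t \<in> B (Suc i) \<Longrightarrow> D i t \<in> vecs A (B i)"
    "\<And>t. t \<in> B 0 \<Longrightarrow> E t \<in> A" "\<exists>x\<in>vecs A (B 0). (\<Sum>t\<in>B 0. x t * E t) - 1 \<in> I"
    "\<And>i. cycles I B D E i = lin_ext (B (Suc i)) (D i) ` vecs A (B (Suc i))"
    "\<And>i t. t \<in> B (Suc i) \<Longrightarrow> D i t \<in> cycles I B D E i"
proof -
  show fin: "\<And>i. finite (B i)" and "\<And>i t. t \<in> B (Suc i) \<Longrightarrow> D i t \<in> vecs A (B i)"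
    "\<And>t. t \<in> B 0 \<Longrightarrow> E t \<in> A" "\<exists>x\<in>vecs A (B 0). (\<Sum>t\<in>B 0. x t * E t) - 1 \<in> I"
    and ex: "\<And>i. cycles I B D E i = lin_ext (B (Suc i)) (D i) ` vecs A (B (Suc i))"
    using assms by (auto simp: mat_resolution_def)
  show "D i t \<in> cycles I B D E i" if "t \<in> B (Suc i)" for i t
    unfolding ex using that
    by (intro image_eqI[of _ _ "unit_vec t"]) (auto simp: lin_ext_unit_vec fin unit_vec_vecs)
qed

lemma cycles_vecs: "x \<in> cycles I B D E i \<Longrightarrow> x \<in> vecs A (B i)"
  by (cases i) auto

end

locale augmented_ideal = augmented_subring A eps
  for A :: "'a::comm_ring_1 set" and eps :: "'a \<Rightarrow> 'k::field" +
  fixes I :: "'a set"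
  assumes zero_I: "0 \<in> I" and add_I: "x \<in> I \<Longrightarrow> y \<in> I \<Longrightarrow> x + y \<in> I"
    and mult_I: "a \<in> A \<Longrightarrow> x \<in> I \<Longrightarrow> a * x \<in> I"
begin

lemma sum_I: "(\<And>t. t \<in> B \<Longrightarrow> f t \<in> I) \<Longrightarrow> sum f B \<in> I"
  by (induction B rule: infinite_finite_induct) (auto simp: zero_I add_I)

text \<open>The lifts \<open>E\<close> and \<open>E'\<close> can be compared only modulo
  \<open>I\<close>. Agreement on the basis extends to all vectors because \<open>I\<close> absorbs
  coefficients from \<open>A\<close>.\<close>

lemma augmentation_lin_ext:
  assumes x: "x \<in> vecs A B" and g: "\<And>t. t \<in> B \<Longrightarrow> (\<Sum>s\<in>C. g t s * E' s) - E t \<in> I"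
  shows "(\<Sum>s\<in>C. lin_ext B g x s * E' s) - (\<Sum>t\<in>B. x t * E t) \<in> I"
proof -
  have "(\<Sum>s\<in>C. lin_ext B g x s * E' s) = (\<Sum>s\<in>C. \<Sum>t\<in>B. x t * (g t s * E' s))"
    by (simp add: lin_ext_def sum_distrib_right mult.assoc)
  also have "\<dots> = (\<Sum>t\<in>B. x t * (\<Sum>s\<in>C. g t s * E' s))"
    by (subst sum.swap) (simp add: sum_distrib_left)
  finally have "(\<Sum>s\<in>C. lin_ext B g x s * E' s) - (\<Sum>t\<in>B. x t * E t)
    = (\<Sum>t\<in>B. x t * ((\<Sum>s\<in>C. g t s * E' s) - E t))"
    by (simp add: right_diff_distrib sum_subtractf)
  also have "\<dots> \<in> I"
    using x g by (intro sum_I mult_I) (auto simp: vecs_def)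
  finally show ?thesis .
qed

text \<open>The identity of A / I is lifted degree by degree: the source is free and the target
  exact. The invariant \<open>P\<close> also records that cycles go to cycles, which is what makes
  the next lift possible, and \<open>Q\<close> is the commuting square between consecutive
  degrees.\<close>

lemma chain_map_exists:
  fixes B :: "nat \<Rightarrow> 'b set" and B' :: "nat \<Rightarrow> 'c set"
  assumes R: "mat_resolution I B D E" and R': "mat_resolution I B' D' E'"
  obtains f where "\<And>i t. t \<in> B i \<Longrightarrow> f i t \<in> vecs A (B' i)"
    "\<And>t. t \<in> B 0 \<Longrightarrow> (\<Sum>s\<in>B' 0. f 0 t s * E' s) - E t \<in> I"
    "\<And>i t. t \<in> B (Suc i) \<Longrightarrow>
      lin_ext (B' (Suc i)) (D' i) (f (Suc i) t) = lin_ext (B i) (f i) (D i t)"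
proof -
  note r = mat_resolutionD[OF R] and r' = mat_resolutionD[OF R']
  define P where "P i g \<longleftrightarrow> (\<forall>t\<in>B i. g t \<in> vecs A (B' i))
    \<and> (\<forall>x\<in>cycles I B D E i. lin_ext (B i) g x \<in> cycles I B' D' E' i)
    \<and> (i = 0 \<longrightarrow> (\<forall>t\<in>B 0. (\<Sum>s\<in>B' 0. g t s * E' s) - E t \<in> I))"
    for i and g :: "'b \<Rightarrow> 'c \<Rightarrow> 'a"
  define Q where "Q i g h \<longleftrightarrow> (\<forall>t\<in>B (Suc i).
      lin_ext (B' (Suc i)) (D' i) (h t) = lin_ext (B i) g (D i t))"
    for i and g h :: "'b \<Rightarrow> 'c \<Rightarrow> 'a"
  have base: "\<exists>g. P 0 g"
  proof -
    \<comment> \<open>A preimage of 1 under the second augmentation; multiplying it by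
      \<open>E t\<close> gives a vector with the same augmentation as \<open>t\<close>, modulo
      \<open>I\<close>.\<close>
    obtain y where y: "y \<in> vecs A (B' 0)" "(\<Sum>t\<in>B' 0. y t * E' t) - 1 \<in> I"
      using r'(4) by auto
    define g where "g = (\<lambda>t s. E t * y s)"
    have g: "g t \<in> vecs A (B' 0)" if "t \<in> B 0" for t
      using y(1) r(3)[OF that] by (auto simp: g_def vecs_def intro: mult_A)
    have gE: "(\<Sum>s\<in>B' 0. g t s * E' s) - E t \<in> I" if "t \<in> B 0" for t
    proof -
      have "(\<Sum>s\<in>B' 0. g t s * E' s) - E t = E t * ((\<Sum>t\<in>B' 0. y t * E' t) - 1)"
        by (simp add: g_def right_diff_distrib sum_distrib_left mult.assoc)
      then show ?thesis
        using mult_I[OF r(3)[OF that] y(2)] by simp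
    qed
    have "lin_ext (B 0) g x \<in> cycles I B' D' E' 0" if "x \<in> cycles I B D E 0" for x
    proof -
      have x: "x \<in> vecs A (B 0)" "(\<Sum>t\<in>B 0. x t * E t) \<in> I"
        using that by auto
      have "(\<Sum>s\<in>B' 0. lin_ext (B 0) g x s * E' s) \<in> I"
        using add_I[OF augmentation_lin_ext[where E = E and E' = E', OF x(1) gE] x(2)] by simp
      then show ?thesis
        using lin_ext_vecs[OF g x(1)] by simp
    qed
    with g gE show ?thesis
      by (auto simp: P_def)
  qed
  have step: "\<exists>h. P (Suc i) h \<and> Q i g h" if P: "P i g" for i g
  proof -
    \<comment> \<open>The row \<open>D i t\<close> is a cycle, so its image under \<open>g\<close>
      is a cycle of the exact target and hence a boundary.\<close>
    have "\<exists>y\<in>vecs A (B' (Suc i)). lin_ext (B i) g (D i t) = lin_ext (B' (Suc i)) (D' i) y"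
      if "t \<in> B (Suc i)" for t
      using P r(6)[OF that] r'(5)[of i] by (auto simp: P_def)
    then obtain h where h: "\<And>t. t \<in> B (Suc i) \<Longrightarrow> h t \<in> vecs A (B' (Suc i))"
      "\<And>t. t \<in> B (Suc i) \<Longrightarrow> lin_ext (B i) g (D i t) = lin_ext (B' (Suc i)) (D' i) (h t)"
      by metis
    have "lin_ext (B (Suc i)) h x \<in> cycles I B' D' E' (Suc i)" if "x \<in> cycles I B D E (Suc i)" for x
    proof -
      have x: "x \<in> vecs A (B (Suc i))" "lin_ext (B (Suc i)) (D i) x = (\<lambda>_. 0)"
        using that by auto
      have "lin_ext (B' (Suc i)) (D' i) (lin_ext (B (Suc i)) h x)
          = lin_ext (B (Suc i)) (\<lambda>t. lin_ext (B i) g (D i t)) x"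
        unfolding lin_ext_comp by (rule lin_ext_cong) (simp add: h)
      also have "\<dots> = (\<lambda>_. 0)"
        by (simp add: lin_ext_comp[symmetric] x lin_ext_zero)
      finally show ?thesis
        using lin_ext_vecs[OF h(1) x(1)] by simp
    qed
    with h show ?thesis
      by (auto simp: P_def Q_def)
  qed
  obtain f where "\<And>i. P i (f i)" "\<And>i. Q i (f i) (f (Suc i))"
    using dependent_nat_choice[of P Q] base step by metis
  then show thesis
    by (intro that[of f]) (auto simp: P_def Q_def)
qed

text \<open>A chain map \<open>p\<close> from a resolution to itself that induces zero on A / I is
  null-homotopic. The invariant says that d h agrees with \<open>p\<close> on cycles, where the term
  h d drops out; applied to the cycle \<open>D i t\<close> it shows that p - h d takes values in
  cycles one degree higher, and exactness gives the next \<open>h\<close>.\<close>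

lemma homotopy_exists:
  fixes B :: "nat \<Rightarrow> 'b set"
  assumes R: "mat_resolution I B D E"
    and p: "\<And>i t. t \<in> B i \<Longrightarrow> p i t \<in> vecs A (B i)"
    and pE: "\<And>t. t \<in> B 0 \<Longrightarrow> (\<Sum>s\<in>B 0. p 0 t s * E s) \<in> I"
    and pD: "\<And>i t. t \<in> B (Suc i) \<Longrightarrow>
      lin_ext (B (Suc i)) (D i) (p (Suc i) t) = lin_ext (B i) (p i) (D i t)"
  obtains h where "\<And>t. t \<in> B 0 \<Longrightarrow> lin_ext (B (Suc 0)) (D 0) (h 0 t) = p 0 t"
    "\<And>i t. t \<in> B (Suc i) \<Longrightarrow> lin_ext (B (Suc (Suc i))) (D (Suc i)) (h (Suc i) t)
      = (\<lambda>s. p (Suc i) t s - lin_ext (B i) (h i) (D i t) s)"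
proof -
  note r = mat_resolutionD[OF R]
  define P where "P i g \<longleftrightarrow> (\<forall>t\<in>B i. g t \<in> vecs A (B (Suc i)))
    \<and> (\<forall>x\<in>cycles I B D E i. lin_ext (B (Suc i)) (D i) (lin_ext (B i) g x) = lin_ext (B i) (p i) x)
    \<and> (i = 0 \<longrightarrow> (\<forall>t\<in>B 0. lin_ext (B (Suc 0)) (D 0) (g t) = p 0 t))"
    for i and g :: "'b \<Rightarrow> 'b \<Rightarrow> 'a"
  define Q where "Q i g h \<longleftrightarrow> (\<forall>t\<in>B (Suc i). lin_ext (B (Suc (Suc i))) (D (Suc i)) (h t)
      = (\<lambda>s. p (Suc i) t s - lin_ext (B i) g (D i t) s))"
    for i and g h :: "'b \<Rightarrow> 'b \<Rightarrow> 'a"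
  have base: "\<exists>g. P 0 g"
  proof -
    have "\<exists>y\<in>vecs A (B (Suc 0)). p 0 t = lin_ext (B (Suc 0)) (D 0) y" if "t \<in> B 0" for t
      using p[OF that] pE[OF that] r(5)[of 0] by auto
    then obtain g where g: "\<And>t. t \<in> B 0 \<Longrightarrow> g t \<in> vecs A (B (Suc 0))"
      "\<And>t. t \<in> B 0 \<Longrightarrow> lin_ext (B (Suc 0)) (D 0) (g t) = p 0 t"
      by metis
    have "lin_ext (B (Suc 0)) (D 0) (lin_ext (B 0) g x) = lin_ext (B 0) (p 0) x" for x
      unfolding lin_ext_comp by (rule lin_ext_cong) (simp add: g)
    with g show ?thesis
      by (auto simp: P_def)
  qed
  have step: "\<exists>h. P (Suc i) h \<and> Q i g h" if P: "P i g" for i g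
  proof -
    have "\<exists>y\<in>vecs A (B (Suc (Suc i))). (\<lambda>s. p (Suc i) t s - lin_ext (B i) g (D i t) s)
        = lin_ext (B (Suc (Suc i))) (D (Suc i)) y" if t: "t \<in> B (Suc i)" for t
    proof -
      have "lin_ext (B (Suc i)) (D i) (lin_ext (B i) g (D i t)) = lin_ext (B i) (p i) (D i t)"
        using P r(6)[OF t] by (auto simp: P_def)
      then have "lin_ext (B (Suc i)) (D i) (\<lambda>s. p (Suc i) t s - lin_ext (B i) g (D i t) s) = (\<lambda>_. 0)"
        by (simp add: lin_ext_diff pD[OF t])
      moreover have "(\<lambda>s. p (Suc i) t s - lin_ext (B i) g (D i t) s) \<in> vecs A (B (Suc i))"
        using P by (intro vecs_diff p t lin_ext_vecs[OF _ r(2)[OF t]]) (auto simp: P_def)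
      ultimately have "(\<lambda>s. p (Suc i) t s - lin_ext (B i) g (D i t) s) \<in> cycles I B D E (Suc i)"
        by simp
      then show ?thesis
        unfolding r(5) by auto
    qed
    then obtain h where h: "\<And>t. t \<in> B (Suc i) \<Longrightarrow> h t \<in> vecs A (B (Suc (Suc i)))"
      "\<And>t. t \<in> B (Suc i) \<Longrightarrow> (\<lambda>s. p (Suc i) t s - lin_ext (B i) g (D i t) s)
        = lin_ext (B (Suc (Suc i))) (D (Suc i)) (h t)"
      by metis
    have "lin_ext (B (Suc (Suc i))) (D (Suc i)) (lin_ext (B (Suc i)) h x) = lin_ext (B (Suc i)) (p (Suc i)) x"
      if "x \<in> cycles I B D E (Suc i)" for x
    proof -
      have "lin_ext (B (Suc (Suc i))) (D (Suc i)) (lin_ext (B (Suc i)) h x)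
        = lin_ext (B (Suc i)) (\<lambda>t s. p (Suc i) t s - lin_ext (B i) g (D i t) s) x"
        unfolding lin_ext_comp by (rule lin_ext_cong) (simp add: h)
      also have "\<dots> = (\<lambda>s. lin_ext (B (Suc i)) (p (Suc i)) x s
          - lin_ext (B i) g (lin_ext (B (Suc i)) (D i) x) s)"
        unfolding lin_ext_mat_diff lin_ext_comp ..
      finally show ?thesis
        using that by (simp add: lin_ext_zero)
    qed
    with h show ?thesis
      by (auto simp: P_def Q_def)
  qed
  obtain f where "\<And>i. P i (f i)" "\<And>i. Q i (f i) (f (Suc i))"
    using dependent_nat_choice[of P Q] base step by metis
  then show thesis
    by (intro that[of f]) (auto simp: P_def Q_def)
qed

abbreviation "rcycles B D \<equiv> kcycles B (\<lambda>i. red eps (D i))"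
abbreviation "rboundaries B D \<equiv> kboundaries B (\<lambda>i. red eps (D i))"

lemma red_vecs: "M t \<in> vecs A C \<Longrightarrow> red eps M t \<in> vecs UNIV C"
  by (auto simp: vecs_def red_def eps_zero)

lemma lin_ext_vecs_UNIV:
  fixes M :: "'b \<Rightarrow> 'c \<Rightarrow> 'k"
  shows "(\<And>t. t \<in> B \<Longrightarrow> M t \<in> vecs UNIV C) \<Longrightarrow> lin_ext B M x \<in> vecs UNIV C"
  by (auto simp: vecs_def lin_ext_def intro!: sum.neutral)

lemma rboundaries_subset:
  assumes R: "mat_resolution I B D E"
  shows "rboundaries B D i \<subseteq> rcycles B D i"
proof -
  note r = mat_resolutionD[OF R]
  have 1: "rboundaries B D i \<subseteq> vecs UNIV (B i)"
    unfolding kboundaries_def by (auto intro!: lin_ext_vecs_UNIV red_vecs r(2))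
  show ?thesis
  proof (cases i)
    case 0
    then show ?thesis using 1 by simp
  next
    case (Suc j)
    have "lin_ext (B i) (red eps (D j)) (lin_ext (B (Suc i)) (red eps (D i)) x) = (\<lambda>_. 0)" for x
    proof -
      have "lin_ext (B i) (D j) (D i t) = (\<lambda>_. 0)" if "t \<in> B (Suc i)" for t
        using r(6)[OF that] Suc by simp
      then have "lin_ext (B (Suc i)) (red eps (\<lambda>t. lin_ext (B i) (D j) (D i t))) x = lin_ext (B (Suc i)) (red eps (\<lambda>t s. 0)) x"
        by (rule red_eqD)
      then show ?thesis
        unfolding lin_ext_comp red_lin_ext by (simp add: red_def lin_ext_def eps_zero)
    qed
    then show ?thesis
      using 1 Suc by (auto simp: kboundaries_def)
  qed
qed

text \<open>One half of the independence of Tor from the resolution. With chain maps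
  \<open>f\<close> and \<open>g\<close> in opposite directions, g f is homotopic to the identity, so
  the reduction of \<open>f\<close> is injective on homology. Exchanging the two resolutions gives
  the other half.\<close>

lemma homology_dim_le:
  fixes B :: "nat \<Rightarrow> 'b set" and B' :: "nat \<Rightarrow> 'c set"
  assumes R: "mat_resolution I B D E" and R': "mat_resolution I B' D' E'"
  shows "kdim (rcycles B D i) - kdim (rboundaries B D i)
    \<le> kdim (rcycles B' D' i) - kdim (rboundaries B' D' i)"
proof -
  note r = mat_resolutionD[OF R] and r' = mat_resolutionD[OF R']
  obtain f where f: "\<And>i t. t \<in> B i \<Longrightarrow> f i t \<in> vecs A (B' i)"
    and fE: "\<And>t. t \<in> B 0 \<Longrightarrow> (\<Sum>s\<in>B' 0. f 0 t s * E' s) - E t \<in> I"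
    and fD: "\<And>i t. t \<in> B (Suc i) \<Longrightarrow>
      lin_ext (B' (Suc i)) (D' i) (f (Suc i) t) = lin_ext (B i) (f i) (D i t)"
    using chain_map_exists[OF R R'] by blast
  obtain g where g: "\<And>i t. t \<in> B' i \<Longrightarrow> g i t \<in> vecs A (B i)"
    and gE: "\<And>t. t \<in> B' 0 \<Longrightarrow> (\<Sum>s\<in>B 0. g 0 t s * E s) - E' t \<in> I"
    and gD: "\<And>i t. t \<in> B' (Suc i) \<Longrightarrow>
      lin_ext (B (Suc i)) (D i) (g (Suc i) t) = lin_ext (B' i) (g i) (D' i t)"
    using chain_map_exists[OF R' R] by blast
  \<comment> \<open>The difference of g f and the identity: it induces zero on A / I and is
    therefore null-homotopic.\<close>
  define p where "p = (\<lambda>i t s. lin_ext (B' i) (g i) (f i t) s - unit_vec t s)"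
  have p: "p i t \<in> vecs A (B i)" if "t \<in> B i" for i t
    unfolding p_def using that by (intro vecs_diff lin_ext_vecs[OF g f] unit_vec_vecs)
  have pE: "(\<Sum>s\<in>B 0. p 0 t s * E s) \<in> I" if t: "t \<in> B 0" for t
  proof -
    have "(\<Sum>s\<in>B 0. unit_vec t s * E s) = E t"
      using t r(1)[of 0] by (simp add: unit_vec_def if_distrib[of "\<lambda>x. x * _"] cong: if_cong)
    then have "(\<Sum>s\<in>B 0. p 0 t s * E s)
      = ((\<Sum>s\<in>B 0. lin_ext (B' 0) (g 0) (f 0 t) s * E s) - (\<Sum>s\<in>B' 0. f 0 t s * E' s))
        + ((\<Sum>s\<in>B' 0. f 0 t s * E' s) - E t)"
      by (simp add: p_def left_diff_distrib sum_subtractf)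
    also have "\<dots> \<in> I"
      by (intro add_I augmentation_lin_ext f fE gE t)
    finally show ?thesis .
  qed
  have pD: "lin_ext (B (Suc i)) (D i) (p (Suc i) t) = lin_ext (B i) (p i) (D i t)"
    if t: "t \<in> B (Suc i)" for i t
  proof -
    have "lin_ext (B (Suc i)) (D i) (lin_ext (B' (Suc i)) (g (Suc i)) (f (Suc i) t))
      = lin_ext (B' (Suc i)) (\<lambda>u. lin_ext (B' i) (g i) (D' i u)) (f (Suc i) t)"
      unfolding lin_ext_comp by (rule lin_ext_cong) (simp add: gD)
    also have "\<dots> = lin_ext (B' i) (g i) (lin_ext (B i) (f i) (D i t))"
      by (simp add: lin_ext_comp[symmetric] fD[OF t])
    finally have 1: "lin_ext (B (Suc i)) (D i) (lin_ext (B' (Suc i)) (g (Suc i)) (f (Suc i) t))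
      = lin_ext (B' i) (g i) (lin_ext (B i) (f i) (D i t))" .
    have "lin_ext (B (Suc i)) (D i) (p (Suc i) t)
      = (\<lambda>s. lin_ext (B' i) (g i) (lin_ext (B i) (f i) (D i t)) s - D i t s)"
      unfolding p_def lin_ext_diff 1 using t r(1) by (simp add: lin_ext_unit_vec)
    also have "\<dots> = lin_ext (B i) (p i) (D i t)"
      unfolding p_def lin_ext_mat_diff lin_ext_comp using lin_ext_id[OF r(1) r(2)[OF t]] by simp
    finally show ?thesis .
  qed
  obtain h where h0: "\<And>t. t \<in> B 0 \<Longrightarrow> lin_ext (B (Suc 0)) (D 0) (h 0 t) = p 0 t"
    and hS: "\<And>i t. t \<in> B (Suc i) \<Longrightarrow> lin_ext (B (Suc (Suc i))) (D (Suc i)) (h (Suc i) t)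
      = (\<lambda>s. p (Suc i) t s - lin_ext (B i) (h i) (D i t) s)"
    using homotopy_exists[where p = p, OF R p pE pD] by blast
  let ?f = "\<lambda>i. lin_ext (B i) (red eps (f i))" and ?g = "\<lambda>i. lin_ext (B' i) (red eps (g i))"
  let ?D = "\<lambda>i. lin_ext (B (Suc i)) (red eps (D i))" and ?D' = "\<lambda>i. lin_ext (B' (Suc i)) (red eps (D' i))"
  let ?h = "\<lambda>i. lin_ext (B i) (red eps (h i))"
  have rf: "?D' i (?f (Suc i) x) = ?f i (?D i x)" for i x
    unfolding lin_ext_comp red_lin_ext[symmetric] by (rule red_eqD) (simp add: fD)
  have rg: "?D i (?g (Suc i) x) = ?g i (?D' i x)" for i x
    unfolding lin_ext_comp red_lin_ext[symmetric] by (rule red_eqD) (simp add: gD)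
  have rp: "lin_ext (B i) (red eps (p i)) x = (\<lambda>s. ?g i (?f i x) s - x s)" if "x \<in> vecs UNIV (B i)" for i x
  proof -
    have "red eps (p i) = (\<lambda>t s. lin_ext (B' i) (red eps (g i)) (red eps (f i) t) s - unit_vec t s)"
      by (auto simp: p_def red_def eps_diff eps_lin_ext unit_vec_def eps_zero eps_one fun_eq_iff)
    then show ?thesis
      by (simp add: lin_ext_mat_diff lin_ext_comp lin_ext_id[OF r(1) that])
  qed
  \<comment> \<open>Only for cycles: there the other half h d of the homotopy formula contributes
    nothing.\<close>
  have rh: "?D i (?h i x) = lin_ext (B i) (red eps (p i)) x" if x: "x \<in> rcycles B D i" for i x
  proof (cases i)
    case 0
    show ?thesis
      unfolding lin_ext_comp red_lin_ext[symmetric] 0 by (rule red_eqD) (simp add: h0)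
  next
    case (Suc j)
    have "?D i (?h i x) = lin_ext (B i) (red eps (\<lambda>t s. p i t s - lin_ext (B j) (h j) (D j t) s)) x"
      unfolding lin_ext_comp red_lin_ext[symmetric] Suc by (rule red_eqD) (simp add: hS)
    also have "\<dots> = lin_ext (B i) (\<lambda>t s. red eps (p i) t s - lin_ext (B j) (red eps (h j)) (red eps (D j) t) s) x"
      by (simp add: red_def eps_diff eps_lin_ext)
    also have "\<dots> = (\<lambda>s. lin_ext (B i) (red eps (p i)) x s - ?h j (?D j x) s)"
      unfolding lin_ext_mat_diff lin_ext_comp Suc ..
    finally show ?thesis
      using x Suc by (simp add: lin_ext_zero)
  qed
  have fB: "?f i x \<in> vecs UNIV (B' i)" for i x
    by (intro lin_ext_vecs_UNIV red_vecs f)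
  show ?thesis
  proof (rule kdim_quotient_le[where f = "?f i"])
    show "finite (B i)" "finite (B' i)"
      using r(1) r'(1) .
    show "ksubspace (rcycles B D i)" "ksubspace (rcycles B' D' i)"
      "ksubspace (rboundaries B D i)" "ksubspace (rboundaries B' D' i)"
      "rcycles B D i \<subseteq> vecs UNIV (B i)" "rcycles B' D' i \<subseteq> vecs UNIV (B' i)"
      "rboundaries B D i \<subseteq> rcycles B D i" "rboundaries B' D' i \<subseteq> rcycles B' D' i"
      by (rule ksubspace_kcycles ksubspace_kboundaries kcycles_subset rboundaries_subset[OF R]
          rboundaries_subset[OF R'])+
    fix x assume x: "x \<in> rcycles B D i"
    then have xB: "x \<in> vecs UNIV (B i)"
      using kcycles_subset by blast
    show "?f i x \<in> rcycles B' D' i"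
    proof (cases i)
      case (Suc j)
      then have "?D' j (?f i x) = (\<lambda>_. 0)"
        using x by (simp add: rf lin_ext_zero)
      then show ?thesis
        using fB Suc by simp
    qed (use fB in simp)
    show "?f i x \<in> rboundaries B' D' i \<longleftrightarrow> x \<in> rboundaries B D i"
    proof
      assume "?f i x \<in> rboundaries B' D' i"
      then obtain y where y: "y \<in> vecs UNIV (B' (Suc i))" "?f i x = ?D' i y"
        by (auto simp: kboundaries_def)
      \<comment> \<open>If f x is the boundary of \<open>y\<close>, then g f x is the boundary of g
        y, while g f x - x is the boundary of h x; so \<open>x\<close> is itself a boundary.\<close>
      have "?D i (\<lambda>s. ?g (Suc i) y s - ?h i x s) = (\<lambda>s. ?g i (?f i x) s - (?g i (?f i x) s - x s))"
        unfolding lin_ext_diff rg rh[OF x] rp[OF xB] y(2) ..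
      then have "x = ?D i (\<lambda>s. ?g (Suc i) y s - ?h i x s)"
        by simp
      \<comment> \<open>The homotopy comes without control of its support, so \<open>z\<close> may
        be nonzero off the basis; truncating it there does not change the image.\<close>
      moreover have "?D i z \<in> rboundaries B D i" for z
      proof -
        have "?D i z = ?D i (\<lambda>t. if t \<in> B (Suc i) then z t else 0)"
          by (simp add: lin_ext_def)
        then show ?thesis
          by (auto simp: kboundaries_def vecs_def)
      qed
      ultimately show "x \<in> rboundaries B D i"
        by metis
    next
      assume "x \<in> rboundaries B D i"
      then obtain y where "x = ?D i y"
        by (auto simp: kboundaries_def)
      then have "?f i x = ?D' i (?f (Suc i) y)"
        by (simp add: rf)
      then show "?f i x \<in> rboundaries B' D' i"
        using fB by (auto simp: kboundaries_def)
    qed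
  qed (simp_all add: lin_ext_add lin_ext_smult)
qed

end

section \<open>Polynomials and squarefree monomials\<close>

abbreviation "lookup \<equiv> Poly_Mapping.lookup"
abbreviation "keys \<equiv> Poly_Mapping.keys"
abbreviation "single \<equiv> Poly_Mapping.single"

definition polys :: "'v set \<Rightarrow> ('v, 'k::field) mpoly set" where
  "polys V = {f. \<forall>m\<in>keys f. keys m \<subseteq> V}"

lemma polysD: "f \<in> polys V \<Longrightarrow> lookup f m \<noteq> 0 \<Longrightarrow> keys m \<subseteq> V"
  by (auto simp: polys_def in_keys_iff)

lemma polysI: "(\<And>m. lookup f m \<noteq> 0 \<Longrightarrow> keys m \<subseteq> V) \<Longrightarrow> f \<in> polys V"
  by (auto simp: polys_def in_keys_iff)

lemma keys_add_nat: "keys (m + n :: 'v \<Rightarrow>\<^sub>0 nat) = keys m \<union> keys n"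
  by (auto simp: in_keys_iff lookup_add)

lemma const_coeff_mult: "const_coeff (f * g) = const_coeff f * const_coeff g"
  for f g :: "('v, 'k::field) mpoly"
proof -
  have eq: "(0 :: 'v \<Rightarrow>\<^sub>0 nat) = l + q \<longleftrightarrow> l = 0 \<and> q = 0" for l q
    by (auto simp: poly_mapping_eq_iff fun_eq_iff lookup_add)
  have "(lookup g q when 0 = l + q) = ((lookup g 0 when l = 0) when q = 0)" for l q
    by (auto simp: eq when_def)
  then have "lookup (f * g) 0 = (\<Sum>l. lookup f l * (lookup g 0 when l = 0))"
    by (simp add: lookup_mult)
  also have "\<dots> = (\<Sum>l::'v \<Rightarrow>\<^sub>0 nat. lookup f 0 * lookup g 0 when l = 0)"
    by (rule Sum_any.cong) (auto simp: when_def)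
  finally show ?thesis
    by (simp add: const_coeff_def)
qed

interpretation polys: augmented_subring "polys V :: ('v, 'k::field) mpoly set" const_coeff
proof
  show "(1 :: ('v, 'k) mpoly) \<in> polys V"
    by (auto simp: polys_def)
  show "f * g \<in> polys V" if "f \<in> polys V" "g \<in> polys V" for f g :: "('v, 'k) mpoly"
  proof (unfold polys_def, intro CollectI ballI)
    fix m assume "m \<in> keys (f * g)"
    then obtain a b where "a \<in> keys f" "b \<in> keys g" "m = a + b"
      using keys_mult[of f g] by auto
    then show "keys m \<subseteq> V"
      using that by (auto simp: polys_def keys_add_nat)
  qed
  show "f + g \<in> polys V" if "f \<in> polys V" "g \<in> polys V" for f g :: "('v, 'k) mpoly"
    using that Poly_Mapping.keys_add[of f g] by (auto simp: polys_def)
  show "- f \<in> polys V" if "f \<in> polys V" for f :: "('v, 'k) mpoly"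
    using that by (auto simp: polys_def in_keys_iff)
  show "const_coeff (f * g) = const_coeff f * const_coeff g" for f g :: "('v, 'k) mpoly"
    by (rule const_coeff_mult)
qed (auto simp: polys_def const_coeff_def lookup_add lookup_one)

lemma sum_single_lookup: "(\<Sum>m\<in>keys f. single m (lookup f m)) = f"
  by (rule poly_mapping_eqI)
    (auto simp: lookup_sum lookup_single when_def in_keys_iff if_distrib cong: if_cong)

text \<open>The guard says that the monomial \<open>m\<close> divides \<open>w\<close>; it is
  essential because \<open>w - m\<close> is truncated subtraction.\<close>

lemma lookup_mult_single:
  fixes f :: "('v, 'k::field) mpoly"
  shows "lookup (f * single m c) w = (if \<exists>w'. w = w' + m then lookup f (w - m) * c else 0)"
proof -
  have "f * single m c = (\<Sum>k\<in>keys f. single k (lookup f k)) * single m c"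
    by (simp only: sum_single_lookup)
  also have "\<dots> = (\<Sum>k\<in>keys f. single (k + m) (lookup f k * c))"
    by (simp add: sum_distrib_right mult_single)
  finally have "lookup (f * single m c) w = (\<Sum>k\<in>keys f. (lookup f k * c when k + m = w))"
    by (simp add: lookup_sum lookup_single)
  also have "\<dots> = (if \<exists>w'. w = w' + m then lookup f (w - m) * c else 0)"
  proof (cases "\<exists>w'. w = w' + m")
    case True
    then obtain w' where w: "w = w' + m" by auto
    have "(\<Sum>k\<in>keys f. (lookup f k * c when k + m = w)) = (\<Sum>k\<in>keys f. if k = w' then lookup f w' * c else 0)"
      by (rule sum.cong) (auto simp: w when_def)
    also have "\<dots> = lookup f w' * c"
      by (auto simp: in_keys_iff)
    finally show ?thesis
      using w by auto
  qed (auto intro!: sum.neutral simp: when_def)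
  finally show ?thesis .
qed

text \<open>The exponent of a squarefree monomial. For such monomials least common multiples are
  unions and divisibility into \<open>u\<close> is inclusion in \<open>keys u\<close>.\<close>

definition ind :: "'v set \<Rightarrow> 'v \<Rightarrow>\<^sub>0 nat" where
  "ind S = (\<Sum>v\<in>S. single v 1)"

lemma lookup_ind: "finite S \<Longrightarrow> lookup (ind S) v = (if v \<in> S then 1 else 0)"
  by (simp add: ind_def lookup_sum lookup_single when_def)

lemma keys_ind: "finite S \<Longrightarrow> keys (ind S) = S"
  by (auto simp: in_keys_iff lookup_ind split: if_splits)

lemma ind_eq_0_iff: "finite S \<Longrightarrow> ind S = 0 \<longleftrightarrow> S = {}"
  using keys_ind[of S] by (auto simp: ind_def)

lemma diff_add_ind: "finite S \<Longrightarrow> S \<subseteq> keys u \<Longrightarrow> (u - ind S) + ind S = u"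
  by (rule poly_mapping_eqI) (auto simp: lookup_add lookup_minus lookup_ind in_keys_iff subset_iff)

lemma single_ind: "finite S \<Longrightarrow> (\<Prod>v\<in>S. var v) = (single (ind S) 1 :: ('v, 'k::field) mpoly)"
  by (induction S rule: finite_induct) (auto simp: ind_def var_def mult_single)

section \<open>A non-minimal Taylor resolution\<close>

text \<open>The coefficients of the simplicial boundary, unfolding the recursion d(a # t) = t - a #
  d t. If several deletions from a tuple with repetitions give the same face, their signs add
  up.\<close>

fun incidence :: "'f list \<Rightarrow> 'f list \<Rightarrow> 'k::field" where
  "incidence [] s = 0"
| "incidence (a # t) s = (if s = t then 1 else 0)
     - (case s of [] \<Rightarrow> 0 | b # s' \<Rightarrow> if b = a then incidence t s' else 0)"

lemma incidence_nonzero: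
  "(incidence t s :: 'k::field) \<noteq> 0 \<Longrightarrow> set s \<subseteq> set t \<and> length t = Suc (length s)"
proof (induction t arbitrary: s)
  case (Cons a t)
  show ?case
  proof (cases s)
    case Nil
    then show ?thesis
      using Cons.prems by (auto split: if_splits)
  next
    case (Cons b s')
    then show ?thesis
      using Cons.IH[of s'] Cons.prems by (auto split: if_splits)
  qed
qed simp

text \<open>Degree \<open>i\<close> of the resolution has the tuples of length \<open>i\<close> as
  basis, so the empty tuple sits in degree 0 and maps to the class of 1.\<close>

definition tuples :: "'f set \<Rightarrow> nat \<Rightarrow> 'f list set" where
  "tuples F i = {t. set t \<subseteq> F \<and> length t = i}"

lemma tuples_0: "tuples F 0 = {[]}"
  by (auto simp: tuples_def)

lemma finite_tuples: "finite F \<Longrightarrow> finite (tuples F i)"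
  unfolding tuples_def by (rule finite_lists_length_eq)

lemma tuples_Suc: "tuples F (Suc i) = (\<lambda>(b, t). b # t) ` (F \<times> tuples F i)"
  by (auto simp: tuples_def length_Suc_conv)

lemma sum_tuples_Suc:
  assumes "finite F"
  shows "(\<Sum>t\<in>tuples F (Suc i). f t) = (\<Sum>t\<in>tuples F i. \<Sum>b\<in>F. f (b # t))"
proof -
  have "(\<Sum>t\<in>tuples F (Suc i). f t) = (\<Sum>(b, t)\<in>F \<times> tuples F i. f (b # t))"
    unfolding tuples_Suc by (subst sum.reindex) (auto simp: inj_on_def case_prod_unfold)
  also have "\<dots> = (\<Sum>b\<in>F. \<Sum>t\<in>tuples F i. f (b # t))"
    by (simp add: sum.cartesian_product)
  also have "\<dots> = (\<Sum>t\<in>tuples F i. \<Sum>b\<in>F. f (b # t))"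
    by (rule sum.swap)
  finally show ?thesis .
qed

lemma sum_tuples_Cons:
  assumes "finite F" "a \<in> F"
  shows "(\<Sum>t\<in>tuples F (Suc i). case t of [] \<Rightarrow> 0 | b # t' \<Rightarrow> if b = a then f t' else 0) = (\<Sum>t\<in>tuples F i. f t)"
  using assms by (simp add: sum_tuples_Suc)

text \<open>By the recursion, d d (a # t) = d t - d(a # d t) = d t - (d t - a # d d t), and the last
  term vanishes by induction.\<close>

lemma incidence_incidence:
  assumes F: "finite F"
  shows "t \<in> tuples F (Suc i) \<Longrightarrow> lin_ext (tuples F i) incidence (incidence t) r = (0 :: 'k::field)"
proof (induction i arbitrary: t r)
  case 0
  then show ?case
    by (auto simp: lin_ext_def tuples_def)
next
  case (Suc j)
  then obtain a t' where t: "t = a # t'" "a \<in> F" and t': "t' \<in> tuples F (Suc j)"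
    by (auto simp: tuples_Suc)
  note fin = finite_tuples[OF F]
  have s: "incidence t s * incidence s r = (if s = t' then incidence t' r else 0)
      - (case s of [] \<Rightarrow> 0 | b # s' \<Rightarrow> if b = a then incidence t' s' * incidence (a # s') r else (0 :: 'k))" for s
    unfolding t by (simp add: left_diff_distrib split: list.splits)
  have "lin_ext (tuples F (Suc j)) incidence (incidence t) r
    = incidence t' r - (\<Sum>s\<in>tuples F j. incidence t' s * incidence (a # s) r :: 'k)"
    unfolding lin_ext_def s sum_subtractf sum_tuples_Cons[OF F t(2)] using t' by (simp add: fin)
  also have "(\<Sum>s\<in>tuples F j. incidence t' s * incidence (a # s) r :: 'k)
    = (\<Sum>s\<in>tuples F j. (if s = r then incidence t' r else 0)
        - (case r of [] \<Rightarrow> 0 | b # r' \<Rightarrow> if b = a then incidence t' s * incidence s r' else 0))"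
    by (rule sum.cong) (auto simp: right_diff_distrib split: list.splits)
  also have "\<dots> = (\<Sum>s\<in>tuples F j. if s = r then incidence t' r else 0)
        - (case r of [] \<Rightarrow> 0 | b # r' \<Rightarrow> if b = a then lin_ext (tuples F j) incidence (incidence t') r' else 0)"
    by (auto simp: sum_subtractf lin_ext_def split: list.splits)
  also have "\<dots> = (\<Sum>s\<in>tuples F j. if s = r then incidence t' r else 0)"
    using Suc.IH[OF t'] by (auto split: list.splits)
  also have "\<dots> = incidence t' r"
  proof (cases "r \<in> tuples F j")
    case False
    then have "(incidence t' r :: 'k) = 0"
      using incidence_nonzero[of t' r] t' by (auto simp: tuples_def)
    then show ?thesis by simp
  qed (simp add: fin)
  finally show ?case by simp
qed

text \<open>Generators are named by an index set \<open>F\<close>, and \<open>G\<close> may give the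
  same support to several indices. This lets the ideals of \<open>P\<close> and of \<open>P'\<close>
  share one index set.\<close>

locale monomial_ideal = augmented_ideal "polys V :: ('v, 'k::field) mpoly set" const_coeff I
  for V :: "'v set" and I :: "('v, 'k::field) mpoly set" +
  fixes F :: "'f set" and G :: "'f \<Rightarrow> 'v set"
  assumes finite_F: "finite F" and finite_G: "\<And>a. a \<in> F \<Longrightarrow> finite (G a)"
    and G_V: "\<And>a. a \<in> F \<Longrightarrow> G a \<subseteq> V"
    and gen_I: "\<And>a. a \<in> F \<Longrightarrow> single (ind (G a)) 1 \<in> I"
    and keys_I: "\<And>f u. f \<in> I \<Longrightarrow> u \<in> keys f \<Longrightarrow> \<exists>a\<in>F. G a \<subseteq> keys u"
begin

definition support :: "'f list \<Rightarrow> 'v set" where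
  "support t = \<Union>(G ` set t)"

text \<open>For a face \<open>s\<close> of \<open>t\<close> the monomial is the quotient of the two
  least common multiples; otherwise the incidence number is 0.\<close>

definition taylor :: "nat \<Rightarrow> 'f list \<Rightarrow> 'f list \<Rightarrow> ('v, 'k) mpoly" where
  "taylor i t s = single (ind (support t - support s)) (incidence t s)"

text \<open>The basis element \<open>t\<close> has multidegree \<open>ind (support t)\<close>, so these are the coefficients of multidegree \<open>u\<close>.\<close>

definition component :: "('v \<Rightarrow>\<^sub>0 nat) \<Rightarrow> ('f list \<Rightarrow> ('v, 'k) mpoly) \<Rightarrow> 'f list \<Rightarrow> 'k" where
  "component u x t = (if support t \<subseteq> keys u then lookup (x t) (u - ind (support t)) else 0)"

lemma finite_support: "t \<in> tuples F i \<Longrightarrow> finite (support t)"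
  by (auto simp: support_def tuples_def intro: finite_G)

lemma support_V: "t \<in> tuples F i \<Longrightarrow> support t \<subseteq> V"
  using G_V by (auto simp: support_def tuples_def)

lemma incidence_support: "(incidence t s :: 'k) \<noteq> 0 \<Longrightarrow> support s \<subseteq> support t"
  using incidence_nonzero[of t s] by (auto simp: support_def)

lemma incidence_tuples: "t \<in> tuples F (Suc i) \<Longrightarrow> (incidence t s :: 'k) \<noteq> 0 \<Longrightarrow> s \<in> tuples F i"
  using incidence_nonzero[of t s] by (auto simp: tuples_def)

lemma single_polys: "finite S \<Longrightarrow> S \<subseteq> V \<Longrightarrow> single (ind S) c \<in> polys V"
  by (cases "c = 0") (auto simp: polys_def keys_ind)

lemma taylor_vecs: "t \<in> tuples F (Suc i) \<Longrightarrow> taylor i t \<in> vecs (polys V) (tuples F i)"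
proof -
  assume t: "t \<in> tuples F (Suc i)"
  have "taylor i t s \<in> polys V" for s
    unfolding taylor_def using finite_support[OF t] support_V[OF t] by (intro single_polys) auto
  moreover have "taylor i t s = 0" if "s \<notin> tuples F i" for s
    using incidence_tuples[OF t, of s] that by (cases "(incidence t s :: 'k) = 0") (simp_all add: taylor_def)
  ultimately show ?thesis
    by (simp add: vecs_def)
qed

text \<open>The differential is homogeneous: the monomial in \<open>taylor\<close> exactly
  compensates for the different degrees of \<open>t\<close> and \<open>s\<close>, so that in each
  multidegree only the simplicial sign is left.\<close>

lemma component_lin_ext:
  "component u (lin_ext (tuples F (Suc i)) (taylor i) x) = lin_ext (tuples F (Suc i)) incidence (component u x)"
proof
  fix s
  have *: "(if support s \<subseteq> keys u then lookup (x t * taylor i t s) (u - ind (support s)) else 0)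
      = component u x t * incidence t s" if t: "t \<in> tuples F (Suc i)" for t
  proof (cases "(incidence t s :: 'k) = 0")
    case False
    have ts: "support s \<subseteq> support t" "finite (support t)" "finite (support s)"
      using incidence_support[OF False] finite_support[OF t] finite_subset by auto
    let ?w = "u - ind (support s)" and ?m = "ind (support t - support s)"
    \<comment> \<open>Given that the multidegree of \<open>s\<close> divides \<open>u\<close>, the
      monomial of the entry divides the quotient exactly when the multidegree of \<open>t\<close>
      divides \<open>u\<close>.\<close>
    have "(\<exists>w'. ?w = w' + ?m) \<longleftrightarrow> support t \<subseteq> keys u" if s: "support s \<subseteq> keys u"
    proof
      assume "\<exists>w'. ?w = w' + ?m"
      then obtain w' where w': "?w = w' + ?m" by auto
      have eq: "lookup u v - lookup (ind (support s)) v = lookup w' v + lookup ?m v" for v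
        using arg_cong[OF w', of "\<lambda>p. lookup p v"] by (simp add: lookup_add lookup_minus)
      have "lookup u v \<noteq> 0" if "v \<in> support t - support s" for v
        using eq[of v] that ts by (simp add: lookup_ind)
      then show "support t \<subseteq> keys u"
        using s by (auto simp: in_keys_iff subset_iff)
    next
      assume "support t \<subseteq> keys u"
      then have "?w = (?w - ?m) + ?m"
        using ts by (intro poly_mapping_eqI) (auto simp: lookup_add lookup_minus lookup_ind in_keys_iff subset_iff)
      then show "\<exists>w'. ?w = w' + ?m" by blast
    qed
    moreover have "?w - ?m = u - ind (support t)"
      using ts by (intro poly_mapping_eqI) (auto simp: lookup_minus lookup_ind)
    ultimately show ?thesis
      using ts by (auto simp: component_def taylor_def lookup_mult_single)
  qed (simp add: taylor_def)
  have "lin_ext (tuples F (Suc i)) incidence (component u x) s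
    = (\<Sum>t\<in>tuples F (Suc i). if support s \<subseteq> keys u then lookup (x t * taylor i t s) (u - ind (support s)) else 0)"
    unfolding lin_ext_def by (rule sum.cong) (simp_all only: *)
  also have "\<dots> = component u (lin_ext (tuples F (Suc i)) (taylor i) x) s"
    by (simp add: component_def lin_ext_def lookup_sum)
  finally show "component u (lin_ext (tuples F (Suc i)) (taylor i) x) s = lin_ext (tuples F (Suc i)) incidence (component u x) s" ..
qed

text \<open>The coefficient of \<open>x t\<close> at exponent \<open>w\<close> is seen in the
  multidegree \<open>w + ind (support t)\<close>, so the components together determine a
  vector.\<close>

lemma component_eqI:
  assumes "\<And>u. component u x = component u y" and "x \<in> vecs (polys V) (tuples F i)" "y \<in> vecs (polys V) (tuples F i)"
  shows "x = y"
proof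
  fix t show "x t = y t"
  proof (cases "t \<in> tuples F i")
    case True
    have "lookup (x t) w = lookup (y t) w" for w
      using fun_cong[OF assms(1)[of "w + ind (support t)"], of t] finite_support[OF True]
      by (simp add: component_def keys_add_nat keys_ind)
    then show ?thesis
      by (rule poly_mapping_eqI)
  qed (use assms in \<open>auto simp: vecs_def\<close>)
qed

text \<open>In multidegree \<open>u\<close>, the cone prepends to a tuple a generator dividing the monomial \<open>u\<close>.\<close>

definition apex :: "('v \<Rightarrow>\<^sub>0 nat) \<Rightarrow> 'f" where
  "apex u = (SOME a. a \<in> F \<and> G a \<subseteq> keys u)"

lemma apex: "a \<in> F \<Longrightarrow> G a \<subseteq> keys u \<Longrightarrow> apex u \<in> F \<and> G (apex u) \<subseteq> keys u"
  unfolding apex_def by (rule someI) auto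

text \<open>The coordinate at \<open>b # t\<close> gathers from \<open>x t\<close> the terms in
  those multidegrees whose apex is \<open>b\<close>. As the apex varies with the multidegree, the
  cone need not be linear over the polynomial ring; to prove exactness it only has to produce a
  preimage for each cycle.\<close>

definition cone :: "('f list \<Rightarrow> ('v, 'k) mpoly) \<Rightarrow> 'f list \<Rightarrow> ('v, 'k) mpoly" where
  "cone x s = (case s of [] \<Rightarrow> 0 | b # t \<Rightarrow> if b \<in> F then
     Poly_Mapping.Abs_poly_mapping (\<lambda>w. if apex (w + ind (support (b # t))) = b
       then lookup (x t) (w + ind (support (b # t) - support t)) else 0) else 0)"

lemma lookup_cone:
  assumes "b \<in> F"
  shows "lookup (cone x (b # t)) w = (if apex (w + ind (support (b # t))) = b
       then lookup (x t) (w + ind (support (b # t) - support t)) else 0)"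
proof -
  let ?m = "ind (support (b # t) - support t)"
  \<comment> \<open>Finite support of the new coefficients: they are a shift of some of the
    coefficients of \<open>x t\<close>, and the shift is injective.\<close>
  have "finite ((\<lambda>w. w + ?m) -` keys (x t))"
    by (rule finite_vimageI) (auto simp: inj_def)
  then have "finite {w. (if apex (w + ind (support (b # t))) = b then lookup (x t) (w + ?m) else 0) \<noteq> 0}"
    by (rule rev_finite_subset) (auto simp: in_keys_iff)
  then show ?thesis
    using assms by (simp add: cone_def)
qed

lemma cone_vecs:
  assumes x: "x \<in> vecs (polys V) (tuples F i)"
  shows "cone x \<in> vecs (polys V) (tuples F (Suc i))"
proof -
  have "cone x s \<in> polys V" for s
  proof (cases s)
    case (Cons b t)
    show ?thesis
    proof (cases "b \<in> F")
      case True
      have "x t \<in> polys V"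
        using x by (cases "t \<in> tuples F i") (auto simp: vecs_def polys.zero_A)
      then show ?thesis
        unfolding Cons by (intro polysI) (auto simp: lookup_cone[OF True] keys_add_nat dest!: polysD split: if_splits)
    qed (simp add: Cons cone_def polys.zero_A)
  qed (simp add: cone_def polys.zero_A)
  moreover have "cone x s = 0" if s: "s \<notin> tuples F (Suc i)" for s
  proof (cases s)
    case (Cons b t)
    show ?thesis
    proof (cases "b \<in> F")
      case True
      then have "x t = 0"
        using x s Cons by (auto simp: vecs_def tuples_def)
      then show ?thesis
        unfolding Cons by (intro poly_mapping_eqI) (simp add: lookup_cone[OF True])
    qed (simp add: Cons cone_def)
  qed (simp add: cone_def)
  ultimately show ?thesis
    by (simp add: vecs_def)
qed

text \<open>No coordinate is lost: the generator at the apex divides \<open>u\<close>, so prepending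
  it to a tuple whose multidegree divides \<open>u\<close> gives another such tuple.\<close>

lemma component_cone:
  assumes x: "x \<in> vecs (polys V) (tuples F i)" and a: "a \<in> F" "G a \<subseteq> keys u"
  shows "component u (cone x) s = (case s of [] \<Rightarrow> 0 | b # t \<Rightarrow> if b = apex u then component u x t else 0)"
proof (cases s)
  case Nil
  then show ?thesis by (simp add: component_def cone_def)
next
  case (Cons b t)
  note ap = apex[OF a]
  show ?thesis
  proof (cases "b \<in> F \<and> t \<in> tuples F i")
    case False
    then have "x t = 0 \<or> b \<notin> F"
      using x by (auto simp: vecs_def)
    then have "cone x (b # t) = 0"
      by (cases "b \<in> F") (auto intro!: poly_mapping_eqI simp: lookup_cone, simp add: cone_def)
    then have "component u (cone x) (b # t) = 0"
      by (simp add: component_def)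
    moreover have "b = apex u \<Longrightarrow> component u x t = 0"
      using \<open>x t = 0 \<or> b \<notin> F\<close> ap by (auto simp: component_def)
    ultimately show ?thesis
      using Cons by simp
  next
    case True
    then have b: "b \<in> F" and t: "t \<in> tuples F i" by auto
    have bt: "finite (support (b # t))" "finite (support t)" "support (b # t) = G b \<union> support t"
      using b t finite_support[of "b # t" "Suc i"] finite_support[OF t] by (auto simp: tuples_def support_def)
    show ?thesis
    proof (cases "support (b # t) \<subseteq> keys u")
      case True
      have "(u - ind (support (b # t))) + ind (support (b # t) - support t) = u - ind (support t)"
        using bt True by (intro poly_mapping_eqI)
          (auto simp: lookup_add lookup_minus lookup_ind in_keys_iff subset_iff)
      note e = this
      have "component u (cone x) (b # t) = lookup (cone x (b # t)) (u - ind (support (b # t)))"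
        using True by (simp only: component_def if_True)
      also have "\<dots> = (if apex u = b then lookup (x t) (u - ind (support t)) else 0)"
        unfolding lookup_cone[OF b] diff_add_ind[OF bt(1) True] e ..
      also have "\<dots> = (if b = apex u then component u x t else 0)"
        using True bt(3) by (auto simp: component_def)
      finally show ?thesis
        using Cons by simp
    next
      case False
      then show ?thesis
        using bt ap Cons by (auto simp: component_def)
    qed
  qed
qed

text \<open>If no generator divides \<open>u\<close>, only the empty tuple can occur in multidegree
  \<open>u\<close>. There the coordinate of a cycle is an element of \<open>I\<close>, and every
  monomial of such an element is a multiple of a generator.\<close>

lemma component_cycle_empty:
  assumes x: "x \<in> polys.cycles V I (tuples F) taylor (\<lambda>_. 1) i"
    and u: "\<And>a. a \<in> F \<Longrightarrow> \<not> G a \<subseteq> keys u"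
  shows "component u x t = 0"
proof (cases "t \<in> tuples F i")
  case False
  then show ?thesis
    using polys.cycles_vecs[OF x] by (auto simp: component_def vecs_def)
next
  case True
  show ?thesis
  proof (cases t)
    case Nil
    then have "i = 0"
      using True by (auto simp: tuples_def)
    then have "x [] \<in> I"
      using x by (simp add: tuples_0)
    then have "lookup (x []) u = 0"
      using keys_I u by (auto simp: in_keys_iff)
    then show ?thesis
      using Nil by (simp add: component_def support_def ind_def)
  next
    case (Cons b t')
    then have "b \<in> F"
      using True by (auto simp: tuples_def)
    then show ?thesis
      using u[of b] Cons by (auto simp: component_def support_def)
  qed
qed

text \<open>The contraction: by d(a # t) = t - a # d t, the boundary of the cone over
  \<open>x\<close> is \<open>x\<close> minus the cone over the boundary of \<open>x\<close>, and the
  latter vanishes for a cycle.\<close>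

lemma lin_ext_cone:
  assumes x: "x \<in> polys.cycles V I (tuples F) taylor (\<lambda>_. 1) i"
  shows "lin_ext (tuples F (Suc i)) (taylor i) (cone x) = x"
proof (rule component_eqI)
  show xv: "x \<in> vecs (polys V) (tuples F i)"
    by (rule polys.cycles_vecs[OF x])
  show "lin_ext (tuples F (Suc i)) (taylor i) (cone x) \<in> vecs (polys V) (tuples F i)"
    by (rule lin_ext_vecs[OF taylor_vecs cone_vecs[OF xv]])
  fix u
  show "component u (lin_ext (tuples F (Suc i)) (taylor i) (cone x)) = component u x"
  proof (cases "\<exists>a\<in>F. G a \<subseteq> keys u")
    case False
    have "component u (cone x) t = 0" if "t \<in> tuples F (Suc i)" for t
    proof -
      obtain b t' where "t = b # t'" "b \<in> F"
        using \<open>t \<in> tuples F (Suc i)\<close> by (auto simp: tuples_Suc)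
      then have "\<not> support t \<subseteq> keys u"
        using False by (auto simp: support_def)
      then show ?thesis
        by (simp add: component_def)
    qed
    moreover have "component u x = (\<lambda>_. 0)"
      using component_cycle_empty[OF x, of u] False by auto
    ultimately show ?thesis
      unfolding component_lin_ext by (simp add: lin_ext_def)
  next
    case True
    then obtain a where a: "a \<in> F" "G a \<subseteq> keys u" by auto
    let ?a = "apex u"
    have aF: "?a \<in> F"
      using apex[OF a] by simp
    \<comment> \<open>In each multidegree a cycle has zero simplicial boundary; in degree 0 this is
      because the empty tuple has none.\<close>
    have zero: "lin_ext (tuples F i) incidence (component u x) r = 0" for r
    proof (cases i)
      case 0
      then show ?thesis by (simp add: lin_ext_def tuples_def)
    next
      case (Suc j)
      then have "lin_ext (tuples F i) (taylor j) x = (\<lambda>_. 0)"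
        using x by simp
      have "lin_ext (tuples F i) incidence (component u x) r = component u (lin_ext (tuples F i) (taylor j) x) r"
        unfolding Suc component_lin_ext ..
      with \<open>lin_ext (tuples F i) (taylor j) x = (\<lambda>_. 0)\<close> show ?thesis
        by (simp add: component_def)
    qed
    have "lin_ext (tuples F (Suc i)) incidence (component u (cone x)) s = component u x s" for s
    proof -
      have "lin_ext (tuples F (Suc i)) incidence (component u (cone x)) s
        = (\<Sum>t\<in>tuples F (Suc i). case t of [] \<Rightarrow> 0 | b # t' \<Rightarrow>
            if b = ?a then component u x t' * incidence (?a # t') s else 0)"
        unfolding lin_ext_def component_cone[OF xv a] by (rule sum.cong) (auto split: list.splits)
      also have "\<dots> = (\<Sum>t\<in>tuples F i. component u x t * incidence (?a # t) s)"
        by (rule sum_tuples_Cons[OF finite_F aF])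
      also have "\<dots> = (\<Sum>t\<in>tuples F i. (if t = s then component u x s else 0)
          - (case s of [] \<Rightarrow> 0 | b # s' \<Rightarrow> if b = ?a then component u x t * incidence t s' else 0))"
        by (rule sum.cong) (auto simp: right_diff_distrib split: list.splits)
      also have "\<dots> = (\<Sum>t\<in>tuples F i. if t = s then component u x s else 0)
          - (case s of [] \<Rightarrow> 0 | b # s' \<Rightarrow> if b = ?a then lin_ext (tuples F i) incidence (component u x) s' else 0)"
        by (auto simp: sum_subtractf lin_ext_def split: list.splits)
      also have "(\<Sum>t\<in>tuples F i. if t = s then component u x s else 0) = component u x s"
        using xv by (auto simp: finite_tuples[OF finite_F] component_def vecs_def)
      finally show ?thesis
        by (simp add: zero split: list.splits)
    qed
    then show ?thesis
      unfolding component_lin_ext by auto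
  qed
qed

text \<open>The boundary of the one-element tuple \<open>[a]\<close> is the generator of index
  \<open>a\<close>, which lies in \<open>I\<close>. In higher degrees d d = 0 is inherited from the
  incidence numbers in every multidegree.\<close>

lemma taylor_cycle:
  assumes x: "x \<in> vecs (polys V) (tuples F (Suc i))"
  shows "lin_ext (tuples F (Suc i)) (taylor i) x \<in> polys.cycles V I (tuples F) taylor (\<lambda>_. 1) i"
proof -
  have y: "lin_ext (tuples F (Suc i)) (taylor i) x \<in> vecs (polys V) (tuples F i)"
    by (rule lin_ext_vecs[OF taylor_vecs x])
  show ?thesis
  proof (cases i)
    case 0
    have "x t * taylor i t [] \<in> I" if t: "t \<in> tuples F (Suc i)" for t
    proof -
      obtain a where "t = [a]" "a \<in> F"
        using t 0 by (auto simp: tuples_Suc tuples_0)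
      then show ?thesis
        using x t by (auto simp: taylor_def support_def vecs_def intro!: mult_I gen_I)
    qed
    then have "lin_ext (tuples F (Suc i)) (taylor i) x [] \<in> I"
      by (auto simp: lin_ext_def intro!: sum_I)
    then show ?thesis
      using y 0 by (simp add: tuples_0)
  next
    case (Suc j)
    have "lin_ext (tuples F i) (taylor j) (lin_ext (tuples F (Suc i)) (taylor i) x) = (\<lambda>_. 0)" (is "?z = _")
    proof (rule component_eqI)
      show "?z \<in> vecs (polys V) (tuples F j)"
        unfolding Suc by (rule lin_ext_vecs[OF taylor_vecs y[unfolded Suc]])
      show "(\<lambda>_. 0) \<in> vecs (polys V) (tuples F j)"
        by (auto simp: vecs_def polys.zero_A)
      fix u
      have "component u ?z = lin_ext (tuples F i) incidence (lin_ext (tuples F (Suc i)) incidence (component u x))"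
        using component_lin_ext[of u j] component_lin_ext[of u i] Suc by simp
      also have "\<dots> = lin_ext (tuples F (Suc i)) (\<lambda>t. lin_ext (tuples F i) incidence (incidence t)) (component u x)"
        by (rule lin_ext_comp)
      also have "\<dots> = (\<lambda>_. 0)"
        by (simp add: lin_ext_def[of "tuples F (Suc i)"] incidence_incidence[OF finite_F])
      finally show "component u ?z = component u (\<lambda>_. 0)"
        by (auto simp: component_def)
    qed
    then show ?thesis
      using y Suc by simp
  qed
qed

lemma taylor_resolution: "polys.mat_resolution V I (tuples F) taylor (\<lambda>_. 1)"
  unfolding polys.mat_resolution_def
proof (intro conjI allI ballI)
  show "\<exists>x\<in>vecs (polys V) (tuples F 0). (\<Sum>t\<in>tuples F 0. x t * 1) - 1 \<in> I"
    by (rule bexI[OF _ unit_vec_vecs[of "[]"]]) (simp_all add: tuples_0 unit_vec_def zero_I)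
  fix i
  show "polys.cycles V I (tuples F) taylor (\<lambda>_. 1) i
      = lin_ext (tuples F (Suc i)) (taylor i) ` vecs (polys V) (tuples F (Suc i))"
  proof (intro equalityI subsetI)
    fix x assume "x \<in> polys.cycles V I (tuples F) taylor (\<lambda>_. 1) i"
    then show "x \<in> lin_ext (tuples F (Suc i)) (taylor i) ` vecs (polys V) (tuples F (Suc i))"
      using lin_ext_cone[of x i] cone_vecs[OF polys.cycles_vecs, of x] by (intro image_eqI[of _ _ "cone x"]) auto
  next
    fix x assume "x \<in> lin_ext (tuples F (Suc i)) (taylor i) ` vecs (polys V) (tuples F (Suc i))"
    then show "x \<in> polys.cycles V I (tuples F) taylor (\<lambda>_. 1) i"
      using taylor_cycle[of _ i] by auto
  qed
qed (auto simp: finite_tuples finite_F taylor_vecs polys.one_A)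

text \<open>The constant coefficient kills every entry with a nontrivial monomial. For a face
  \<open>s\<close> of \<open>t\<close>, the surviving case is that of equal least common
  multiples.\<close>

lemma red_taylor:
  assumes t: "t \<in> tuples F (Suc i)"
  shows "red const_coeff (taylor i) t s = (if support t \<subseteq> support s then incidence t s else 0)"
  using finite_support[OF t]
  by (auto simp: red_def taylor_def const_coeff_def lookup_single when_def ind_eq_0_iff)

end

section \<open>Free modules over the polynomial ring\<close>

lemma poly_ring_simps [simp]:
  "carrier (poly_ring V) = polys V" "mult (poly_ring V) = (*)" "one (poly_ring V) = 1"
  "zero (poly_ring V) = 0" "add (poly_ring V) = (+)"
  by (simp_all add: poly_ring_def polys_def)

lemma cring_poly_ring: "cring (poly_ring V :: ('v, 'k::field) mpoly ring)"
proof (rule cringI)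
  show "abelian_group (poly_ring V :: ('v, 'k) mpoly ring)"
  proof (rule abelian_groupI)
    show "\<exists>y\<in>carrier (poly_ring V). y \<oplus>\<^bsub>poly_ring V\<^esub> x = \<zero>\<^bsub>poly_ring V\<^esub>"
      if "x \<in> carrier (poly_ring V)" for x :: "('v, 'k) mpoly"
      using that by (intro bexI[of _ "- x"]) (auto simp: polys.uminus_A)
  qed (auto simp: polys.add_A polys.zero_A algebra_simps)
  show "Group.comm_monoid (poly_ring V :: ('v, 'k) mpoly ring)"
    by (rule comm_monoidI) (auto simp: polys.mult_A polys.one_A algebra_simps)
qed (auto simp: algebra_simps)

interpretation poly_ring: cring "poly_ring V :: ('v, 'k::field) mpoly ring"
  by (rule cring_poly_ring)

lemma a_inv_poly_ring: "f \<in> polys V \<Longrightarrow> \<ominus>\<^bsub>poly_ring V\<^esub> f = - f"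
  for f :: "('v, 'k::field) mpoly"
  by (rule poly_ring.minus_equality) (auto simp: polys.uminus_A)

abbreviation fmod :: "'v set \<Rightarrow> 'b set \<Rightarrow> (('v, 'k::field) mpoly, 'b \<Rightarrow> ('v, 'k) mpoly) module" where
  "fmod V B \<equiv> free_module (poly_ring V) B"

lemma fmod_simps:
  "carrier (fmod V B :: (('v, 'k::field) mpoly, _) module) = {f \<in> B \<rightarrow>\<^sub>E polys V. finite {b \<in> B. f b \<noteq> 0}}"
  "zero (fmod V B :: (('v, 'k) mpoly, _) module) = (\<lambda>b\<in>B. 0)"
  "add (fmod V B :: (('v, 'k) mpoly, _) module) = (\<lambda>f g. \<lambda>b\<in>B. f b + g b)"
  "module.smult (fmod V B :: (('v, 'k) mpoly, _) module) = (\<lambda>c f. \<lambda>b\<in>B. c * f b)"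
  by (simp_all add: free_module_def poly_ring.func_space_def)

lemma fmod_carrier_finite:
  "finite B \<Longrightarrow> carrier (fmod V B :: (('v, 'k::field) mpoly, _) module) = B \<rightarrow>\<^sub>E polys V"
  by (auto simp: fmod_simps)

lemma module_fmod:
  fixes B :: "'b set"
  shows "module (poly_ring V) (fmod V B :: (('v, 'k::field) mpoly, _) module)"
proof -
  let ?M = "poly_ring.func_space V B :: (('v, 'k) mpoly, 'b \<Rightarrow> ('v, 'k) mpoly) module"
  interpret M: Module.module "poly_ring V :: ('v, 'k) mpoly ring" ?M
    by (rule poly_ring.func_space_is_module)
  let ?N = "{f \<in> B \<rightarrow>\<^sub>E polys V. finite {b \<in> B. f b \<noteq> 0}} :: ('b \<Rightarrow> ('v, 'k) mpoly) set"
  have "submodule (poly_ring V) ?N ?M"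
  proof (rule submodule.intro)
    show "f \<oplus>\<^bsub>?M\<^esub> g \<in> ?N" if "f \<in> ?N" "g \<in> ?N" for f g
    proof -
      have "{b \<in> B. f b + g b \<noteq> 0} \<subseteq> {b \<in> B. f b \<noteq> 0} \<union> {b \<in> B. g b \<noteq> 0}"
        by auto
      then have "finite {b \<in> B. f b + g b \<noteq> 0}"
        using that by (auto intro: finite_subset)
      then show ?thesis
        using that by (auto simp: poly_ring.func_space_def PiE_iff intro!: polys.add_A cong: conj_cong)
    qed
    show "c \<odot>\<^bsub>?M\<^esub> f \<in> ?N" if "c \<in> carrier (poly_ring V)" "f \<in> ?N" for c f
    proof -
      have "{b \<in> B. c * f b \<noteq> 0} \<subseteq> {b \<in> B. f b \<noteq> 0}"
        by auto
      then have "finite {b \<in> B. c * f b \<noteq> 0}"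
        using that by (auto intro: finite_subset)
      then show ?thesis
        using that by (auto simp: poly_ring.func_space_def PiE_iff intro!: polys.mult_A cong: conj_cong)
    qed
    show "module (poly_ring V) ?M"
      by (rule M.module_axioms)
  qed (auto simp: poly_ring.func_space_def polys.zero_A cong: conj_cong)
  then have "module (poly_ring V) (?M\<lparr>carrier := ?N\<rparr>)"
    by (rule M.submodule_is_module)
  then show ?thesis
    by (simp add: free_module_def)
qed

lemma free_gen_carrier:
  "b \<in> B \<Longrightarrow> free_gen (poly_ring V) B b \<in> carrier (fmod V B :: (('v, 'k::field) mpoly, _) module)"
proof -
  assume "b \<in> B"
  then have "{x \<in> B. free_gen (poly_ring V :: ('v, 'k) mpoly ring) B b x \<noteq> 0} = {b}"
    by (auto simp: free_gen_def)
  then show ?thesis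
    by (auto simp: fmod_simps free_gen_def polys.zero_A polys.one_A)
qed

text \<open>Induction on the finite support. It reduces identities to generators both for free
  modules of finite rank and for the free module on all pairs behind the tensor product.\<close>

lemma fmod_induct [consumes 1, case_names zero gen add smult]:
  fixes f :: "'b \<Rightarrow> ('v, 'k::field) mpoly"
  assumes f: "f \<in> carrier (fmod V B)"
    and zero: "P \<zero>\<^bsub>fmod V B\<^esub>"
    and gen: "\<And>b. b \<in> B \<Longrightarrow> P (free_gen (poly_ring V) B b)"
    and add: "\<And>f g. f \<in> carrier (fmod V B) \<Longrightarrow> g \<in> carrier (fmod V B) \<Longrightarrow> P f \<Longrightarrow> P g \<Longrightarrow> P (f \<oplus>\<^bsub>fmod V B\<^esub> g)"
    and smult: "\<And>c f. c \<in> polys V \<Longrightarrow> f \<in> carrier (fmod V B) \<Longrightarrow> P f \<Longrightarrow> P (c \<odot>\<^bsub>fmod V B\<^esub> f)"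
  shows "P f"
proof -
  interpret M: Module.module "poly_ring V :: ('v, 'k) mpoly ring" "fmod V B"
    by (rule module_fmod)
  have "finite {b \<in> B. f b \<noteq> 0}"
    using f by (simp add: fmod_simps)
  then show ?thesis
    using f
  proof (induction "{b \<in> B. f b \<noteq> 0}" arbitrary: f rule: finite_induct)
    case empty
    then have "f = \<zero>\<^bsub>fmod V B\<^esub>"
      by (auto simp: fmod_simps fun_eq_iff PiE_iff extensional_def)
    with zero show ?case by simp
  next
    case (insert b X)
    let ?g = "f(b := 0)" and ?e = "free_gen (poly_ring V) B b :: 'b \<Rightarrow> ('v, 'k) mpoly"
    have b: "b \<in> B" "f b \<in> polys V"
      using insert by (auto simp: fmod_simps)
    have X: "X = {c \<in> B. ?g c \<noteq> 0}"
      using insert.hyps by auto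
    have g: "?g \<in> carrier (fmod V B)"
      using insert.prems insert.hyps(1) X b by (auto simp: fmod_simps PiE_iff extensional_def polys.zero_A)
    have "f = ?g \<oplus>\<^bsub>fmod V B\<^esub> (f b \<odot>\<^bsub>fmod V B\<^esub> ?e)"
      using insert.prems b by (auto simp: fmod_simps fun_eq_iff free_gen_def PiE_iff extensional_def)
    moreover have "P (?g \<oplus>\<^bsub>fmod V B\<^esub> (f b \<odot>\<^bsub>fmod V B\<^esub> ?e))"
      using insert.hyps(3)[OF X g] b g free_gen_carrier[OF b(1)]
      by (intro add smult gen M.smult_closed) auto
    ultimately show ?case by simp
  qed
qed

text \<open>The extension of a function on the basis to the free module, semilinear along \<open>const_coeff\<close>.\<close>

definition res_ext :: "'b set \<Rightarrow> ('b \<Rightarrow> 'k) \<Rightarrow> ('b \<Rightarrow> ('v, 'k::field) mpoly) \<Rightarrow> 'k" where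
  "res_ext B \<phi> f = (\<Sum>b | b \<in> B \<and> f b \<noteq> 0. const_coeff (f b) * \<phi> b)"

lemma res_ext_superset:
  assumes "finite S" "{b \<in> B. f b \<noteq> 0} \<subseteq> S" "S \<subseteq> B"
  shows "res_ext B \<phi> f = (\<Sum>b\<in>S. const_coeff (f b) * \<phi> b)"
  unfolding res_ext_def using assms
  by (intro sum.mono_neutral_left) (auto simp: polys.eps_zero)

lemma res_ext_add:
  assumes "f \<in> carrier (fmod V B)" "g \<in> carrier (fmod V B)"
  shows "res_ext B \<phi> (f \<oplus>\<^bsub>fmod V B\<^esub> g) = res_ext B \<phi> f + res_ext B \<phi> g"
proof -
  let ?S = "{b \<in> B. f b \<noteq> 0} \<union> {b \<in> B. g b \<noteq> 0}"
  have fin: "finite ?S"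
    using assms by (simp add: fmod_simps)
  have "res_ext B \<phi> h = (\<Sum>b\<in>?S. const_coeff (h b) * \<phi> b)" if "{b \<in> B. h b \<noteq> 0} \<subseteq> ?S" for h
    using fin that by (rule res_ext_superset) auto
  note * = this
  have "res_ext B \<phi> (f \<oplus>\<^bsub>fmod V B\<^esub> g) = (\<Sum>b\<in>?S. const_coeff (f b + g b) * \<phi> b)"
    by (subst *) (auto simp: fmod_simps intro!: sum.cong)
  also have "\<dots> = res_ext B \<phi> f + res_ext B \<phi> g"
    by (subst (1 2) *) (auto simp: polys.eps_add distrib_right sum.distrib)
  finally show ?thesis .
qed

lemma res_ext_smult:
  assumes "f \<in> carrier (fmod V B)"
  shows "res_ext B \<phi> (c \<odot>\<^bsub>fmod V B\<^esub> f) = const_coeff c * res_ext B \<phi> f"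
proof -
  let ?S = "{b \<in> B. f b \<noteq> 0}"
  have fin: "finite ?S"
    using assms by (simp add: fmod_simps)
  have "res_ext B \<phi> h = (\<Sum>b\<in>?S. const_coeff (h b) * \<phi> b)" if "{b \<in> B. h b \<noteq> 0} \<subseteq> ?S" for h
    using fin that by (rule res_ext_superset) auto
  note * = this
  have "res_ext B \<phi> (c \<odot>\<^bsub>fmod V B\<^esub> f) = (\<Sum>b\<in>?S. const_coeff (c * f b) * \<phi> b)"
    by (subst *) (auto simp: fmod_simps intro!: sum.cong)
  also have "\<dots> = const_coeff c * res_ext B \<phi> f"
    by (subst *) (auto simp: polys.eps_mult sum_distrib_left mult.assoc)
  finally show ?thesis .
qed

lemma res_ext_zero: "res_ext B \<phi> \<zero>\<^bsub>fmod V B\<^esub> = 0"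
  by (auto simp: res_ext_def fmod_simps intro!: sum.neutral)

lemma res_ext_minus:
  fixes f g :: "'b \<Rightarrow> ('v, 'k::field) mpoly"
  assumes f: "f \<in> carrier (fmod V B)" and g: "g \<in> carrier (fmod V B)"
  shows "res_ext B \<phi> (f \<ominus>\<^bsub>fmod V B\<^esub> g) = res_ext B \<phi> f - res_ext B \<phi> g"
proof -
  interpret M: Module.module "poly_ring V :: ('v, 'k) mpoly ring" "fmod V B"
    by (rule module_fmod)
  have "(f \<ominus>\<^bsub>fmod V B\<^esub> g) \<oplus>\<^bsub>fmod V B\<^esub> g = f"
    using f g by (simp add: M.M.minus_eq M.M.a_assoc M.M.l_neg)
  then show ?thesis
    using res_ext_add[of "f \<ominus>\<^bsub>fmod V B\<^esub> g" V B g \<phi>] f g by simp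
qed

lemma res_ext_gen:
  fixes \<phi> :: "'b \<Rightarrow> 'k::field"
  assumes b: "b \<in> B"
  shows "res_ext B \<phi> (free_gen (poly_ring V :: ('v, 'k) mpoly ring) B b) = \<phi> b"
proof -
  have "{x \<in> B. free_gen (poly_ring V) B b x \<noteq> (0 :: ('v, 'k) mpoly)} = {b}"
    using b by (auto simp: free_gen_def)
  then show ?thesis
    using b by (simp add: res_ext_def free_gen_def polys.eps_one)
qed

section \<open>Tensoring free modules with the residue field\<close>

lemma residue_module_simps [simp]:
  "carrier residue_module = UNIV" "zero residue_module = 0" "add residue_module = (+)"
  "module.smult residue_module = (\<lambda>f x. const_coeff f * x)"
  by (simp_all add: residue_module_def restrict_scalars_def regular_module_def
      ring.defs module.defs)

abbreviation res_tensor :: "'v set \<Rightarrow> nat \<Rightarrow> (('v, 'k::field) mpoly, ((nat \<Rightarrow> ('v, 'k) mpoly) \<times> 'k \<Rightarrow> ('v, 'k) mpoly) set) module" where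
  "res_tensor V n \<equiv> tensor (poly_ring V) (fmod V {..<n}) residue_module"

abbreviation res_pure :: "'v set \<Rightarrow> nat \<Rightarrow> (nat \<Rightarrow> ('v, 'k::field) mpoly) \<Rightarrow> 'k \<Rightarrow> ((nat \<Rightarrow> ('v, 'k) mpoly) \<times> 'k \<Rightarrow> ('v, 'k) mpoly) set" where
  "res_pure V n \<equiv> pure_tensor (poly_ring V) (fmod V {..<n}) residue_module"

abbreviation basis_vec :: "'v set \<Rightarrow> nat \<Rightarrow> nat \<Rightarrow> nat \<Rightarrow> ('v, 'k::field) mpoly" where
  "basis_vec V n \<equiv> free_gen (poly_ring V) {..<n}"

text \<open>A partial sum of the pure tensors of basis vectors with the entries of \<open>z\<close>,
  as a recursion so that its rules follow by induction on \<open>k\<close>.\<close>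

primrec res_sum :: "'v set \<Rightarrow> nat \<Rightarrow> nat \<Rightarrow> (nat \<Rightarrow> 'k::field) \<Rightarrow> ((nat \<Rightarrow> ('v, 'k) mpoly) \<times> 'k \<Rightarrow> ('v, 'k) mpoly) set" where
  "res_sum V n 0 z = \<zero>\<^bsub>res_tensor V n\<^esub>"
| "res_sum V n (Suc k) z = res_sum V n k z \<oplus>\<^bsub>res_tensor V n\<^esub> res_pure V n (basis_vec V n k) (z k)"

text \<open>The isomorphism \<open>K\<^bsup>n\<^esup> \<rightarrow> R\<^bsup>n\<^esup> \<otimes> K\<close>.\<close>

definition res_iso :: "'v set \<Rightarrow> nat \<Rightarrow> (nat \<Rightarrow> 'k::field) \<Rightarrow> ((nat \<Rightarrow> ('v, 'k) mpoly) \<times> 'k \<Rightarrow> ('v, 'k) mpoly) set" where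
  "res_iso V n = res_sum V n n"

context
  fixes V :: "'v set" and n :: nat and K_type :: "'k::field itself"
begin

private abbreviation "R \<equiv> poly_ring V :: ('v, 'k) mpoly ring"
private abbreviation "M \<equiv> fmod V {..<n} :: (('v, 'k) mpoly, nat \<Rightarrow> ('v, 'k) mpoly) module"
private abbreviation "BB \<equiv> carrier M \<times> (UNIV :: 'k set)"
private abbreviation "FF \<equiv> fmod V BB"
private abbreviation "KK \<equiv> tensor_kernel R M (residue_module :: (('v, 'k) mpoly, 'k) module)"
private abbreviation "T \<equiv> res_tensor V n :: (('v, 'k) mpoly, ((nat \<Rightarrow> ('v, 'k) mpoly) \<times> 'k \<Rightarrow> ('v, 'k) mpoly) set) module"
private abbreviation "g \<equiv> \<lambda>m c. free_gen R BB (m, c)"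
text \<open>The \<open>a\<close>-th coordinate of the inverse of \<open>res_iso\<close>, still on
  the free module on pairs.\<close>

private abbreviation "\<Theta> \<equiv> \<lambda>a. res_ext BB (\<lambda>(m, c). const_coeff (m a) * c)"

interpretation M: Module.module R M
  by (rule module_fmod)

interpretation FF: Module.module R FF
  by (rule module_fmod)

private lemma relations:
  "tensor_relations R M (residue_module :: (('v, 'k) mpoly, 'k) module) =
      {g (m \<oplus>\<^bsub>M\<^esub> m') c \<ominus>\<^bsub>FF\<^esub> (g m c \<oplus>\<^bsub>FF\<^esub> g m' c) | m m' c. m \<in> carrier M \<and> m' \<in> carrier M}
    \<union> {g m (c + c') \<ominus>\<^bsub>FF\<^esub> (g m c \<oplus>\<^bsub>FF\<^esub> g m c') | m c c'. m \<in> carrier M}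
    \<union> {g (r \<odot>\<^bsub>M\<^esub> m) c \<ominus>\<^bsub>FF\<^esub> (r \<odot>\<^bsub>FF\<^esub> g m c) | r m c. r \<in> polys V \<and> m \<in> carrier M}
    \<union> {g m (const_coeff r * c) \<ominus>\<^bsub>FF\<^esub> (r \<odot>\<^bsub>FF\<^esub> g m c) | r m c. r \<in> polys V \<and> m \<in> carrier M}"
  unfolding tensor_relations_def Let_def by (simp only: residue_module_simps poly_ring_simps) simp

private lemma g_carrier: "m \<in> carrier M \<Longrightarrow> g m c \<in> carrier FF"
  by (rule free_gen_carrier) simp

private lemma relations_carrier:
  "tensor_relations R M (residue_module :: (('v, 'k) mpoly, 'k) module) \<subseteq> carrier FF"
  unfolding relations by (auto intro!: FF.M.minus_closed FF.M.add.m_closed FF.smult_closed g_carrier simp: M.smult_closed)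

private lemma KK_eq: "KK = FF.span (tensor_relations R M residue_module)"
  by (simp add: tensor_kernel_def)

private lemma KK_submodule: "submodule R KK FF"
  unfolding KK_eq by (rule FF.span_is_submodule[OF relations_carrier])

private lemma T_eq: "T = quot_module FF KK"
  by (simp add: tensor_def)

private lemmas quot = quot_module[OF module_fmod KK_submodule, folded T_eq]

lemma module_res_tensor: "module R T"
  by (rule quot(1))

interpretation T: Module.module R T
  by (rule module_res_tensor)

private lemma relation_eq:
  assumes "x \<ominus>\<^bsub>FF\<^esub> y \<in> tensor_relations R M (residue_module :: (('v, 'k) mpoly, 'k) module)"
    "x \<in> carrier FF" "y \<in> carrier FF"
  shows "KK +>\<^bsub>FF\<^esub> x = KK +>\<^bsub>FF\<^esub> y"
  using quot(4)[OF assms(2,3)] assms(1) FF.in_own_span[OF relations_carrier] by (auto simp: KK_eq)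

private lemma relations_mem:
  fixes c c' :: 'k
  assumes "m \<in> carrier M"
  shows "m' \<in> carrier M \<Longrightarrow> g (m \<oplus>\<^bsub>M\<^esub> m') c \<ominus>\<^bsub>FF\<^esub> (g m c \<oplus>\<^bsub>FF\<^esub> g m' c) \<in> tensor_relations R M residue_module"
    and "g m (c + c') \<ominus>\<^bsub>FF\<^esub> (g m c \<oplus>\<^bsub>FF\<^esub> g m c') \<in> tensor_relations R M residue_module"
    and "r \<in> polys V \<Longrightarrow> g (r \<odot>\<^bsub>M\<^esub> m) c \<ominus>\<^bsub>FF\<^esub> (r \<odot>\<^bsub>FF\<^esub> g m c) \<in> tensor_relations R M residue_module"
    and "r \<in> polys V \<Longrightarrow> g m (const_coeff r * c) \<ominus>\<^bsub>FF\<^esub> (r \<odot>\<^bsub>FF\<^esub> g m c) \<in> tensor_relations R M residue_module"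
  unfolding relations using assms by blast+

private lemma proj_add: "x \<in> carrier FF \<Longrightarrow> y \<in> carrier FF \<Longrightarrow>
    KK +>\<^bsub>FF\<^esub> (x \<oplus>\<^bsub>FF\<^esub> y) = (KK +>\<^bsub>FF\<^esub> x) \<oplus>\<^bsub>T\<^esub> (KK +>\<^bsub>FF\<^esub> y)"
  using LinearCombinations.module_hom_add[OF quot(2)] by simp

private lemma proj_smult: "r \<in> polys V \<Longrightarrow> x \<in> carrier FF \<Longrightarrow>
    KK +>\<^bsub>FF\<^esub> (r \<odot>\<^bsub>FF\<^esub> x) = r \<odot>\<^bsub>T\<^esub> (KK +>\<^bsub>FF\<^esub> x)"
  using LinearCombinations.module_hom_smult[OF quot(2)] by simp

private lemma proj_carrier: "x \<in> carrier FF \<Longrightarrow> KK +>\<^bsub>FF\<^esub> x \<in> carrier T"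
  using quot(3) by auto

private lemma proj_zero: "KK +>\<^bsub>FF\<^esub> \<zero>\<^bsub>FF\<^esub> = \<zero>\<^bsub>T\<^esub>"
  using proj_smult[of 0 "\<zero>\<^bsub>FF\<^esub>"] T.lmult_0[OF proj_carrier[of "\<zero>\<^bsub>FF\<^esub>"]] FF.lmult_0[of "\<zero>\<^bsub>FF\<^esub>"]
  by (simp add: polys.zero_A)

private lemma pure_eq: "res_pure V n m c = KK +>\<^bsub>FF\<^esub> g m c"
  by (simp add: pure_tensor_def)

lemma pure_carrier: "m \<in> carrier M \<Longrightarrow> res_pure V n m (c :: 'k) \<in> carrier T"
  unfolding pure_eq by (rule proj_carrier[OF g_carrier])

lemma pure_add_left: "m \<in> carrier M \<Longrightarrow> m' \<in> carrier M \<Longrightarrow>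
    res_pure V n (m \<oplus>\<^bsub>M\<^esub> m') (c :: 'k) = res_pure V n m c \<oplus>\<^bsub>T\<^esub> res_pure V n m' c"
  unfolding pure_eq proj_add[symmetric, OF g_carrier g_carrier]
  by (rule relation_eq[OF relations_mem(1)]) (auto intro!: g_carrier FF.M.add.m_closed)

lemma pure_add_right: "m \<in> carrier M \<Longrightarrow>
    res_pure V n m (c + c' :: 'k) = res_pure V n m c \<oplus>\<^bsub>T\<^esub> res_pure V n m c'"
  unfolding pure_eq proj_add[symmetric, OF g_carrier g_carrier]
  by (rule relation_eq[OF relations_mem(2)]) (auto intro!: g_carrier FF.M.add.m_closed)

lemma pure_smult_left: "r \<in> polys V \<Longrightarrow> m \<in> carrier M \<Longrightarrow>
    res_pure V n (r \<odot>\<^bsub>M\<^esub> m) (c :: 'k) = r \<odot>\<^bsub>T\<^esub> res_pure V n m c"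
  unfolding pure_eq proj_smult[symmetric, OF _ g_carrier]
  by (rule relation_eq[OF relations_mem(3)]) (auto intro!: g_carrier FF.smult_closed M.smult_closed)

lemma pure_smult_right: "r \<in> polys V \<Longrightarrow> m \<in> carrier M \<Longrightarrow>
    res_pure V n m (const_coeff r * c :: 'k) = r \<odot>\<^bsub>T\<^esub> res_pure V n m c"
  unfolding pure_eq proj_smult[symmetric, OF _ g_carrier]
  by (rule relation_eq[OF relations_mem(4)]) (auto intro!: g_carrier FF.smult_closed)

private lemma \<Theta>_g: "m \<in> carrier M \<Longrightarrow> \<Theta> a (g m c) = const_coeff (m a) * c"
  by (subst res_ext_gen) auto

text \<open>The tensor relations express bilinearity, which the pairing of \<open>m\<close> and
  \<open>c\<close> to \<open>const_coeff (m a) * c\<close> has. The bound on \<open>a\<close>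
  matters: beyond the rank the coordinates are \<open>undefined\<close>.\<close>

private lemma \<Theta>_KK: assumes a: "a < n" and f: "f \<in> KK" shows "\<Theta> a f = 0"
proof -
  let ?N = "{f \<in> carrier FF. \<Theta> a f = 0}"
  have N: "submodule R ?N FF"
  proof (rule submodule.intro)
    show "module R FF" by (rule module_fmod)
    show "\<zero>\<^bsub>FF\<^esub> \<in> ?N"
      by (simp add: res_ext_zero)
  qed (auto simp: res_ext_add res_ext_smult)
  have "x \<in> ?N" if "x \<in> tensor_relations R M (residue_module :: (('v, 'k) mpoly, 'k) module)" for x
  proof -
    have "x \<in> carrier FF"
      using that relations_carrier by auto
    moreover have "\<Theta> a x = 0"
      using that a unfolding relations
      by (auto simp: res_ext_minus res_ext_add res_ext_smult g_carrier \<Theta>_g M.smult_closed)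
        (auto simp: fmod_simps polys.eps_add polys.eps_mult algebra_simps)
    ultimately show ?thesis by simp
  qed
  then have "FF.span (tensor_relations R M residue_module) \<subseteq> ?N"
    by (intro FF.span_is_subset[OF _ N]) auto
  then show ?thesis
    using f by (auto simp: KK_eq)
qed

private lemma basis_carrier: "k < n \<Longrightarrow> basis_vec V n k \<in> carrier M"
  by (rule free_gen_carrier) simp

lemma res_sum_carrier: "k \<le> n \<Longrightarrow> res_sum V n k (z :: nat \<Rightarrow> 'k) \<in> carrier T"
  by (induction k) (auto intro!: T.M.add.m_closed pure_carrier basis_carrier)

lemma res_sum_cong: "(\<And>a. a < k \<Longrightarrow> z a = z' a) \<Longrightarrow> res_sum V n k z = res_sum V n k (z' :: nat \<Rightarrow> 'k)"
  by (induction k) auto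

lemma res_sum_add: "k \<le> n \<Longrightarrow>
    res_sum V n k (\<lambda>a. z a + z' a :: 'k) = res_sum V n k z \<oplus>\<^bsub>T\<^esub> res_sum V n k z'"
  by (induction k)
    (auto simp: pure_add_right basis_carrier pure_carrier res_sum_carrier T.M.a_ac)

lemma res_sum_smult: "k \<le> n \<Longrightarrow> r \<in> polys V \<Longrightarrow>
    res_sum V n k (\<lambda>a. const_coeff r * z a :: 'k) = r \<odot>\<^bsub>T\<^esub> res_sum V n k z"
  by (induction k)
    (auto simp: pure_smult_right basis_carrier pure_carrier res_sum_carrier T.smult_r_distr)

lemma pure_zero: "m \<in> carrier M \<Longrightarrow> res_pure V n m (0 :: 'k) = \<zero>\<^bsub>T\<^esub>"
  using pure_smult_right[of 0 m 0] T.lmult_0[OF pure_carrier[of m 0]] by (simp add: polys.zero_A)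

lemma res_sum_single: "k \<le> n \<Longrightarrow> a < n \<Longrightarrow>
    res_sum V n k (\<lambda>b. if b = a then c else 0 :: 'k) = (if a < k then res_pure V n (basis_vec V n a) c else \<zero>\<^bsub>T\<^esub>)"
  by (induction k) (auto simp: pure_zero basis_carrier pure_carrier less_Suc_eq)

text \<open>Expanding \<open>m\<close> in the basis, each polynomial coefficient crosses the tensor
  sign and acts on the field by its constant term.\<close>

lemma pure_eq_res_iso:
  assumes m: "m \<in> carrier M"
  shows "res_pure V n m (c :: 'k) = res_iso V n (\<lambda>a. const_coeff (m a) * c)"
  using m
proof (induction m arbitrary: c rule: fmod_induct)
  case zero
  have "res_pure V n \<zero>\<^bsub>M\<^esub> c = 0 \<odot>\<^bsub>T\<^esub> res_pure V n \<zero>\<^bsub>M\<^esub> c"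
    using pure_smult_left[of 0 "\<zero>\<^bsub>M\<^esub>" c] M.lmult_0[of "\<zero>\<^bsub>M\<^esub>"] by (simp add: polys.zero_A)
  also have "\<dots> = 0 \<odot>\<^bsub>T\<^esub> res_sum V n n (\<lambda>a. const_coeff (\<zero>\<^bsub>M\<^esub> a) * c)"
    using T.lmult_0 pure_carrier[of "\<zero>\<^bsub>M\<^esub>" c] res_sum_carrier[of n] by simp
  also have "\<dots> = res_sum V n n (\<lambda>a. 0)"
    by (subst res_sum_smult[symmetric]) (auto simp: polys.zero_A polys.eps_zero)
  also have "\<dots> = res_sum V n n (\<lambda>a. const_coeff (\<zero>\<^bsub>M\<^esub> a) * c)"
    by (rule res_sum_cong) (simp add: fmod_simps polys.eps_zero)
  finally show ?case
    by (simp add: res_iso_def)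
next
  case (gen b)
  have "res_sum V n n (\<lambda>a. const_coeff (basis_vec V n b a) * c) = res_sum V n n (\<lambda>a. if a = b then c else 0)"
    by (rule res_sum_cong) (simp add: free_gen_def polys.eps_zero polys.eps_one)
  with gen show ?case
    by (simp add: res_iso_def res_sum_single)
next
  case (add f h)
  have "res_sum V n n (\<lambda>a. const_coeff ((f \<oplus>\<^bsub>M\<^esub> h) a) * c)
    = res_sum V n n (\<lambda>a. const_coeff (f a) * c + const_coeff (h a) * c)"
    by (rule res_sum_cong) (simp add: fmod_simps polys.eps_add distrib_right)
  with add show ?case
    by (simp add: res_iso_def res_sum_add pure_add_left)
next
  case (smult r f)
  have "res_sum V n n (\<lambda>a. const_coeff ((r \<odot>\<^bsub>M\<^esub> f) a) * c)
    = res_sum V n n (\<lambda>a. const_coeff r * (const_coeff (f a) * c))"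
    by (rule res_sum_cong) (simp add: fmod_simps polys.eps_mult mult.assoc)
  with smult show ?case
    by (simp add: res_iso_def res_sum_smult pure_smult_left)
qed

private lemma proj_eq_res_iso:
  assumes f: "f \<in> carrier FF"
  shows "KK +>\<^bsub>FF\<^esub> f = res_iso V n (\<lambda>a. \<Theta> a f)"
  using f
proof (induction f rule: fmod_induct)
  case zero
  have "res_iso V n (\<lambda>a. \<Theta> a \<zero>\<^bsub>FF\<^esub>) = res_sum V n n (\<lambda>a. const_coeff (0 :: ('v, 'k) mpoly) * \<Theta> a \<zero>\<^bsub>FF\<^esub>)"
    unfolding res_iso_def by (rule res_sum_cong) (simp add: res_ext_zero)
  also have "\<dots> = \<zero>\<^bsub>T\<^esub>"
    using T.lmult_0 res_sum_carrier[of n] by (subst res_sum_smult) (simp_all add: polys.zero_A)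
  finally show ?case
    by (simp only: proj_zero)
next
  case (gen b)
  obtain m c where b: "b = (m, c)" and m: "m \<in> carrier M"
    using gen by (cases b) auto
  have "KK +>\<^bsub>FF\<^esub> g m c = res_iso V n (\<lambda>a. \<Theta> a (g m c))"
    unfolding \<Theta>_g[OF m] using pure_eq_res_iso[OF m, of c] by (simp add: pure_eq)
  then show ?case
    unfolding b .
next
  case (add f h)
  then show ?case
    by (simp add: proj_add res_ext_add res_iso_def res_sum_add)
next
  case (smult r f)
  then show ?case
    by (simp add: proj_smult res_ext_smult res_iso_def res_sum_smult)
qed

text \<open>A representative with prescribed coordinates. As the coordinates vanish on the tensor
  relations, \<open>z\<close> can be recovered from its image, which is the injectivity of
  \<open>res_iso\<close>.\<close>

private lemma res_sum_lift: "k \<le> n \<Longrightarrow>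
    \<exists>f\<in>carrier FF. KK +>\<^bsub>FF\<^esub> f = res_sum V n k (z :: nat \<Rightarrow> 'k) \<and> (\<forall>a<n. \<Theta> a f = (if a < k then z a else 0))"
proof (induction k)
  case 0
  show ?case
    using proj_zero by (intro bexI[of _ "\<zero>\<^bsub>FF\<^esub>"]) (auto simp: res_ext_zero)
next
  case (Suc k)
  then obtain f where f: "f \<in> carrier FF" "KK +>\<^bsub>FF\<^esub> f = res_sum V n k z"
    "\<forall>a<n. \<Theta> a f = (if a < k then z a else 0)"
    by auto
  have b: "basis_vec V n k \<in> carrier M"
    using Suc.prems by (intro basis_carrier) simp
  note gb = g_carrier[OF b]
  show ?case
  proof (intro bexI conjI allI impI)
    show "KK +>\<^bsub>FF\<^esub> (f \<oplus>\<^bsub>FF\<^esub> g (basis_vec V n k) (z k)) = res_sum V n (Suc k) z"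
      using f gb by (simp add: proj_add pure_eq)
    show "\<Theta> a (f \<oplus>\<^bsub>FF\<^esub> g (basis_vec V n k) (z k)) = (if a < Suc k then z a else 0)" if "a < n" for a
      unfolding res_ext_add[OF f(1) gb] \<Theta>_g[OF b] using f(3) that
      by (auto simp: free_gen_def polys.eps_one polys.eps_zero less_Suc_eq)
    show "f \<oplus>\<^bsub>FF\<^esub> g (basis_vec V n k) (z k) \<in> carrier FF"
      using f(1) gb by simp
  qed
qed

lemma res_iso_carrier: "res_iso V n (z :: nat \<Rightarrow> 'k) \<in> carrier T"
  unfolding res_iso_def by (rule res_sum_carrier) simp

lemma res_iso_add: "res_iso V n (\<lambda>a. z a + z' a :: 'k) = res_iso V n z \<oplus>\<^bsub>T\<^esub> res_iso V n z'"
  unfolding res_iso_def by (rule res_sum_add) simp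

lemma res_iso_smult: "r \<in> polys V \<Longrightarrow>
    res_iso V n (\<lambda>a. const_coeff r * z a :: 'k) = r \<odot>\<^bsub>T\<^esub> res_iso V n z"
  unfolding res_iso_def by (rule res_sum_smult) simp_all

lemma res_iso_eq_iff: "res_iso V n z = res_iso V n z' \<longleftrightarrow> (\<forall>a<n. z a = (z' a :: 'k))"
proof
  assume eq: "res_iso V n z = res_iso V n z'"
  obtain f f' where f: "f \<in> carrier FF" "KK +>\<^bsub>FF\<^esub> f = res_iso V n z" "\<forall>a<n. \<Theta> a f = z a"
    and f': "f' \<in> carrier FF" "KK +>\<^bsub>FF\<^esub> f' = res_iso V n z'" "\<forall>a<n. \<Theta> a f' = z' a"
    using res_sum_lift[of n z] res_sum_lift[of n z'] by (auto simp: res_iso_def)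
  have "f \<ominus>\<^bsub>FF\<^esub> f' \<in> KK"
    using quot(4)[OF f(1) f'(1)] eq f f' by simp
  then show "\<forall>a<n. z a = z' a"
    using \<Theta>_KK res_ext_minus[OF f(1) f'(1)] f(3) f'(3) by (metis eq_iff_diff_eq_0)
next
  assume "\<forall>a<n. z a = z' a"
  then show "res_iso V n z = res_iso V n z'"
    unfolding res_iso_def by (intro res_sum_cong) simp
qed

lemma res_iso_surj:
  assumes "t \<in> carrier T"
  obtains z :: "nat \<Rightarrow> 'k" where "z \<in> vecs UNIV {..<n}" "t = res_iso V n z"
proof -
  obtain f where f: "f \<in> carrier FF" "t = KK +>\<^bsub>FF\<^esub> f"
    using assms quot(3) by auto
  let ?z = "\<lambda>a. if a < n then \<Theta> a f else 0"
  have "t = res_iso V n ?z"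
    unfolding f(2) proj_eq_res_iso[OF f(1)] res_iso_eq_iff by simp
  then show thesis
    by (intro that[of ?z]) (auto simp: vecs_def)
qed

end

text \<open>\<open>tensor_map\<close> is a definite description, so existence and uniqueness are
  both due. The map exists by transporting the reduced matrix along \<open>res_iso\<close>; it is
  unique because pure tensors of basis vectors generate.\<close>

lemma tensor_map_res_iso:
  fixes V :: "'v set" and f :: "(nat \<Rightarrow> ('v, 'k::field) mpoly) \<Rightarrow> (nat \<Rightarrow> ('v, 'k) mpoly)"
  assumes f: "\<And>x b. x \<in> carrier (fmod V {..<n}) \<Longrightarrow> b < m \<Longrightarrow> f x b = (\<Sum>a<n. x a * D a b)"
    and f_closed: "\<And>x. x \<in> carrier (fmod V {..<n}) \<Longrightarrow> f x \<in> carrier (fmod V {..<m})"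
  shows "tensor_map (poly_ring V) (fmod V {..<n}) (fmod V {..<m}) residue_module f (res_iso V n z)
    = res_iso V m (lin_ext {..<n} (red const_coeff D) z)"
proof -
  let ?R = "poly_ring V :: ('v, 'k) mpoly ring"
  let ?T = "res_tensor V n :: (('v, 'k) mpoly, _) module" and ?T' = "res_tensor V m :: (('v, 'k) mpoly, _) module"
  let ?D = "lin_ext {..<n} (red const_coeff D) :: (nat \<Rightarrow> 'k) \<Rightarrow> nat \<Rightarrow> 'k"
  interpret T: Module.module "poly_ring V :: ('v, 'k) mpoly ring" ?T
    by (rule module_res_tensor)
  interpret T': Module.module "poly_ring V :: ('v, 'k) mpoly ring" ?T'
    by (rule module_res_tensor)
  \<comment> \<open>The chosen coordinates are determined only below \<open>n\<close>, and
    \<open>lin_ext\<close> reads no others.\<close>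
  define h where "h = (\<lambda>t\<in>carrier ?T. res_iso V m (?D (SOME z. t = res_iso V n z)))"
  have h: "h (res_iso V n z) = res_iso V m (?D z)" for z
  proof -
    have "res_iso V n z = res_iso V n (SOME z'. res_iso V n z = res_iso V n z')"
      by (rule someI[of "\<lambda>z'. res_iso V n z = res_iso V n z'", OF refl])
    then have "\<forall>a<n. z a = (SOME z'. res_iso V n z = res_iso V n z') a"
      by (simp only: res_iso_eq_iff)
    then have "?D (SOME z'. res_iso V n z = res_iso V n z') = ?D z"
      by (simp add: lin_ext_def)
    then show ?thesis
      by (simp add: h_def res_iso_carrier)
  qed
  have h_hom: "h \<in> LinearCombinations.module_hom ?R ?T ?T'"
    unfolding LinearCombinations.module_hom_def
  proof (intro CollectI conjI allI impI Pi_I)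
    fix t assume "t \<in> carrier ?T"
    then show "h t \<in> carrier ?T'"
      by (auto simp: h_def res_iso_carrier)
  next
    fix t t' assume "t \<in> carrier ?T \<and> t' \<in> carrier ?T"
    then obtain z z' where "t = res_iso V n z" "t' = res_iso V n z'"
      by (metis res_iso_surj)
    then show "h (t \<oplus>\<^bsub>?T\<^esub> t') = h t \<oplus>\<^bsub>?T'\<^esub> h t'"
      by (simp add: h lin_ext_add flip: res_iso_add)
  next
    fix r t assume rt: "r \<in> carrier ?R \<and> t \<in> carrier ?T"
    then obtain z where "t = res_iso V n z"
      by (metis res_iso_surj)
    with rt show "h (r \<odot>\<^bsub>?T\<^esub> t) = r \<odot>\<^bsub>?T'\<^esub> h t"
      by (simp add: h lin_ext_smult flip: res_iso_smult)
  qed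
  have h_pure: "h (res_pure V n x c) = res_pure V m (f x) c" if x: "x \<in> carrier (fmod V {..<n})" for x c
  proof -
    have "?D (\<lambda>a. const_coeff (x a) * c) b = const_coeff (f x b) * c" if "b < m" for b
      unfolding f[OF x that]
      by (simp add: lin_ext_def red_def polys.eps_sum polys.eps_mult sum_distrib_left sum_distrib_right mult_ac)
    then show ?thesis
      unfolding pure_eq_res_iso[OF x] pure_eq_res_iso[OF f_closed[OF x]] h res_iso_eq_iff by simp
  qed
  have "tensor_map (poly_ring V) (fmod V {..<n}) (fmod V {..<m}) residue_module f = h"
    unfolding tensor_map_def
  proof (rule the_equality)
    show "h \<in> extensional (carrier ?T) \<and> h \<in> LinearCombinations.module_hom ?R ?T ?T'
      \<and> (\<forall>x\<in>carrier (fmod V {..<n}). \<forall>c\<in>carrier residue_module. h (res_pure V n x c) = res_pure V m (f x) c)"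
      using h_hom h_pure by (auto simp: h_def)
  next
    fix h' assume h': "h' \<in> extensional (carrier ?T) \<and> h' \<in> LinearCombinations.module_hom ?R ?T ?T'
      \<and> (\<forall>x\<in>carrier (fmod V {..<n}). \<forall>c\<in>carrier residue_module. h' (res_pure V n x c) = res_pure V m (f x) c)"
    note add = LinearCombinations.module_hom_add[of _ ?R ?T ?T']
    have b: "basis_vec V n k \<in> carrier (fmod V {..<n} :: (('v, 'k) mpoly, _) module)" if "k < n" for k
      using that by (intro free_gen_carrier) simp
    have "h' (res_sum V n k z) = h (res_sum V n k z)" if "k \<le> n" for k z
      using that
    proof (induction k)
      case 0
      have "u \<zero>\<^bsub>?T\<^esub> = \<zero>\<^bsub>?T'\<^esub>"
        if "u \<in> LinearCombinations.module_hom ?R ?T ?T'" for u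
        using LinearCombinations.module_hom_smult[OF that, of 0 "\<zero>\<^bsub>?T\<^esub>"]
          LinearCombinations.module_hom_closed[OF that] T.lmult_0[of "\<zero>\<^bsub>?T\<^esub>"]
          T'.lmult_0[of "u \<zero>\<^bsub>?T\<^esub>"]
        by (auto simp: polys.zero_A Pi_iff)
      from this[of h'] this[of h] show ?case
        using h' h_hom by simp
    next
      case (Suc k)
      then show ?case
        using h' h_hom h_pure b[of k] res_sum_carrier[of k n V z] pure_carrier[OF b, of k "z k"]
        by (simp add: add)
    qed
    then have eq: "h' (res_iso V n z) = h (res_iso V n z)" for z
      by (simp add: res_iso_def)
    show "h' = h"
    proof (rule extensionalityI[of _ "carrier ?T"])
      show "h' \<in> extensional (carrier ?T)" "h \<in> extensional (carrier ?T)"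
        using h' by (auto simp: h_def)
      fix t assume "t \<in> carrier ?T"
      then obtain z where "t = res_iso V n z"
        by (metis res_iso_surj)
      with eq show "h' t = h t"
        by simp
    qed
  qed
  then show ?thesis
    by (simp add: h)
qed

section \<open>The dimension of Tor\<close>

lemma restrict_scalars_simps [simp]:
  "carrier (restrict_scalars h X) = carrier X" "zero (restrict_scalars h X) = zero X"
  "add (restrict_scalars h X) = add X"
  "module.smult (restrict_scalars h X) = (\<lambda>r x. h r \<odot>\<^bsub>X\<^esub> x)"
  by (simp_all add: restrict_scalars_def ring.defs module.defs)

lemma const_simps:
  "const c \<in> polys V" "const (c * c') = const c * const c'" "const (c + c') = const c + const c'"
  "const 1 = 1" "const_coeff (const c) = c"
  by (simp_all add: const_def polys_def const_coeff_def mult_single single_add)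

lemma vectorspace_restrict_scalars:
  fixes X :: "(('v, 'k::field) mpoly, 'm) module"
  assumes "module (poly_ring V) X"
  shows "vectorspace (class_ring :: 'k ring) (restrict_scalars const X)"
proof -
  interpret X: Module.module "poly_ring V :: ('v, 'k) mpoly ring" X
    by fact
  have c: "const c \<in> carrier (poly_ring V :: ('v, 'k) mpoly ring)" for c
    by (simp add: const_simps)
  show ?thesis
  proof (rule vs_criteria)
    show "\<forall>v\<in>carrier (restrict_scalars const X). \<exists>w\<in>carrier (restrict_scalars const X).
        v \<oplus>\<^bsub>restrict_scalars const X\<^esub> w = \<zero>\<^bsub>restrict_scalars const X\<^esub>"
      using X.M.r_neg by force
    show "\<forall>a b v. a \<in> carrier class_ring \<and> b \<in> carrier class_ring \<and> v \<in> carrier (restrict_scalars const X) \<longrightarrow>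
      (a \<otimes>\<^bsub>class_ring\<^esub> b) \<odot>\<^bsub>restrict_scalars const X\<^esub> v = a \<odot>\<^bsub>restrict_scalars const X\<^esub> (b \<odot>\<^bsub>restrict_scalars const X\<^esub> v)"
      using X.smult_assoc1[OF c c] by (simp add: const_simps)
    show "\<forall>a b v. a \<in> carrier class_ring \<and> b \<in> carrier class_ring \<and> v \<in> carrier (restrict_scalars const X) \<longrightarrow>
      (a \<oplus>\<^bsub>class_ring\<^esub> b) \<odot>\<^bsub>restrict_scalars const X\<^esub> v
        = (a \<odot>\<^bsub>restrict_scalars const X\<^esub> v) \<oplus>\<^bsub>restrict_scalars const X\<^esub> (b \<odot>\<^bsub>restrict_scalars const X\<^esub> v)"
      using X.smult_l_distr[OF c c] by (simp add: const_simps)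
    show "\<forall>v\<in>carrier (restrict_scalars const X). \<one>\<^bsub>class_ring\<^esub> \<odot>\<^bsub>restrict_scalars const X\<^esub> v = v"
      using X.smult_one by (simp add: const_simps)
  qed (use X.smult_closed[OF c] X.smult_r_distr[OF c] in \<open>auto simp: class_field X.M.a_ac\<close>)
qed

lemma hom_eq_matrix:
  fixes f :: "(nat \<Rightarrow> ('v, 'k::field) mpoly) \<Rightarrow> (nat \<Rightarrow> ('v, 'k) mpoly)"
  assumes f: "f \<in> LinearCombinations.module_hom (poly_ring V) (fmod V {..<n}) (fmod V {..<m})"
    and x: "x \<in> carrier (fmod V {..<n})" and b: "b < m"
  shows "f x b = (\<Sum>a<n. x a * f (basis_vec V n a) b)"
  using x
proof (induction x rule: fmod_induct)
  case zero
  show ?case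
    unfolding module_hom_zero[OF module_fmod module_fmod f] using b by (simp add: fmod_simps)
next
  case (gen c)
  then show ?case
    by (simp add: free_gen_def if_distrib[of "\<lambda>x. x * _"] cong: if_cong)
next
  case (add x y)
  have "f (x \<oplus>\<^bsub>fmod V {..<n}\<^esub> y) = f x \<oplus>\<^bsub>fmod V {..<m}\<^esub> f y"
    by (rule LinearCombinations.module_hom_add[OF f add.hyps])
  then show ?case
    using add.IH b by (simp only:) (simp add: fmod_simps(3) distrib_right sum.distrib)
next
  case (smult c x)
  have "f (c \<odot>\<^bsub>fmod V {..<n}\<^esub> x) = c \<odot>\<^bsub>fmod V {..<m}\<^esub> f x"
    using smult.hyps by (intro LinearCombinations.module_hom_smult[OF f]) simp_all
  then show ?case
    using smult.IH b by (simp only:) (simp add: fmod_simps(4) sum_distrib_left mult.assoc)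
qed

text \<open>Vectors of a free module are \<open>undefined\<close> beyond the rank; replacing these
  values by 0 makes the rows elements of \<open>vecs\<close>.\<close>

definition diff_mat :: "'v set \<Rightarrow> (nat \<Rightarrow> nat) \<Rightarrow> (nat \<Rightarrow> (nat \<Rightarrow> ('v, 'k::field) mpoly) \<Rightarrow> (nat \<Rightarrow> ('v, 'k) mpoly))
    \<Rightarrow> nat \<Rightarrow> nat \<Rightarrow> nat \<Rightarrow> ('v, 'k) mpoly" where
  "diff_mat V n d i = (\<lambda>a b. if b < n i then d (Suc i) (basis_vec V (n (Suc i)) a) b else 0)"

lemma res_iso_zero:
  fixes V :: "'v set"
  shows "res_iso V n (\<lambda>_. 0 :: 'k::field) = \<zero>\<^bsub>res_tensor V n\<^esub>"
proof -
  interpret T: Module.module "poly_ring V :: ('v, 'k) mpoly ring" "res_tensor V n"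
    by (rule module_res_tensor)
  show ?thesis
    using res_iso_smult[of 0 V n "\<lambda>_. 0 :: 'k"] T.lmult_0[OF res_iso_carrier[of V n "\<lambda>_. 0 :: 'k"]]
    by (simp add: polys.zero_A)
qed

lemma submodule_res_iso:
  fixes U :: "(nat \<Rightarrow> 'k::field) set" and V :: "'v set"
  assumes U: "ksubspace U"
  shows "submodule (poly_ring V) (res_iso V n ` U) (res_tensor V n)"
proof (rule submodule.intro)
  show "module (poly_ring V :: ('v, 'k) mpoly ring) (res_tensor V n)"
    by (rule module_res_tensor)
  show "\<zero>\<^bsub>res_tensor V n\<^esub> \<in> res_iso V n ` U"
    using ksubspaceD(1)[OF U] by (metis imageI res_iso_zero)
qed (use ksubspaceD[OF U] in \<open>auto simp: res_iso_carrier simp flip: res_iso_add res_iso_smult\<close>)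

lemma res_iso_mem_iff:
  assumes "U \<subseteq> vecs UNIV {..<n}" "z \<in> vecs UNIV {..<n}"
  shows "res_iso V n z \<in> res_iso V n ` U \<longleftrightarrow> z \<in> U"
proof -
  have "z = z'" if "res_iso V n z = res_iso V n z'" "z' \<in> U" for z'
  proof
    fix a
    have "z' \<in> vecs UNIV {..<n}"
      using assms(1) that(2) by auto
    then show "z a = z' a"
      using that(1) assms(2) by (cases "a < n") (simp_all add: res_iso_eq_iff vecs_def)
  qed
  then show ?thesis by blast
qed

text \<open>A scalar acts on the tensor product through \<open>const\<close> as it acts on
  coordinates. Hence \<open>res_iso\<close> followed by the projection is linear over the field,
  onto, and has kernel \<open>N\<close>, and rank-nullity applies.\<close>

lemma dim_quot_res_iso:
  fixes Z N :: "(nat \<Rightarrow> 'k::field) set" and V :: "'v set"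
  assumes Z: "ksubspace Z" "Z \<subseteq> vecs UNIV {..<n}" and N: "ksubspace N" "N \<subseteq> Z"
  shows "vectorspace.dim (class_ring :: 'k ring) (restrict_scalars const
      (quot_module ((res_tensor V n)\<lparr>carrier := res_iso V n ` Z\<rparr>) (res_iso V n ` N))) = kdim Z - kdim N"
proof -
  let ?R = "poly_ring V :: ('v, 'k) mpoly ring"
  let ?T = "(res_tensor V n)\<lparr>carrier := res_iso V n ` Z\<rparr>" and ?N = "res_iso V n ` N :: ((nat \<Rightarrow> ('v, 'k) mpoly) \<times> 'k \<Rightarrow> ('v, 'k) mpoly) set set"
  let ?Q = "quot_module ?T ?N"
  have T: "module ?R ?T"
    by (rule LinearCombinations.module.submodule_is_module[OF module_res_tensor submodule_res_iso[OF Z(1)]])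
  have N': "submodule ?R ?N ?T"
    using submodule_res_iso[OF N(1), of V n] N(2) T by (auto simp: submodule_def)
  note q = quot_module[OF T N']
  let ?f = "\<lambda>z. ?N +>\<^bsub>?T\<^esub> res_iso V n z"
  have W: "vectorspace (class_ring :: 'k ring) (restrict_scalars const ?Q)"
    by (rule vectorspace_restrict_scalars[OF q(1)])
  have h: "?f \<in> LinearCombinations.module_hom (class_ring :: 'k ring) (kspace Z) (restrict_scalars const ?Q)"
    unfolding LinearCombinations.module_hom_def
  proof (intro CollectI conjI allI impI Pi_I)
    show "?f z \<in> carrier (restrict_scalars const ?Q)" if "z \<in> carrier (kspace Z)" for z
      using that LinearCombinations.module_hom_closed[OF q(2)] by auto
    show "?f (z \<oplus>\<^bsub>kspace Z\<^esub> z') = ?f z \<oplus>\<^bsub>restrict_scalars const ?Q\<^esub> ?f z'"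
      if "z \<in> carrier (kspace Z) \<and> z' \<in> carrier (kspace Z)" for z z'
      using that LinearCombinations.module_hom_add[OF q(2), of "res_iso V n z" "res_iso V n z'"]
      by (simp add: res_iso_add)
    show "?f (c \<odot>\<^bsub>kspace Z\<^esub> z) = c \<odot>\<^bsub>restrict_scalars const ?Q\<^esub> ?f z"
      if "c \<in> carrier class_ring \<and> z \<in> carrier (kspace Z)" for c z
      using that LinearCombinations.module_hom_smult[OF q(2), of "const c" "res_iso V n z"]
        res_iso_smult[of "const c" V n z] by (simp add: const_simps)
  qed
  have surj: "?f ` Z = carrier (restrict_scalars const ?Q)"
    using q(3) by (simp add: image_image)
  have "?f z = \<zero>\<^bsub>restrict_scalars const ?Q\<^esub> \<longleftrightarrow> z \<in> N" if z: "z \<in> Z" for z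
  proof -
    have "z \<in> vecs UNIV {..<n}" "N \<subseteq> vecs UNIV {..<n}"
      using z N(2) Z(2) by auto
    then have "res_iso V n z \<in> ?N \<longleftrightarrow> z \<in> N"
      by (intro res_iso_mem_iff)
    then show ?thesis
      using coset_eq_zero_iff[OF T N', of "res_iso V n z"] z by (simp add: quot_module_simps)
  qed
  then have "{z \<in> Z. ?f z = \<zero>\<^bsub>restrict_scalars const ?Q\<^esub>} = N"
    using N(2) by blast
  moreover have "(restrict_scalars const ?Q)\<lparr>carrier := ?f ` Z\<rparr> = restrict_scalars const ?Q"
    unfolding surj by simp
  ultimately have "vectorspace.dim (class_ring :: 'k ring) (restrict_scalars const ?Q) + kdim N = kdim Z"
    using rank_nullity_kspace(1)[OF finite_lessThan Z W h] by simp
  then show ?thesis by simp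
qed

text \<open>The resolution selected inside \<open>Tor\<close> is known only to be a resolution,
  provided that one exists; so it is handed out as an unspecified witness, to be compared with a
  concrete one later.\<close>

lemma betti_free_resolution:
  fixes X :: "(('v, 'k::field) mpoly, 'm) module"
  assumes ex: "\<exists>n d e. free_resolution (poly_ring V) X n d e"
  obtains n d e where "free_resolution (poly_ring V) X n d e"
    "betti V i X = kdim (kcycles (\<lambda>i. {..<n i}) (\<lambda>i. red const_coeff (diff_mat V n d i)) i)
      - kdim (kboundaries (\<lambda>i. {..<n i}) (\<lambda>i. red const_coeff (diff_mat V n d i)) i)"
proof -
  define p where "p = (SOME (n, d, e). free_resolution (poly_ring V) X n d e)"
  obtain n d e where "p = (n, d, e)"
    by (cases p)
  then have nde: "(SOME (n, d, e). free_resolution (poly_ring V) X n d e) = (n, d, e)"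
    by (simp add: p_def)
  have "case p of (n, d, e) \<Rightarrow> free_resolution (poly_ring V) X n d e"
    unfolding p_def by (rule someI_ex) (use ex in auto)
  then have res: "free_resolution (poly_ring V) X n d e"
    by (simp add: \<open>p = (n, d, e)\<close>)
  let ?B = "\<lambda>i. {..<n i}" and ?D = "\<lambda>i. red const_coeff (diff_mat V n d i) :: nat \<Rightarrow> nat \<Rightarrow> 'k"
  let ?F = "\<lambda>i. fmod V {..<n i} :: (('v, 'k) mpoly, _) module"
  let ?T = "\<lambda>i. res_tensor V (n i) :: (('v, 'k) mpoly, _) module"
  let ?\<delta> = "\<lambda>j. tensor_map (poly_ring V) (?F (Suc j)) (?F j) (residue_module :: (('v, 'k) mpoly, 'k) module) (d (Suc j))"
  have d: "d (Suc j) \<in> LinearCombinations.module_hom (poly_ring V) (?F (Suc j)) (?F j)"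
    and dd: "a_kernel (?F (Suc j)) (?F j) (d (Suc j)) = d (Suc (Suc j)) ` carrier (?F (Suc (Suc j)))" for j
    using res by (auto simp: free_resolution_def Let_def)
  have \<delta>: "?\<delta> j (res_iso V (n (Suc j)) z) = res_iso V (n j) (lin_ext {..<n (Suc j)} (?D j) z)" for j z
  proof (rule tensor_map_res_iso)
    fix x assume x: "x \<in> carrier (?F (Suc j))"
    show "d (Suc j) x \<in> carrier (?F j)"
      using LinearCombinations.module_hom_closed[OF d] x by (rule funcset_mem)
    show "d (Suc j) x b = (\<Sum>a<n (Suc j). x a * diff_mat V n d j a b)" if "b < n j" for b
      using hom_eq_matrix[OF d x that] that by (simp add: diff_mat_def)
  qed
  have carrier: "carrier (?T j) = res_iso V (n j) ` vecs UNIV {..<n j}" for j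
    using res_iso_carrier by (auto elim: res_iso_surj)
  have D_vecs: "lin_ext {..<n (Suc j)} (?D j) z \<in> vecs UNIV {..<n j}" for j z
    by (auto simp: vecs_def lin_ext_def red_def diff_mat_def polys.eps_zero)
  have B: "?\<delta> j ` carrier (?T (Suc j)) = res_iso V (n j) ` kboundaries ?B ?D j" for j
    by (simp add: carrier kboundaries_def image_image \<delta>)
  have Z: "(case i of 0 \<Rightarrow> carrier (?T 0) | Suc j \<Rightarrow> a_kernel (?T (Suc j)) (?T j) (?\<delta> j))
      = res_iso V (n i) ` kcycles ?B ?D i"
  proof (cases i)
    case 0
    then show ?thesis by (simp add: carrier)
  next
    case (Suc j)
    have "res_iso V (n j) (lin_ext {..<n (Suc j)} (?D j) z) = \<zero>\<^bsub>?T j\<^esub> \<longleftrightarrow> lin_ext {..<n (Suc j)} (?D j) z = (\<lambda>_. 0)" for z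
    proof -
      have "lin_ext {..<n (Suc j)} (?D j) z b = 0" if "\<not> b < n j" for b
        using D_vecs[of j z] that by (simp add: vecs_def)
      then show ?thesis
        unfolding res_iso_zero[symmetric] res_iso_eq_iff fun_eq_iff by blast
    qed
    then show ?thesis
      by (auto simp: Suc a_kernel_def' carrier \<delta> res_iso_zero)
  qed
  have sub: "kboundaries ?B ?D i \<subseteq> kcycles ?B ?D i"
  proof (cases i)
    case 0
    then show ?thesis
      using D_vecs by (auto simp: kboundaries_def)
  next
    case (Suc j)
    have "lin_ext {..<n i} (diff_mat V n d j) (diff_mat V n d i a) = (\<lambda>_. 0)" if a: "a < n (Suc i)" for a
    proof -
      let ?y = "d (Suc i) (basis_vec V (n (Suc i)) a)"
      have "basis_vec V (n (Suc i)) a \<in> carrier (?F (Suc i))"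
        using a by (intro free_gen_carrier) simp
      then have "?y \<in> a_kernel (?F (Suc j)) (?F j) (d (Suc j))"
        unfolding dd Suc by simp
      then have y: "?y \<in> carrier (?F (Suc j))" "d (Suc j) ?y = \<zero>\<^bsub>?F j\<^esub>"
        by (auto simp: a_kernel_def')
      show ?thesis
      proof
        fix b
        show "lin_ext {..<n i} (diff_mat V n d j) (diff_mat V n d i a) b = 0"
          using hom_eq_matrix[OF d y(1), of b] y(2)
          by (cases "b < n j") (auto simp: lin_ext_def diff_mat_def Suc fmod_simps)
      qed
    qed
    then have "lin_ext {..<n (Suc i)} (red const_coeff (\<lambda>a. lin_ext {..<n i} (diff_mat V n d j) (diff_mat V n d i a))) x
      = lin_ext {..<n (Suc i)} (red const_coeff (\<lambda>a s. 0 :: ('v, 'k) mpoly)) x" for x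
      by (intro polys.red_eqD) auto
    then have "lin_ext {..<n i} (?D j) (lin_ext {..<n (Suc i)} (?D i) x) = (\<lambda>_. 0)" for x
      unfolding lin_ext_comp polys.red_lin_ext by (simp add: red_def lin_ext_def polys.eps_zero)
    then show ?thesis
      using D_vecs Suc by (auto simp: kboundaries_def)
  qed
  have "betti V i X = vectorspace.dim (class_ring :: 'k ring) (restrict_scalars const
      (quot_module ((?T i)\<lparr>carrier := res_iso V (n i) ` kcycles ?B ?D i\<rparr>) (res_iso V (n i) ` kboundaries ?B ?D i)))"
    unfolding betti_def Tor_def nde Let_def prod.case B[symmetric] Z[symmetric] ..
  also have "\<dots> = kdim (kcycles ?B ?D i) - kdim (kboundaries ?B ?D i)"
    by (rule dim_quot_res_iso[OF ksubspace_kcycles kcycles_subset ksubspace_kboundaries sub])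
  finally show thesis
    using res by (rule that[rotated])
qed

section \<open>Resolutions of cyclic modules\<close>

text \<open>\<open>q\<close> presents the module \<open>X\<close> as the quotient by
  \<open>I\<close>, so that everything about \<open>X\<close> can be expressed by polynomials modulo
  \<open>I\<close>.\<close>

locale cyclic_module = augmented_ideal "polys V :: ('v, 'k::field) mpoly set" const_coeff I
  for V :: "'v set" and I :: "('v, 'k::field) mpoly set" +
  fixes X :: "(('v, 'k) mpoly, 'm) module" and q :: "('v, 'k) mpoly \<Rightarrow> 'm"
  assumes module_X: "module (poly_ring V) X"
    and I_polys: "I \<subseteq> polys V"
    and q_surj: "q ` polys V = carrier X"
    and q_add: "f \<in> polys V \<Longrightarrow> g \<in> polys V \<Longrightarrow> q (f + g) = q f \<oplus>\<^bsub>X\<^esub> q g"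
    and q_smult: "f \<in> polys V \<Longrightarrow> g \<in> polys V \<Longrightarrow> q (f * g) = f \<odot>\<^bsub>X\<^esub> q g"
    and q_eq_zero_iff: "f \<in> polys V \<Longrightarrow> q f = \<zero>\<^bsub>X\<^esub> \<longleftrightarrow> f \<in> I"
begin

lemma q_eqI:
  assumes "f \<in> polys V" "g \<in> polys V" "f - g \<in> I"
  shows "q f = q g"
proof -
  interpret X: Module.module "poly_ring V :: ('v, 'k) mpoly ring" X
    by (rule module_X)
  have "q (f - g) = \<zero>\<^bsub>X\<^esub>"
    using assms polys.diff_A q_eq_zero_iff by blast
  moreover have "q f = q (f - g) \<oplus>\<^bsub>X\<^esub> q g"
    using q_add[of "f - g" g] assms by (simp add: polys.diff_A)
  moreover have "q g \<in> carrier X"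
    using assms(2) q_surj by blast
  ultimately show ?thesis by simp
qed

lemma q_eqD:
  assumes "f \<in> polys V" "g \<in> polys V" "q f = q g"
  shows "f - g \<in> I"
proof -
  interpret X: Module.module "poly_ring V :: ('v, 'k) mpoly ring" X
    by (rule module_X)
  have "q (f - g) \<in> carrier X" "q g \<in> carrier X"
    using assms q_surj polys.diff_A by blast+
  moreover have "q f = q (f - g) \<oplus>\<^bsub>X\<^esub> q g"
    using q_add[of "f - g" g] assms by (simp add: polys.diff_A)
  ultimately have "q (f - g) = \<zero>\<^bsub>X\<^esub>"
    using assms(3) X.M.add.r_cancel_one' by metis
  then show ?thesis
    using q_eq_zero_iff polys.diff_A assms by blast
qed

text \<open>The dictionary between linear maps on free modules and matrices. Both directions are
  used: the Taylor matrices give the existence of a free resolution, and the chosen free resolution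
  is turned into matrices for the comparison.\<close>

lemma free_resolution_iff:
  fixes B :: "nat \<Rightarrow> 'b set" and n :: "nat \<Rightarrow> nat"
  assumes en: "\<And>i. bij_betw (en i) {..<n i} (B i)"
    and d: "\<And>i y. y \<in> carrier (fmod V {..<n (Suc i)}) \<Longrightarrow> d (Suc i) y
      = (\<lambda>b\<in>{..<n i}. \<Sum>a<n (Suc i). y a * D i (en (Suc i) a) (en i b))"
    and e: "\<And>y. y \<in> carrier (fmod V {..<n 0}) \<Longrightarrow> e y = q (\<Sum>a<n 0. y a * E (en 0 a))"
    and D: "\<And>i t. t \<in> B (Suc i) \<Longrightarrow> D i t \<in> vecs (polys V) (B i)"
    and E: "\<And>t. t \<in> B 0 \<Longrightarrow> E t \<in> polys V"
  shows "free_resolution (poly_ring V) X n d e \<longleftrightarrow> polys.mat_resolution V I B D E"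
proof -
  let ?R = "poly_ring V :: ('v, 'k) mpoly ring"
  let ?F = "\<lambda>i. fmod V {..<n i} :: (('v, 'k) mpoly, nat \<Rightarrow> ('v, 'k) mpoly) module"
  let ?D = "\<lambda>i. lin_ext (B (Suc i)) (D i)"
  let ?E = "\<lambda>x. \<Sum>t\<in>B 0. x t * E t"
  \<comment> \<open>The change of convention: from vectors indexed by \<open>B i\<close> and zero
    outside to vectors indexed by numbers below \<open>n i\<close> and undefined outside.\<close>
  define un where "un = (\<lambda>i x. \<lambda>a\<in>{..<n i}. x (en i a) :: ('v, 'k) mpoly)"
  have fin: "finite (B i)" for i
    using bij_betw_finite[OF en[of i]] by simp
  have mem: "en i a \<in> B i" if "a < n i" for i a
    using bij_betwE[OF en[of i]] that by simp
  have carrier: "carrier (?F i) = {..<n i} \<rightarrow>\<^sub>E polys V" for i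
    by (rule fmod_carrier_finite) simp
  have un_carrier: "un i x \<in> carrier (?F i)" if "x \<in> vecs (polys V) (B i)" for i x
    using that mem by (auto simp: carrier un_def vecs_def)
  have un_surj: "\<exists>x\<in>vecs (polys V) (B i). y = un i x" if y: "y \<in> carrier (?F i)" for i y
  proof (intro bexI)
    let ?x = "\<lambda>t. if t \<in> B i then y (inv_into {..<n i} (en i) t) else 0"
    have inv: "inv_into {..<n i} (en i) t < n i" if "t \<in> B i" for t
      using bij_betwE[OF bij_betw_inv_into[OF en[of i]]] that by simp
    then show "?x \<in> vecs (polys V) (B i)"
      using y by (auto simp: vecs_def carrier)
    have "inv_into {..<n i} (en i) (en i a) = a" if "a < n i" for a
      using bij_betw_inv_into_left[OF en[of i]] that by simp
    then show "y = un i ?x"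
      using y mem by (intro extensionalityI[of _ "{..<n i}"]) (auto simp: un_def carrier PiE_iff)
  qed
  have un_inj: "x = x'" if "x \<in> vecs (polys V) (B i)" "x' \<in> vecs (polys V) (B i)" "un i x = un i x'" for i x x'
  proof
    fix t
    show "x t = x' t"
    proof (cases "t \<in> B i")
      case True
      then obtain a where "a < n i" "t = en i a"
        using bij_betw_imp_surj_on[OF en[of i]] by auto
      then show ?thesis
        using fun_cong[OF that(3), of a] by (simp add: un_def)
    qed (use that in \<open>simp add: vecs_def\<close>)
  qed
  have reindex: "(\<Sum>a<n i. f (en i a)) = (\<Sum>t\<in>B i. f t)" for i and f :: "'b \<Rightarrow> ('v, 'k) mpoly"
    using sum.reindex_bij_betw[OF en[of i], of f] .
  have D_vecs: "?D i x \<in> vecs (polys V) (B i)" if "x \<in> vecs (polys V) (B (Suc i))" for i x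
    by (rule polys.lin_ext_vecs[OF D that])
  have E_polys: "?E x \<in> polys V" if "x \<in> vecs (polys V) (B 0)" for x
    using that E by (intro polys.sum_A polys.mult_A) (auto simp: vecs_def)
  have d_un: "d (Suc i) (un (Suc i) x) = un i (?D i x)" if x: "x \<in> vecs (polys V) (B (Suc i))" for i x
    using d[OF un_carrier[OF x]] by (simp add: un_def lin_ext_def reindex[symmetric])
  have e_un: "e (un 0 x) = q (?E x)" if x: "x \<in> vecs (polys V) (B 0)" for x
    using e[OF un_carrier[OF x]] by (simp add: un_def reindex[symmetric])
  have un_image: "carrier (?F i) = un i ` vecs (polys V) (B i)" for i
    using un_carrier un_surj by blast
  have un_zero: "\<zero>\<^bsub>?F i\<^esub> = un i (\<lambda>_. 0)" for i
    by (simp add: fmod_simps un_def)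
  have un_add: "un i x \<oplus>\<^bsub>?F i\<^esub> un i x' = un i (\<lambda>t. x t + x' t)" for i x x'
    by (auto simp: fmod_simps un_def)
  have un_smult: "r \<odot>\<^bsub>?F i\<^esub> un i x = un i (\<lambda>t. r * x t)" for i r x
    by (auto simp: fmod_simps un_def)
  have vecs0: "(\<lambda>_. 0) \<in> vecs (polys V) (B i)" for i
    by (simp add: vecs_def polys.zero_A)
  have vecs_add: "(\<lambda>t. x t + x' t) \<in> vecs (polys V) (B i)"
    if "x \<in> vecs (polys V) (B i)" "x' \<in> vecs (polys V) (B i)" for i and x x' :: "'b \<Rightarrow> ('v, 'k) mpoly"
    using that by (auto simp: vecs_def polys.add_A)
  have vecs_smult: "(\<lambda>t. r * x t) \<in> vecs (polys V) (B i)"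
    if "r \<in> polys V" "x \<in> vecs (polys V) (B i)" for i r and x :: "'b \<Rightarrow> ('v, 'k) mpoly"
    using that by (auto simp: vecs_def polys.mult_A)
  have d_hom: "d (Suc i) \<in> LinearCombinations.module_hom ?R (?F (Suc i)) (?F i)" for i
    unfolding LinearCombinations.module_hom_def un_image
    by (auto simp: d_un un_add un_smult vecs_add vecs_smult D_vecs lin_ext_add lin_ext_smult)
  have e_hom: "e \<in> LinearCombinations.module_hom ?R (?F 0) X"
  proof -
    have "?E (\<lambda>t. x t + x' t) = ?E x + ?E x'" "?E (\<lambda>t. r * x t) = r * ?E x" for x x' r
      by (simp_all add: distrib_right sum.distrib sum_distrib_left mult.assoc)
    then show ?thesis
      unfolding LinearCombinations.module_hom_def un_image using q_surj
      by (auto simp: e_un un_add un_smult vecs_add vecs_smult E_polys q_add q_smult)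
  qed
  \<comment> \<open>\<open>X\<close> is generated by \<open>q 1\<close>, so it suffices to reach 1
    modulo \<open>I\<close>.\<close>
  have e_surj: "e ` carrier (?F 0) = carrier X \<longleftrightarrow> (\<exists>x\<in>vecs (polys V) (B 0). ?E x - 1 \<in> I)"
  proof
    assume "e ` carrier (?F 0) = carrier X"
    moreover have "q 1 \<in> carrier X"
      using q_surj polys.one_A by blast
    ultimately have "q 1 \<in> e ` un 0 ` vecs (polys V) (B 0)"
      by (simp add: un_image)
    then obtain x where "x \<in> vecs (polys V) (B 0)" "q 1 = q (?E x)"
      using e_un by force
    then show "\<exists>x\<in>vecs (polys V) (B 0). ?E x - 1 \<in> I"
      using q_eqD[of "?E x" 1] E_polys polys.one_A by auto
  next
    assume "\<exists>x\<in>vecs (polys V) (B 0). ?E x - 1 \<in> I"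
    then obtain x where x: "x \<in> vecs (polys V) (B 0)" "?E x - 1 \<in> I" by auto
    have "q f \<in> e ` carrier (?F 0)" if f: "f \<in> polys V" for f
    proof -
      have "?E (\<lambda>t. f * x t) - f = f * (?E x - 1)"
        by (simp add: right_diff_distrib sum_distrib_left mult.assoc)
      then have "?E (\<lambda>t. f * x t) - f \<in> I"
        using mult_I[OF f x(2)] by simp
      then have "q (?E (\<lambda>t. f * x t)) = q f"
        by (intro q_eqI E_polys vecs_smult f x)
      then have "q f = e (un 0 (\<lambda>t. f * x t))"
        by (simp add: e_un vecs_smult f x)
      then show ?thesis
        using un_carrier[OF vecs_smult[OF f x(1)]] by blast
    qed
    then have "carrier X \<subseteq> e ` carrier (?F 0)"
      unfolding q_surj[symmetric] by (rule image_subsetI)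
    moreover have "e ` carrier (?F 0) \<subseteq> carrier X"
      using LinearCombinations.module_hom_closed[OF e_hom] by (rule funcset_image)
    ultimately show "e ` carrier (?F 0) = carrier X"
      by (rule antisym[rotated])
  qed
  have inj: "un i ` S = un i ` S' \<longleftrightarrow> S = S'"
    if "S \<subseteq> vecs (polys V) (B i)" "S' \<subseteq> vecs (polys V) (B i)" for i S S'
    by (rule inj_on_image_eq_iff[OF _ that]) (use un_inj in \<open>auto simp: inj_on_def\<close>)
  have image: "d (Suc i) ` carrier (?F (Suc i)) = un i ` ?D i ` vecs (polys V) (B (Suc i))" for i
    unfolding un_image image_image by (auto simp: d_un)
  have ker0: "a_kernel (?F 0) X e = un 0 ` polys.cycles V I B D E 0"
    unfolding a_kernel_def' un_image by (auto simp: e_un q_eq_zero_iff E_polys)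
  have "d (Suc i) (un (Suc i) x) = \<zero>\<^bsub>?F i\<^esub> \<longleftrightarrow> ?D i x = (\<lambda>_. 0)"
    if "x \<in> vecs (polys V) (B (Suc i))" for i x
    unfolding d_un[OF that] un_zero using un_inj[OF D_vecs[OF that] vecs0] by auto
  then have kerS: "a_kernel (?F (Suc i)) (?F i) (d (Suc i)) = un (Suc i) ` polys.cycles V I B D E (Suc i)" for i
    unfolding a_kernel_def' un_image by auto
  have cyc: "polys.cycles V I B D E i \<subseteq> vecs (polys V) (B i)" for i
    using polys.cycles_vecs by blast
  have im: "?D i ` vecs (polys V) (B (Suc i)) \<subseteq> vecs (polys V) (B i)" for i
    using D_vecs by blast
  have all_nat: "(\<forall>i. Q i) \<longleftrightarrow> Q 0 \<and> (\<forall>i. Q (Suc i))" for Q :: "nat \<Rightarrow> bool"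
    by (metis not0_implies_Suc)
  define exact where "exact i \<longleftrightarrow> polys.cycles V I B D E i = ?D i ` vecs (polys V) (B (Suc i))" for i
  have "a_kernel (?F 0) X e = d 1 ` carrier (?F 1) \<longleftrightarrow> exact 0"
    unfolding One_nat_def ker0 image exact_def by (rule inj[OF cyc im])
  moreover have "a_kernel (?F (Suc i)) (?F i) (d (Suc i)) = d (Suc (Suc i)) ` carrier (?F (Suc (Suc i))) \<longleftrightarrow> exact (Suc i)" for i
    unfolding kerS image exact_def by (rule inj[OF cyc im])
  ultimately have "free_resolution (poly_ring V) X n d e \<longleftrightarrow> (\<exists>x\<in>vecs (polys V) (B 0). ?E x - 1 \<in> I) \<and> (\<forall>i. exact i)"
    unfolding free_resolution_def Let_def e_surj all_nat[of exact] using d_hom e_hom by simp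
  moreover have "polys.mat_resolution V I B D E \<longleftrightarrow> (\<exists>x\<in>vecs (polys V) (B 0). ?E x - 1 \<in> I) \<and> (\<forall>i. exact i)"
    unfolding polys.mat_resolution_def exact_def using fin D E by simp
  ultimately show ?thesis
    by simp
qed

text \<open>The values of the augmentation on the basis are lifted along \<open>q\<close> to
  polynomials, which form \<open>E\<close>.\<close>

lemma mat_resolution_of_free_resolution:
  assumes res: "free_resolution (poly_ring V) X n d e"
  obtains E where "polys.mat_resolution V I (\<lambda>i. {..<n i}) (diff_mat V n d) E"
proof -
  let ?F = "\<lambda>i. fmod V {..<n i} :: (('v, 'k) mpoly, nat \<Rightarrow> ('v, 'k) mpoly) module"
  have e: "e \<in> LinearCombinations.module_hom (poly_ring V) (?F 0) X"
    and d: "d (Suc i) \<in> LinearCombinations.module_hom (poly_ring V) (?F (Suc i)) (?F i)" for i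
    using res by (auto simp: free_resolution_def Let_def)
  have basis: "basis_vec V (n i) a \<in> carrier (?F i)" if "a < n i" for i a
    using that by (intro free_gen_carrier) simp
  have carrier: "carrier (?F i) = {..<n i} \<rightarrow>\<^sub>E polys V" for i
    by (rule fmod_carrier_finite) simp
  have "\<exists>f\<in>polys V. e (basis_vec V (n 0) a) = q f" if "a < n 0" for a
    using LinearCombinations.module_hom_closed[OF e] basis[OF that] q_surj by (auto simp: Pi_iff)
  then obtain E where E: "\<And>a. a < n 0 \<Longrightarrow> E a \<in> polys V" "\<And>a. a < n 0 \<Longrightarrow> e (basis_vec V (n 0) a) = q (E a)"
    by metis
  have eq: "e y = q (\<Sum>a<n 0. y a * E a)" if "y \<in> carrier (?F 0)" for y
    using that
  proof (induction y rule: fmod_induct)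
    case zero
    have "q 0 = \<zero>\<^bsub>X\<^esub>"
      using q_eq_zero_iff[of 0] zero_I by (simp add: polys.zero_A)
    then show ?case
      unfolding module_hom_zero[OF module_fmod module_X e] by (simp add: fmod_simps(2))
  next
    case (gen b)
    then have "(\<Sum>a<n 0. basis_vec V (n 0) b a * E a) = E b"
      by (simp add: free_gen_def if_distrib[of "\<lambda>x. x * _"] cong: if_cong)
    with gen show ?case
      by (simp only: E(2) lessThan_iff)
  next
    case (add f g)
    have "(\<Sum>a<n 0. f a * E a) \<in> polys V" "(\<Sum>a<n 0. g a * E a) \<in> polys V"
      using add.hyps E(1) by (auto simp: carrier intro!: polys.sum_A polys.mult_A)
    moreover have "e (f \<oplus>\<^bsub>?F 0\<^esub> g) = e f \<oplus>\<^bsub>X\<^esub> e g"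
      by (rule LinearCombinations.module_hom_add[OF e add.hyps])
    ultimately show ?case
      using add.IH by (simp only:) (simp add: fmod_simps(3) distrib_right sum.distrib q_add)
  next
    case (smult c f)
    have "(\<Sum>a<n 0. f a * E a) \<in> polys V"
      using smult.hyps E(1) by (auto simp: carrier intro!: polys.sum_A polys.mult_A)
    moreover have "e (c \<odot>\<^bsub>?F 0\<^esub> f) = c \<odot>\<^bsub>X\<^esub> e f"
      using smult.hyps by (intro LinearCombinations.module_hom_smult[OF e]) simp_all
    ultimately show ?case
      using smult.IH smult.hyps
      by (simp only:) (simp add: fmod_simps(4) q_smult[symmetric] sum_distrib_left mult.assoc)
  qed
  have closed: "d (Suc i) y \<in> carrier (?F i)" if "y \<in> carrier (?F (Suc i))" for i y
    using LinearCombinations.module_hom_closed[OF d] that by (rule funcset_mem)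
  have "polys.mat_resolution V I (\<lambda>i. {..<n i}) (diff_mat V n d) E"
  proof (subst free_resolution_iff[symmetric, where en = "\<lambda>_ a. a" and n = n])
    show "bij_betw (\<lambda>a. a) {..<n i} {..<n i}" for i
      by (simp add: bij_betw_def)
    show "d (Suc i) y = (\<lambda>b\<in>{..<n i}. \<Sum>a<n (Suc i). y a * diff_mat V n d i a b)"
      if "y \<in> carrier (?F (Suc i))" for i y
      using closed[OF that] hom_eq_matrix[OF d that]
      by (intro extensionalityI[of _ "{..<n i}"]) (auto simp: carrier PiE_iff diff_mat_def)
    show "diff_mat V n d i a \<in> vecs (polys V) {..<n i}" if "a \<in> {..<n (Suc i)}" for i a
      using closed[OF basis[of a "Suc i"]] that by (auto simp: diff_mat_def vecs_def carrier)
  qed (use eq E(1) res in auto)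
  then show thesis
    by (rule that)
qed

lemma free_resolution_of_mat_resolution:
  fixes B :: "nat \<Rightarrow> 'b set"
  assumes R: "polys.mat_resolution V I B D E"
  shows "\<exists>n d e. free_resolution (poly_ring V) X n d e"
proof -
  note r = polys.mat_resolutionD[OF R]
  have "\<exists>f. bij_betw f {..<card (B i)} (B i)" for i
    using ex_bij_betw_nat_finite[OF r(1)[of i]] by (simp add: atLeast0LessThan)
  then obtain en where en: "\<And>i. bij_betw (en i) {..<card (B i)} (B i)"
    by metis
  have "free_resolution (poly_ring V) X (\<lambda>i. card (B i))
    (\<lambda>j y. case j of 0 \<Rightarrow> y | Suc i \<Rightarrow> \<lambda>b\<in>{..<card (B i)}. \<Sum>a<card (B (Suc i)). y a * D i (en (Suc i) a) (en i b))
    (\<lambda>y. q (\<Sum>a<card (B 0). y a * E (en 0 a)))"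
    by (subst free_resolution_iff[OF en, where D = D and E = E]) (use r R in auto)
  then show ?thesis by blast
qed

text \<open>Comparison in both directions shows that any resolution may replace the chosen one, and
  the boundaries are then traded for cycles. The rank is added on the left to avoid truncated
  subtraction.\<close>

lemma betti_mat_resolution:
  fixes B :: "nat \<Rightarrow> 'b set"
  assumes R: "polys.mat_resolution V I B D E"
  shows "betti V i X + kdim (vecs UNIV (B (Suc i)) :: ('b \<Rightarrow> 'k) set)
    = kdim (rcycles B D i) + kdim (rcycles B D (Suc i))"
proof -
  obtain n d e where res: "free_resolution (poly_ring V) X n d e"
    and betti: "betti V i X = kdim (rcycles (\<lambda>i. {..<n i}) (diff_mat V n d) i)
      - kdim (rboundaries (\<lambda>i. {..<n i}) (diff_mat V n d) i)"
    using betti_free_resolution[OF free_resolution_of_mat_resolution[OF R], of i] by metis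
  obtain E' where R': "polys.mat_resolution V I (\<lambda>i. {..<n i}) (diff_mat V n d) E'"
    using mat_resolution_of_free_resolution[OF res] by blast
  have "betti V i X = kdim (rcycles B D i) - kdim (rboundaries B D i)"
    unfolding betti by (rule antisym[OF homology_dim_le[OF R' R] homology_dim_le[OF R R']])
  moreover have "kdim (rboundaries B D i) \<le> kdim (rcycles B D i)"
    by (rule kdim_mono[OF polys.mat_resolutionD(1)[OF R] ksubspace_kboundaries ksubspace_kcycles
          rboundaries_subset[OF R] kcycles_subset])
  moreover have "kdim (rboundaries B D i) + kdim (rcycles B D (Suc i)) = kdim (vecs UNIV (B (Suc i)) :: ('b \<Rightarrow> 'k) set)"
    by (rule kdim_kboundaries[OF polys.mat_resolutionD(1)[OF R]])
  ultimately show ?thesis by linarith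
qed

end

section \<open>The algebras attached to a pair of posets\<close>

lemma regular_module_simps [simp]:
  "carrier (regular_module A) = carrier A" "zero (regular_module A) = zero A"
  "add (regular_module A) = add A" "module.smult (regular_module A) = mult A"
  by (simp_all add: regular_module_def ring.defs module.defs)

lemma augmented_ideal_of_ideal:
  fixes I :: "('v, 'k::field) mpoly set"
  assumes "ideal I (poly_ring V)"
  shows "augmented_ideal (polys V) const_coeff I"
proof -
  interpret ideal I "poly_ring V :: ('v, 'k) mpoly ring"
    by fact
  show ?thesis
    by unfold_locales (use zero_closed a_closed I_l_closed in auto)
qed

lemma cyclic_module_quotient:
  fixes I :: "('v, 'k::field) mpoly set"
  assumes I: "ideal I (poly_ring V)"
  shows "cyclic_module V I
    (restrict_scalars (\<lambda>f. I +>\<^bsub>poly_ring V\<^esub> f) (regular_module (poly_ring V Quot I))) (\<lambda>f. I +>\<^bsub>poly_ring V\<^esub> f)"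
proof -
  let ?R = "poly_ring V :: ('v, 'k) mpoly ring"
  let ?A = "?R Quot I"
  let ?q = "\<lambda>f. I +>\<^bsub>?R\<^esub> f"
  interpret ideal I ?R
    by fact
  interpret augmented_ideal "polys V" const_coeff I
    by (rule augmented_ideal_of_ideal[OF I])
  interpret A: cring ?A
    by (rule quotient_is_cring[OF cring_poly_ring])
  have hom: "?q \<in> Ring.ring_hom ?R ?A"
    by (rule rcos_ring_hom)
  have closed: "?q f \<in> carrier ?A" if "f \<in> polys V" for f
    using ring_hom_closed[OF hom] that by simp
  have one: "?q 1 = \<one>\<^bsub>?A\<^esub>"
    using ring_hom_one[OF hom] by simp
  have add: "?q (f + g) = ?q f \<oplus>\<^bsub>?A\<^esub> ?q g" and mult: "?q (f * g) = ?q f \<otimes>\<^bsub>?A\<^esub> ?q g"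
    if "f \<in> polys V" "g \<in> polys V" for f g
    using ring_hom_add[OF hom, of f g] ring_hom_mult[OF hom, of f g] that by simp_all
  show ?thesis
  proof (intro cyclic_module.intro cyclic_module_axioms.intro)
    show "augmented_ideal (polys V) const_coeff I"
      by (rule augmented_ideal_of_ideal[OF I])
    show "module ?R (restrict_scalars ?q (regular_module ?A))"
      by (rule module_criteria[OF cring_poly_ring])
        (use closed A.r_neg in \<open>force simp: add mult one A.a_ac A.m_assoc A.l_distr A.r_distr\<close>)+
    show "I \<subseteq> polys V"
      using a_subset by simp
    show "?q ` polys V = carrier (restrict_scalars ?q (regular_module ?A))"
      by (auto simp: FactRing_def A_RCOSETS_def')
    show "?q f = \<zero>\<^bsub>restrict_scalars ?q (regular_module ?A)\<^esub> \<longleftrightarrow> f \<in> I" if "f \<in> polys V" for f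
      using that poly_ring.a_coset_join1[of V I f] poly_ring.a_coset_join2[of f V I] a_subgroup
      by (auto simp: FactRing_def)
  qed (simp_all add: add mult)
qed

lemma monomial_ideal_genideal:
  fixes V :: "'v set" and F :: "'f set"
  assumes F: "finite F" and G: "\<And>a. a \<in> F \<Longrightarrow> finite (G a)" "\<And>a. a \<in> F \<Longrightarrow> G a \<subseteq> V"
  defines "I \<equiv> genideal (poly_ring V) ((\<lambda>a. single (ind (G a)) (1 :: 'k::field)) ` F)"
  shows "ideal I (poly_ring V)" and "monomial_ideal V I F G"
proof -
  let ?R = "poly_ring V :: ('v, 'k) mpoly ring"
  let ?S = "(\<lambda>a. single (ind (G a)) (1 :: 'k)) ` F"
  have S: "?S \<subseteq> carrier ?R"
    using G(1) G(2)[THEN subsetD] by (auto simp: polys_def keys_ind)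
  show I: "ideal I ?R"
    unfolding I_def by (rule poly_ring.genideal_ideal[OF S])
  interpret augmented_ideal "polys V" const_coeff I
    by (rule augmented_ideal_of_ideal[OF I])
  \<comment> \<open>The polynomials whose monomials are all divisible by generators form an ideal
    containing the generators; minimality of the generated ideal then gives the condition on the
    monomials of \<open>I\<close>.\<close>
  let ?J = "{f \<in> polys V. \<forall>u\<in>keys f. \<exists>a\<in>F. G a \<subseteq> keys u} :: ('v, 'k) mpoly set"
  have mult: "f * g \<in> ?J" if f: "f \<in> ?J" and g: "g \<in> polys V" for f g
  proof -
    have "\<exists>a\<in>F. G a \<subseteq> keys u" if u: "u \<in> keys (f * g)" for u
    proof -
      obtain u1 u2 where "u1 \<in> keys f" "u = u1 + u2"
        using keys_mult[of f g] u by auto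
      then show ?thesis
        using f by (force simp: keys_add_nat)
    qed
    then show ?thesis
      using f g by (auto intro: polys.mult_A)
  qed
  have "ideal ?J ?R"
  proof (rule idealI)
    show "subgroup ?J (add_monoid ?R)"
    proof (rule poly_ring.add.subgroupI)
      show "?J \<noteq> {}"
        using polys.zero_A by force
      show "\<ominus>\<^bsub>?R\<^esub> f \<in> ?J" if "f \<in> ?J" for f
        using that by (auto simp: a_inv_poly_ring polys.uminus_A)
      show "f \<oplus>\<^bsub>?R\<^esub> g \<in> ?J" if "f \<in> ?J" "g \<in> ?J" for f g
        using that Poly_Mapping.keys_add[of f g] by (auto intro: polys.add_A)
    qed auto
  qed (use mult in \<open>auto simp: poly_ring.ring_axioms mult.commute\<close>)
  then have "I \<subseteq> ?J"
    unfolding I_def using G(1) G(2)[THEN subsetD]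
    by (intro poly_ring.genideal_minimal) (auto simp: polys_def keys_ind)
  moreover have "?S \<subseteq> I"
    unfolding I_def by (rule poly_ring.genideal_self[OF S])
  ultimately show "monomial_ideal V I F G"
    by unfold_locales (use F G in auto)
qed

section \<open>Monomials of order-preserving maps, and the comparison of the two posets\<close>

lemma finite_Hom: "finite P \<Longrightarrow> finite Q \<Longrightarrow> finite (Hom P Q)"
  by (rule finite_subset[of _ "P \<rightarrow>\<^sub>E Q"]) (auto simp: Hom_def intro: finite_PiE)

text \<open>The variables dividing the monomial of the map. Only the values on \<open>P\<close> are
  read, so the map may be defined on a larger poset.\<close>

definition graph :: "'p set \<Rightarrow> ('p \<Rightarrow> 'q) \<Rightarrow> ('p \<times> 'q) set" where
  "graph P \<phi> = (\<lambda>p. (p, \<phi> p)) ` P"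

lemma hom_monomial_eq:
  assumes "finite P"
  shows "hom_monomial P \<phi> = (single (ind (graph P \<phi>)) 1 :: ('p \<times> 'q, 'k::field) mpoly)"
proof -
  have "hom_monomial P \<phi> = (\<Prod>v\<in>graph P \<phi>. var v :: ('p \<times> 'q, 'k) mpoly)"
    unfolding hom_monomial_def graph_def by (subst prod.reindex) (auto simp: inj_on_def)
  also have "\<dots> = single (ind (graph P \<phi>)) 1"
    by (rule single_ind) (simp add: graph_def assms)
  finally show ?thesis .
qed

text \<open>\<open>F\<close> is kept apart from \<open>Hom P Q\<close>: it only has to give the same
  generators. For the smaller poset it is instantiated with the maps on the larger one.\<close>

lemma betti_hom_algebra:
  fixes P :: "'p::order set" and Q :: "'q::order set" and F :: "('p \<Rightarrow> 'q) set"
  assumes "finite P" "finite F" and F: "\<And>\<phi>. \<phi> \<in> F \<Longrightarrow> \<phi> ` P \<subseteq> Q"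
    and gens: "graph P ` Hom P Q = graph P ` F"
  shows "monomial_ideal (P \<times> Q) (hom_ideal P Q :: ('p \<times> 'q, 'k::field) mpoly set) F (graph P)"
    and "betti (P \<times> Q) i (hom_algebra_module P Q :: (('p \<times> 'q, 'k) mpoly, _) module)
        + kdim (vecs UNIV (tuples F (Suc i)) :: (('p \<Rightarrow> 'q) list \<Rightarrow> 'k) set)
      = kdim (kcycles (tuples F) (\<lambda>i. red const_coeff (monomial_ideal.taylor (graph P) i) :: _ \<Rightarrow> _ \<Rightarrow> 'k) i)
        + kdim (kcycles (tuples F) (\<lambda>i. red const_coeff (monomial_ideal.taylor (graph P) i) :: _ \<Rightarrow> _ \<Rightarrow> 'k) (Suc i))"
proof -
  let ?R = "poly_ring (P \<times> Q) :: ('p \<times> 'q, 'k) mpoly ring"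
  have "hom_monomial P ` Hom P Q = (\<lambda>\<phi>. single (ind (graph P \<phi>)) (1 :: 'k)) ` F"
    using arg_cong[OF gens, of "\<lambda>Z. (\<lambda>S. single (ind S) (1 :: 'k)) ` Z"]
    by (simp add: image_image hom_monomial_eq[OF assms(1)])
  then have I: "hom_ideal P Q = genideal ?R ((\<lambda>\<phi>. single (ind (graph P \<phi>)) 1) ` F)"
    by (simp add: hom_ideal_def)
  have G: "finite (graph P \<phi>)" "graph P \<phi> \<subseteq> P \<times> Q" if "\<phi> \<in> F" for \<phi>
    using F[OF that] assms(1) by (auto simp: graph_def)
  note m = monomial_ideal_genideal[where 'k = 'k, of F "graph P" "P \<times> Q", OF assms(2) G, folded I]
  show "monomial_ideal (P \<times> Q) (hom_ideal P Q :: ('p \<times> 'q, 'k) mpoly set) F (graph P)"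
    by (rule m(2))
  interpret M: monomial_ideal "P \<times> Q" "hom_ideal P Q :: ('p \<times> 'q, 'k) mpoly set" F "graph P"
    by (rule m(2))
  interpret X: cyclic_module "P \<times> Q" "hom_ideal P Q" "hom_algebra_module P Q :: (('p \<times> 'q, 'k) mpoly, _) module"
    "\<lambda>f. hom_ideal P Q +>\<^bsub>?R\<^esub> f"
    unfolding hom_algebra_module_def hom_algebra_def by (rule cyclic_module_quotient[OF m(1)])
  show "betti (P \<times> Q) i (hom_algebra_module P Q :: (('p \<times> 'q, 'k) mpoly, _) module)
        + kdim (vecs UNIV (tuples F (Suc i)) :: (('p \<Rightarrow> 'q) list \<Rightarrow> 'k) set)
      = kdim (kcycles (tuples F) (\<lambda>i. red const_coeff (M.taylor i)) i)
        + kdim (kcycles (tuples F) (\<lambda>i. red const_coeff (M.taylor i)) (Suc i))"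
    by (rule X.betti_mat_resolution[OF M.taylor_resolution])
qed

theorem proposition3p10:
  fixes P P' :: "'p::order set" and Q :: "'q::order set" and i :: nat
  assumes "finite P" and "P \<noteq> {}" and "finite Q" and "Q \<noteq> {}"
    and "P' \<subseteq> P" and "P' \<noteq> {}"
    and extend: "\<And>\<phi>. \<phi> \<in> Hom P' Q \<Longrightarrow> \<exists>\<psi>\<in>Hom P Q. \<forall>p\<in>P'. \<psi> p = \<phi> p"
  shows "betti (P \<times> Q) i (hom_algebra_module P Q :: (('p \<times> 'q, 'k::field) mpoly, _) module)
       \<ge> betti (P' \<times> Q) i (hom_algebra_module P' Q :: (('p \<times> 'q, 'k) mpoly, _) module)"
proof -
  let ?F = "Hom P Q"
  have F: "finite ?F"
    by (rule finite_Hom) fact+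
  have fin': "finite P'"
    using assms(1,5) by (rule finite_subset[rotated])
  have img: "\<phi> ` P \<subseteq> Q" if "\<phi> \<in> ?F" for \<phi>
    using that by (auto simp: Hom_def)
  then have img': "\<phi> ` P' \<subseteq> Q" if "\<phi> \<in> ?F" for \<phi>
    using that assms(5) by blast
  \<comment> \<open>The only place where the extension hypothesis enters; the converse inclusion
    restricts maps from \<open>P\<close> to \<open>P'\<close>.\<close>
  have gens: "graph P' ` Hom P' Q = graph P' ` ?F"
  proof (intro equalityI image_subsetI)
    fix \<phi> assume "\<phi> \<in> Hom P' Q"
    then obtain \<psi> where "\<psi> \<in> ?F" "\<forall>p\<in>P'. \<psi> p = \<phi> p"
      using extend by blast
    then show "graph P' \<phi> \<in> graph P' ` ?F"
      by (intro image_eqI[of _ _ \<psi>]) (auto simp: graph_def)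
  next
    fix \<psi> assume "\<psi> \<in> ?F"
    then have "mono_on P' \<psi>" "\<psi> \<in> P \<rightarrow>\<^sub>E Q"
      using mono_on_subset[OF _ assms(5)] by (auto simp: Hom_def)
    then have "restrict \<psi> P' \<in> Hom P' Q"
      using assms(5) by (auto simp: Hom_def mono_on_def)
    then show "graph P' \<psi> \<in> graph P' ` Hom P' Q"
      by (intro image_eqI[of _ _ "restrict \<psi> P'"]) (auto simp: graph_def)
  qed
  note b = betti_hom_algebra[where 'k = 'k, OF assms(1) F img refl]
    and b' = betti_hom_algebra[where 'k = 'k, OF fin' F img' gens]
  interpret M: monomial_ideal "P \<times> Q" "hom_ideal P Q :: ('p \<times> 'q, 'k) mpoly set" ?F "graph P"
    by (rule b(1))
  interpret M': monomial_ideal "P' \<times> Q" "hom_ideal P' Q :: ('p \<times> 'q, 'k) mpoly set" ?F "graph P'"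
    by (rule b'(1))
  \<comment> \<open>Hence tuples with equal supports for \<open>P\<close> also have equal supports
    for \<open>P'\<close>: a sign surviving for \<open>P\<close> survives for
    \<open>P'\<close>.\<close>
  have support: "M'.support t = M.support t \<inter> P' \<times> UNIV" for t
    using assms(5) by (auto simp: M.support_def M'.support_def graph_def)
  let ?C = "\<lambda>j. red const_coeff (M.taylor j) :: _ \<Rightarrow> _ \<Rightarrow> 'k" and ?C' = "\<lambda>j. red const_coeff (M'.taylor j) :: _ \<Rightarrow> _ \<Rightarrow> 'k"
  have cycles: "kdim (kcycles (tuples ?F) ?C' j) \<le> kdim (kcycles (tuples ?F) ?C j)" for j
  proof (cases j)
    case (Suc k)
    have "kdim {x \<in> vecs UNIV (tuples ?F (Suc k)). lin_ext (tuples ?F (Suc k)) (?C' k) x = (\<lambda>_. 0)}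
      \<le> kdim {x \<in> vecs UNIV (tuples ?F (Suc k)). lin_ext (tuples ?F (Suc k)) (?C k) x = (\<lambda>_. 0)}"
    \<comment> \<open>The cardinality of the support is the degree of the squarefree least common
      multiple for \<open>P\<close>; it grades the source and the target alike.\<close>
    proof (rule kdim_kernel_filtration[where v = "\<lambda>t. card (M.support t)" and w = "\<lambda>s. card (M.support s)"])
      show "finite (tuples ?F (Suc k))"
        by (rule finite_tuples[OF F])
      fix t s assume t: "t \<in> tuples ?F (Suc k)"
      note fin = M.finite_support[OF t]
      show "?C k t s = (if card (M.support s) = card (M.support t) then ?C' k t s else 0)"
      proof (cases "(incidence t s :: 'k) = 0")
        case False
        then have sub: "M.support s \<subseteq> M.support t"
          by (rule M.incidence_support)
        \<comment> \<open>For a face the supports are nested, so equal cardinality forces equality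
          and a numerical filtration detects equal least common multiples.\<close>
        then have "card (M.support s) = card (M.support t) \<longleftrightarrow> M.support t \<subseteq> M.support s"
          using card_subset_eq[OF fin sub] by auto
        then show ?thesis
          by (auto simp: M.red_taylor[OF t] M'.red_taylor[OF t] support)
      qed (simp add: M.red_taylor[OF t] M'.red_taylor[OF t])
      \<comment> \<open>A nonzero entry for \<open>P'\<close> still requires \<open>s\<close> to be
        a face of \<open>t\<close>, whose support for \<open>P\<close> is then no larger.\<close>
      show "card (M.support s) \<le> card (M.support t)" if "?C' k t s \<noteq> 0"
        using that M.incidence_support[of t s] fin
        by (intro card_mono) (auto simp: M'.red_taylor[OF t] split: if_splits)
    qed
    then show ?thesis
      by (simp add: Suc)
  qed simp
  show ?thesis
    \<comment> \<open>Both equations contain the same rank in degree \<open>Suc i\<close>, as the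
      bases coincide; it cancels, leaving the two inequalities between kernels.\<close>
    using b(2)[of i] b'(2)[of i] cycles[of i] cycles[of "Suc i"] by linarith
qed

end
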